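(* Let $(X,d,\mu)$ be a locally compact, separable, doubling metric measure space with $\operatorname{supp}\mu=X$, let $\mathcal V\to X$ be a Euclidean vector bundle of finite rank, and let $A$ be a nonnegative self-adjoint operator on $L^2(X;\mathcal V)$ satisfying ultracontractivity (A1), the Davies--Gaffney estimates (A2) and the local Weyl law (A3) (all spelled out in the context). Let $\omega\subset X$ be measurable with $\mu(\omega)>0$. Let $T\in(0,+\infty)$ and let $h\in\mathcal O([0,T])$ be an admissible weight satisfying $$\forall f\in L^2(X;\mathcal V),\qquad\int_0^Th(t)\,\|e^{-tA}f\|_{L^2(X;\mathcal V)}^2\,dt\le\int_0^T\|e^{-tA}f\|_{L^2(\omega;\mathcal V)}^2\,dt.$$ Set $H_T(\lambda)=\Big(\int_0^Th(t)e^{-2t\lambda}\,dt\Big)^{1/2}$ for $\lambda\ge0$, and let $\mathcal L(\omega)\in[0,+\infty]$ be the essential maximal distance to $\omega$. If $\mathcal L(\omega)<+\infty$, then for every $0<\beta<1$ there exists $A'_{T,\beta}>0$ such that $$\forall\lambda\ge0,\qquad H_T(\lambda)\le A'_{T,\beta}\,e^{-\beta\mathcal L(\omega)\sqrt\lambda}.$$ If $\mathcal L(\omega)=+\infty$, then for every $R>0$ and every $0<\beta<1$ there exists $A'_{T,R,\beta}>0$ such that $H_T(\lambda)\le A'_{T,R,\beta}\,e^{-\beta R\sqrt\lambda}$ for all $\lambda\ge0$.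
   Context: **Space and bundle.** $(X,d,\mu)$ is a locally compact separable metric space with a Radon measure $\mu$, $\operatorname{supp}\mu=X$, $0<\mu(B(x,r))<+\infty$ for all $x\in X$, $r>0$, and there is $C_D>0$ with $\mu(B(x,2r))\le C_D\,\mu(B(x,r))$ for all $x\in X$, $r>0$ (doubling). $\mathcal V\to X$ is a vector bundle of finite rank $r_{\mathcal V}$ with fiberwise inner products $\langle\cdot,\cdot\rangle_{\mathcal V_x}$; $L^p(X;\mathcal V)$ are the $L^p$ sections; $\|\cdot\|_{p\to q}$ is the operator norm $L^p(X;\mathcal V)\to L^q(X;\mathcal V)$; $\mathcal L(\mathcal V_y,\mathcal V_x)$ denotes linear maps. **$\Delta$-a.e.** A property of pairs $(x,y)$ holds $\Delta$-a.e. if there is a $\mu$-null set $N\subset X$ such that it holds for all $(x,y)\in(X\setminus N)^2$. A kernel $K(x,y)\in\mathcal L(\mathcal V_y,\mathcal V_x)$ defined up to $\Delta$-a.e. equality has a diagonal $K(x,x)$ well defined for $\mu$-a.e. $x$. **Assumptions on the nonnegative self-adjoint operator $A$ on $L^2(X;\mathcal V)$.** (A1) For every $t>0$, $e^{-tA}$ is bounded $L^2(X;\mathcal V)\to L^\infty(X;\mathcal V)$, and there are $\alpha_1>0$, $C>0$ with $\|e^{-tA}\|_{2\to\infty}\le C\,t^{-\alpha_1/2}$ for all $t\in(0,1]$. (A2) For all measurable $E,F\subset X$ and $t>0$, $\|1_Fe^{-tA}1_E\|_{L^2\to L^2}\le e^{-d(E,F)^2/(4t)}$. (A3) There are $\alpha_2>0$,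 a slowly varying function $\chi_2:[0,+\infty)\to(0,+\infty)$ (i.e. $\chi_2(a\lambda)/\chi_2(\lambda)\to1$ as $\lambda\to+\infty$ for every $a>0$) and a measurable $c:X\to(0,+\infty)$ such that for $\mu$-a.e. $x$, $E_x(\lambda)\sim c(x)\lambda^{\alpha_2}\chi_2(\lambda)$ as $\lambda\to+\infty$, where $E_x(\lambda)=\mathrm{Tr}_{\mathcal V_x}\big(K_{1_{[0,\lambda]}(A)}(x,x)\big)$ and $K_{1_{[0,\lambda]}(A)}$ is the integral kernel of $1_{[0,\lambda]}(A)$, made precise as follows. Under (A1), there is a unique (up to $\Delta$-a.e. equality) family $(p_t)_{t>0}$ of $\Delta$-essentially bounded kernels with $(e^{-tA}f)(x)=\int_Xp_t(x,y)f(y)\,d\mu(y)$ for a.e. $x$ and all $f\in L^2$, $p_t(x,y)=p_t(y,x)^*$ and $p_{t+s}(x,y)=\int_Xp_t(x,z)p_s(z,y)\,d\mu(z)$ $\Delta$-a.e. Put $P_{t,x}:\mathcal V_x\to L^2(X;\mathcal V)$, $(P_{t,x}u)(y)=p_t(y,x)u$. For bounded Borel compactly supported $\phi$, the kernel of $\phi(A)$ is, $\Delta$-a.e., $K_{\phi(A)}(x,y)=P_{t/2,x}^*\,\phi(A)e^{tA}\,P_{t/2,y}$ (independent of $t>0$). **Essential distance.** $d_{\mathrm{ess}}(x,\omega)=\sup\{r>0:\mu(B(x,r)\cap\omega)=0\}$ with $\sup\emptyset=0$, and $\mathcal L(\omega)=\sup_{x\in X}d_{\mathrm{ess}}(x,\omega)\in[0,+\infty]$.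 **Admissible weights.** $\mathcal O([0,T])$ is the set of bounded continuous $h:[0,T)\to[0,+\infty)$ for which there is $\tau_h\in(0,T)$ such that $h$ is nondecreasing on $[0,\tau_h]$. *)

theory Defs
  imports "HOL-Analysis.Analysis" "HOL-Library.Landau_Symbols"
begin

section \<open>The metric measure space\<close>

definition radon_measure :: "'x::metric_space measure \<Rightarrow> bool" where
  "radon_measure M \<longleftrightarrow> sets M = sets borel \<and>
     (\<forall>K. compact K \<longrightarrow> emeasure M K < \<infinity>) \<and>
     (\<forall>S\<in>sets borel. emeasure M S = (INF U\<in>{U. open U \<and> S \<subseteq> U}. emeasure M U)) \<and>
     (\<forall>U. open U \<longrightarrow> emeasure M U = (SUP K\<in>{K. compact K \<and> K \<subseteq> U}. emeasure M K))"

definition msupport :: "'x::metric_space measure \<Rightarrow> 'x set" where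
  "msupport M = {x. \<forall>U. open U \<and> x \<in> U \<longrightarrow> 0 < emeasure M U}"

definition doubling :: "'x::metric_space measure \<Rightarrow> bool" where
  "doubling M \<longleftrightarrow> (\<exists>C>0. \<forall>x r. 0 < r \<longrightarrow>
     emeasure M (ball x (2 * r)) \<le> ennreal C * emeasure M (ball x r))"

definition ess_dist :: "'x::metric_space measure \<Rightarrow> 'x set \<Rightarrow> 'x \<Rightarrow> ennreal" where
  \<comment> \<open>In \<^typ>\<open>ennreal\<close> the supremum of the empty set is 0.\<close>
  "ess_dist M \<omega> x = (SUP r\<in>{r::real. 0 < r \<and> emeasure M (ball x r \<inter> \<omega>) = 0}. ennreal r)"

definition max_ess_dist :: "'x::metric_space measure \<Rightarrow> 'x set \<Rightarrow> ennreal" where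
  "max_ess_dist M \<omega> = (SUP x. ess_dist M \<omega> x)"

definition delta_AE :: "'x measure \<Rightarrow> ('x \<Rightarrow> 'x \<Rightarrow> bool) \<Rightarrow> bool" where
  "delta_AE M P \<longleftrightarrow> (\<exists>N\<in>null_sets M. \<forall>x y. x \<notin> N \<and> y \<notin> N \<longrightarrow> P x y)"


section \<open>Euclidean vector bundles and their sections\<close>

text \<open>
  A bundle over \<^typ>\<open>'x\<close> is given by its fibres, fibrewise inner products, and an atlas of local
  trivialisations \<open>\<phi> : U \<times> 'e \<rightarrow> V\<close>, where the dimension of \<^typ>\<open>'e\<close> is the rank.
  All fibres are subspaces of one vector space \<^typ>\<open>'v\<close>. This is no restriction, since any
  family of vector spaces embeds into its direct sum: \<^typ>\<open>'v\<close> carries no topology, fibres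
  over different points are unrelated, and the topology of the bundle is encoded in
  the continuity of the transition maps.
\<close>

record ('x, 'v, 'e) vbundle =
  fibre :: "'x \<Rightarrow> 'v set"
  ip :: "'x \<Rightarrow> 'v \<Rightarrow> 'v \<Rightarrow> real"
  charts :: "('x set \<times> ('x \<Rightarrow> 'e \<Rightarrow> 'v)) set"

definition inner_product_on :: "'v::real_vector set \<Rightarrow> ('v \<Rightarrow> 'v \<Rightarrow> real) \<Rightarrow> bool" where
  "inner_product_on V b \<longleftrightarrow>
     (\<forall>u\<in>V. \<forall>v\<in>V. b u v = b v u) \<and>
     (\<forall>u\<in>V. \<forall>v\<in>V. \<forall>w\<in>V. b (u + v) w = b u w + b v w) \<and>
     (\<forall>a. \<forall>u\<in>V. \<forall>v\<in>V. b (a *\<^sub>R u) v = a * b u v) \<and>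
     (\<forall>u\<in>V. u \<noteq> 0 \<longrightarrow> 0 < b u u)"

definition euclidean_bundle ::
    "('x::topological_space, 'v::real_vector, 'e::euclidean_space) vbundle \<Rightarrow> bool" where
  "euclidean_bundle B \<longleftrightarrow>
     (\<forall>x. subspace (fibre B x) \<and> inner_product_on (fibre B x) (ip B x)) \<and>
     (\<Union>(U, \<phi>)\<in>charts B. U) = UNIV \<and>
     (\<forall>(U, \<phi>)\<in>charts B. open U \<and>
        (\<forall>x\<in>U. linear (\<phi> x) \<and> bij_betw (\<phi> x) UNIV (fibre B x)) \<and>
        (\<forall>a b. continuous_on U (\<lambda>x. ip B x (\<phi> x a) (\<phi> x b)))) \<and>
     (\<forall>(U, \<phi>)\<in>charts B. \<forall>(W, \<psi>)\<in>charts B. \<forall>a.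
        continuous_on (U \<inter> W) (\<lambda>x. inv (\<psi> x) (\<phi> x a)))"

definition fnorm :: "('x, 'v, 'e) vbundle \<Rightarrow> 'x \<Rightarrow> 'v \<Rightarrow> real" where
  "fnorm B x v = sqrt (ip B x v v)"

definition measurable_section ::
    "('x, 'v::real_vector, 'e::euclidean_space) vbundle \<Rightarrow> 'x measure \<Rightarrow> ('x \<Rightarrow> 'v) \<Rightarrow> bool" where
  "measurable_section B M f \<longleftrightarrow> (\<forall>x. f x \<in> fibre B x) \<and>
     (\<forall>(U, \<phi>)\<in>charts B. (\<lambda>x. inv (\<phi> x) (f x)) \<in> borel_measurable (restrict_space M U))"

text \<open>
  Elements of \<open>L\<^sup>2\<close> are represented by functions; operators respect almost everywhere equality.
\<close>

definition L2 ::
    "('x, 'v::real_vector, 'e::euclidean_space) vbundle \<Rightarrow> 'x measure \<Rightarrow> ('x \<Rightarrow> 'v) set" where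
  "L2 B M = {f. measurable_section B M f \<and> integrable M (\<lambda>x. ip B x (f x) (f x))}"

definition l2inner ::
    "('x, 'v, 'e) vbundle \<Rightarrow> 'x measure \<Rightarrow> ('x \<Rightarrow> 'v) \<Rightarrow> ('x \<Rightarrow> 'v) \<Rightarrow> real" where
  "l2inner B M f g = (LINT x|M. ip B x (f x) (g x))"

definition l2norm :: "('x, 'v, 'e) vbundle \<Rightarrow> 'x measure \<Rightarrow> ('x \<Rightarrow> 'v) \<Rightarrow> real" where
  "l2norm B M f = sqrt (l2inner B M f f)"

definition cutoff :: "'x set \<Rightarrow> ('x \<Rightarrow> 'v::real_vector) \<Rightarrow> 'x \<Rightarrow> 'v" where
  "cutoff E f = (\<lambda>x. indicat_real E x *\<^sub>R f x)"


section \<open>Self-adjoint operators and functional calculus\<close>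

text \<open>
  An unbounded operator is given by its domain \<open>D\<close> and a map \<open>A\<close>. In \<open>selfadjoint_op\<close>, the right-hand
  side of the last equivalence says that \<open>g\<close> lies in the domain of the adjoint and is mapped to \<open>k\<close>.
\<close>

definition densely_defined_op ::
    "('x, 'v::real_vector, 'e::euclidean_space) vbundle \<Rightarrow> 'x measure \<Rightarrow> ('x \<Rightarrow> 'v) set \<Rightarrow>
     (('x \<Rightarrow> 'v) \<Rightarrow> ('x \<Rightarrow> 'v)) \<Rightarrow> bool" where
  "densely_defined_op B M D A \<longleftrightarrow>
     D \<subseteq> L2 B M \<and> A ` D \<subseteq> L2 B M \<and>
     (\<forall>f\<in>D. \<forall>g\<in>L2 B M. (AE x in M. f x = g x) \<longrightarrow> g \<in> D \<and> (AE x in M. A f x = A g x)) \<and>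
     (\<forall>a. \<forall>f\<in>D. \<forall>g\<in>D. (\<lambda>x. a *\<^sub>R f x + g x) \<in> D \<and>
        (AE x in M. A (\<lambda>x. a *\<^sub>R f x + g x) x = a *\<^sub>R A f x + A g x)) \<and>
     (\<forall>f\<in>L2 B M. \<forall>\<epsilon>>0. \<exists>g\<in>D. l2norm B M (\<lambda>x. f x - g x) < \<epsilon>)"

definition selfadjoint_op ::
    "('x, 'v::real_vector, 'e::euclidean_space) vbundle \<Rightarrow> 'x measure \<Rightarrow> ('x \<Rightarrow> 'v) set \<Rightarrow>
     (('x \<Rightarrow> 'v) \<Rightarrow> ('x \<Rightarrow> 'v)) \<Rightarrow> bool" where
  "selfadjoint_op B M D A \<longleftrightarrow> densely_defined_op B M D A \<and>
     (\<forall>g\<in>L2 B M. \<forall>k\<in>L2 B M.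
        (g \<in> D \<and> (AE x in M. A g x = k x)) \<longleftrightarrow> (\<forall>f\<in>D. l2inner B M (A f) g = l2inner B M f k))"

definition nonneg_op ::
    "('x, 'v, 'e) vbundle \<Rightarrow> 'x measure \<Rightarrow> ('x \<Rightarrow> 'v) set \<Rightarrow> (('x \<Rightarrow> 'v) \<Rightarrow> ('x \<Rightarrow> 'v)) \<Rightarrow> bool" where
  "nonneg_op B M D A \<longleftrightarrow> (\<forall>f\<in>D. 0 \<le> l2inner B M (A f) f)"

definition bounded_borel :: "(real \<Rightarrow> real) set" where
  "bounded_borel = {\<phi>. \<phi> \<in> borel_measurable borel \<and> bounded (\<phi> ` {0..})}"

text \<open>
  \<open>functional_calculus B M D A \<Phi>\<close> states that \<open>\<Phi> \<phi>\<close> is \<open>\<phi>(A)\<close> for all Borel \<open>\<phi>\<close> bounded on \<open>[0,\<infinity>)\<close>,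
  which contains the spectrum of \<open>A\<close>. By the spectral theorem (functional calculus form, see Reed and
  Simon, Methods of Modern Mathematical Physics I, Theorem VIII.5), every nonnegative
  self-adjoint \<open>A\<close> has such a \<open>\<Phi>\<close>, and \<open>A\<close> determines it uniquely up to almost everywhere equality.
\<close>

definition functional_calculus ::
    "('x, 'v::real_vector, 'e::euclidean_space) vbundle \<Rightarrow> 'x measure \<Rightarrow> ('x \<Rightarrow> 'v) set \<Rightarrow>
     (('x \<Rightarrow> 'v) \<Rightarrow> ('x \<Rightarrow> 'v)) \<Rightarrow> ((real \<Rightarrow> real) \<Rightarrow> ('x \<Rightarrow> 'v) \<Rightarrow> ('x \<Rightarrow> 'v)) \<Rightarrow> bool" where
  "functional_calculus B M D A \<Phi> \<longleftrightarrow>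
     (\<forall>\<phi>\<in>bounded_borel.
        \<Phi> \<phi> ` L2 B M \<subseteq> L2 B M \<and>
        (\<forall>a. \<forall>f\<in>L2 B M. \<forall>g\<in>L2 B M.
           AE x in M. \<Phi> \<phi> (\<lambda>x. a *\<^sub>R f x + g x) x = a *\<^sub>R \<Phi> \<phi> f x + \<Phi> \<phi> g x) \<and>
        (\<forall>f\<in>L2 B M. \<forall>g\<in>L2 B M. l2inner B M (\<Phi> \<phi> f) g = l2inner B M f (\<Phi> \<phi> g)) \<and>
        (\<forall>C. (\<forall>l\<ge>0. \<bar>\<phi> l\<bar> \<le> C) \<longrightarrow> (\<forall>f\<in>L2 B M. l2norm B M (\<Phi> \<phi> f) \<le> C * l2norm B M f))) \<and>
     (\<forall>\<phi>\<in>bounded_borel. \<forall>\<psi>\<in>bounded_borel. \<forall>f\<in>L2 B M.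
        (\<forall>a. AE x in M. \<Phi> (\<lambda>l. a * \<phi> l + \<psi> l) f x = a *\<^sub>R \<Phi> \<phi> f x + \<Phi> \<psi> f x) \<and>
        (AE x in M. \<Phi> (\<lambda>l. \<phi> l * \<psi> l) f x = \<Phi> \<phi> (\<Phi> \<psi> f) x)) \<and>
     (\<forall>f\<in>L2 B M. AE x in M. \<Phi> (\<lambda>_. 1) f x = f x) \<and>
     (\<forall>\<phi> \<psi> C. range \<phi> \<subseteq> bounded_borel \<and> \<psi> \<in> bounded_borel \<and>
        (\<forall>n. \<forall>l\<ge>0. \<bar>\<phi> n l\<bar> \<le> C) \<and> (\<forall>l\<ge>0. (\<lambda>n. \<phi> n l) \<longlonglongrightarrow> \<psi> l) \<longrightarrow>
        (\<forall>f\<in>L2 B M. (\<lambda>n. l2norm B M (\<lambda>x. \<Phi> (\<phi> n) f x - \<Phi> \<psi> f x)) \<longlonglongrightarrow> 0)) \<and>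
     (\<forall>\<phi>. range \<phi> \<subseteq> bounded_borel \<and>
        (\<forall>n. \<forall>l\<ge>0. \<bar>\<phi> n l\<bar> \<le> l) \<and> (\<forall>l\<ge>0. (\<lambda>n. \<phi> n l) \<longlonglongrightarrow> l) \<longrightarrow>
        (\<forall>f\<in>D. (\<lambda>n. l2norm B M (\<lambda>x. \<Phi> (\<phi> n) f x - A f x)) \<longlonglongrightarrow> 0))"

text \<open>The value of \<^term>\<open>\<lambda>l. exp (- t * l)\<close> at negative arguments is irrelevant.\<close>

definition heat ::
    "((real \<Rightarrow> real) \<Rightarrow> ('x \<Rightarrow> 'v) \<Rightarrow> ('x \<Rightarrow> 'v)) \<Rightarrow> real \<Rightarrow> ('x \<Rightarrow> 'v) \<Rightarrow> ('x \<Rightarrow> 'v)" where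
  "heat \<Phi> t = \<Phi> (\<lambda>l. exp (- t * l))"


section \<open>Heat kernel and spectral kernels\<close>

text \<open>
  Integrals with values in a fibre are expressed by pairing with an arbitrary vector of that
  (finite-dimensional) fibre.
\<close>

definition kernel ::
    "('x, 'v::real_vector, 'e::euclidean_space) vbundle \<Rightarrow> 'x measure \<Rightarrow>
     ('x \<Rightarrow> 'x \<Rightarrow> 'v \<Rightarrow> 'v) \<Rightarrow> bool" where
  "kernel B M K \<longleftrightarrow>
     (\<forall>x y. K x y ` fibre B y \<subseteq> fibre B x \<and>
        (\<forall>a. \<forall>u\<in>fibre B y. \<forall>v\<in>fibre B y. K x y (a *\<^sub>R u + v) = a *\<^sub>R K x y u + K x y v)) \<and>
     (\<forall>(U, \<phi>)\<in>charts B. \<forall>(W, \<psi>)\<in>charts B. \<forall>a.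
        (\<lambda>(x, y). inv (\<phi> x) (K x y (\<psi> y a))) \<in> borel_measurable (restrict_space (M \<Otimes>\<^sub>M M) (U \<times> W)))"

definition heat_kernel ::
    "('x, 'v::real_vector, 'e::euclidean_space) vbundle \<Rightarrow> 'x measure \<Rightarrow>
     ((real \<Rightarrow> real) \<Rightarrow> ('x \<Rightarrow> 'v) \<Rightarrow> ('x \<Rightarrow> 'v)) \<Rightarrow> (real \<Rightarrow> 'x \<Rightarrow> 'x \<Rightarrow> 'v \<Rightarrow> 'v) \<Rightarrow> bool" where
  "heat_kernel B M \<Phi> p \<longleftrightarrow>
     (\<forall>t>0. kernel B M (p t) \<and>
        (\<exists>C. delta_AE M (\<lambda>x y. \<forall>v\<in>fibre B y. fnorm B x (p t x y v) \<le> C * fnorm B y v)) \<and>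
        (\<forall>f\<in>L2 B M. AE x in M. \<forall>u\<in>fibre B x.
           integrable M (\<lambda>y. ip B x (p t x y (f y)) u) \<and>
           ip B x (heat \<Phi> t f x) u = (LINT y|M. ip B x (p t x y (f y)) u)) \<and>
        delta_AE M (\<lambda>x y. \<forall>v\<in>fibre B y. \<forall>u\<in>fibre B x.
           ip B x (p t x y v) u = ip B y v (p t y x u))) \<and>
     (\<forall>t>0. \<forall>s>0. delta_AE M (\<lambda>x y. \<forall>v\<in>fibre B y. \<forall>u\<in>fibre B x.
        integrable M (\<lambda>z. ip B x (p t x z (p s z y v)) u) \<and>
        ip B x (p (t + s) x y v) u = (LINT z|M. ip B x (p t x z (p s z y v)) u)))"

definition Pop :: "(real \<Rightarrow> 'x \<Rightarrow> 'x \<Rightarrow> 'v \<Rightarrow> 'v) \<Rightarrow> real \<Rightarrow> 'x \<Rightarrow> 'v \<Rightarrow> 'x \<Rightarrow> 'v" where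
  "Pop p t x u = (\<lambda>y. p t y x u)"

definition Pop_adj ::
    "('x, 'v, 'e) vbundle \<Rightarrow> 'x measure \<Rightarrow> (real \<Rightarrow> 'x \<Rightarrow> 'x \<Rightarrow> 'v \<Rightarrow> 'v) \<Rightarrow>
     real \<Rightarrow> 'x \<Rightarrow> ('x \<Rightarrow> 'v) \<Rightarrow> 'v" where
  "Pop_adj B M p t x g =
     (THE w. w \<in> fibre B x \<and> (\<forall>u\<in>fibre B x. ip B x w u = l2inner B M g (Pop p t x u)))"

text \<open>
  The kernel of \<open>\<phi>(A)\<close>, where \<open>\<phi>(A) e\<^sup>t\<^sup>A\<close> is the operator associated with the function
  \<^term>\<open>\<lambda>l. \<phi> l * exp (t * l)\<close>, which is bounded if \<open>\<phi>\<close> is bounded with compact support.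
\<close>

definition calc_kernel ::
    "('x, 'v, 'e) vbundle \<Rightarrow> 'x measure \<Rightarrow> ((real \<Rightarrow> real) \<Rightarrow> ('x \<Rightarrow> 'v) \<Rightarrow> ('x \<Rightarrow> 'v)) \<Rightarrow>
     (real \<Rightarrow> 'x \<Rightarrow> 'x \<Rightarrow> 'v \<Rightarrow> 'v) \<Rightarrow> real \<Rightarrow> (real \<Rightarrow> real) \<Rightarrow> 'x \<Rightarrow> 'x \<Rightarrow> 'v \<Rightarrow> 'v" where
  "calc_kernel B M \<Phi> p t \<phi> x y v =
     Pop_adj B M p (t / 2) x (\<Phi> (\<lambda>l. \<phi> l * exp (t * l)) (Pop p (t / 2) y v))"

definition trace_on :: "'v::real_vector set \<Rightarrow> ('v \<Rightarrow> 'v) \<Rightarrow> real" where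
  \<comment> \<open>The trace of an endomorphism of the finite-dimensional subspace \<open>V\<close>; the basis is immaterial.\<close>
  "trace_on V L =
     (let b = (SOME b. independent b \<and> span b = V) in \<Sum>v\<in>b. representation b (L v) v)"

definition local_counting ::
    "('x, 'v::real_vector, 'e) vbundle \<Rightarrow> 'x measure \<Rightarrow> ((real \<Rightarrow> real) \<Rightarrow> ('x \<Rightarrow> 'v) \<Rightarrow> ('x \<Rightarrow> 'v)) \<Rightarrow>
     (real \<Rightarrow> 'x \<Rightarrow> 'x \<Rightarrow> 'v \<Rightarrow> 'v) \<Rightarrow> real \<Rightarrow> 'x \<Rightarrow> real \<Rightarrow> real" where
  "local_counting B M \<Phi> p t x l =
     trace_on (fibre B x) (calc_kernel B M \<Phi> p t (indicat_real {0..l}) x x)"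


section \<open>The assumptions on the operator\<close>

definition bounded_2_inf ::
    "('x, 'v::real_vector, 'e::euclidean_space) vbundle \<Rightarrow> 'x measure \<Rightarrow>
     (('x \<Rightarrow> 'v) \<Rightarrow> ('x \<Rightarrow> 'v)) \<Rightarrow> real \<Rightarrow> bool" where
  \<comment> \<open>\<open>S\<close> maps \<open>L\<^sup>2\<close> to \<open>L\<^sup>\<infinity>\<close> with operator norm at most \<open>C\<close>.\<close>
  "bounded_2_inf B M S C \<longleftrightarrow>
     (\<forall>f\<in>L2 B M. AE x in M. fnorm B x (S f x) \<le> C * l2norm B M f)"

definition ultracontractive ::
    "('x, 'v::real_vector, 'e::euclidean_space) vbundle \<Rightarrow> 'x measure \<Rightarrow>
     ((real \<Rightarrow> real) \<Rightarrow> ('x \<Rightarrow> 'v) \<Rightarrow> ('x \<Rightarrow> 'v)) \<Rightarrow> bool" where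
  "ultracontractive B M \<Phi> \<longleftrightarrow>
     (\<forall>t>0. \<exists>C. bounded_2_inf B M (heat \<Phi> t) C) \<and>
     (\<exists>\<alpha>\<^sub>1>0. \<exists>C>0. \<forall>t. 0 < t \<and> t \<le> 1 \<longrightarrow>
        bounded_2_inf B M (heat \<Phi> t) (C * t powr (- \<alpha>\<^sub>1 / 2)))"

text \<open>
  If \<open>E\<close> or \<open>F\<close> is empty, then \<^const>\<open>setdist\<close> is 0 rather than infinite; this is harmless, as
  the operator on the left-hand side is then zero.
\<close>

definition davies_gaffney ::
    "('x::metric_space, 'v::real_vector, 'e::euclidean_space) vbundle \<Rightarrow> 'x measure \<Rightarrow>
     ((real \<Rightarrow> real) \<Rightarrow> ('x \<Rightarrow> 'v) \<Rightarrow> ('x \<Rightarrow> 'v)) \<Rightarrow> bool" where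
  "davies_gaffney B M \<Phi> \<longleftrightarrow>
     (\<forall>E\<in>sets M. \<forall>F\<in>sets M. \<forall>t>0. \<forall>f\<in>L2 B M.
        l2norm B M (cutoff F (heat \<Phi> t (cutoff E f))) \<le>
        exp (- (setdist E F)\<^sup>2 / (4 * t)) * l2norm B M f)"

definition slowly_varying :: "(real \<Rightarrow> real) \<Rightarrow> bool" where
  "slowly_varying \<kappa> \<longleftrightarrow> (\<forall>l\<ge>0. 0 < \<kappa> l) \<and>
     (\<forall>a>0. ((\<lambda>l. \<kappa> (a * l) / \<kappa> l) \<longlongrightarrow> 1) at_top)"

text \<open>
  Up to a null set of points \<open>x\<close> independent of \<open>l\<close>, the quantity \<open>local_counting B M \<Phi> p t x l\<close>
  does not depend on the auxiliary parameter \<open>t\<close>.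
\<close>

definition local_weyl_law ::
    "('x, 'v::real_vector, 'e::euclidean_space) vbundle \<Rightarrow> 'x measure \<Rightarrow>
     ((real \<Rightarrow> real) \<Rightarrow> ('x \<Rightarrow> 'v) \<Rightarrow> ('x \<Rightarrow> 'v)) \<Rightarrow> (real \<Rightarrow> 'x \<Rightarrow> 'x \<Rightarrow> 'v \<Rightarrow> 'v) \<Rightarrow> bool" where
  "local_weyl_law B M \<Phi> p \<longleftrightarrow>
     (\<exists>\<alpha>\<^sub>2>0. \<exists>\<kappa>\<^sub>2. slowly_varying \<kappa>\<^sub>2 \<and>
       (\<exists>c. c \<in> borel_measurable M \<and> (\<forall>x. 0 < c x) \<and>
         (\<forall>t>0. AE x in M. asymp_equiv (local_counting B M \<Phi> p t x) at_top
            (\<lambda>l. c x * l powr \<alpha>\<^sub>2 * \<kappa>\<^sub>2 l))))"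


section \<open>Weights\<close>

definition admissible_weight :: "real \<Rightarrow> (real \<Rightarrow> real) \<Rightarrow> bool" where
  "admissible_weight T h \<longleftrightarrow>
     continuous_on {0..<T} h \<and> bounded (h ` {0..<T}) \<and> (\<forall>t\<in>{0..<T}. 0 \<le> h t) \<and>
     (\<exists>\<tau>. 0 < \<tau> \<and> \<tau> < T \<and> mono_on {0..\<tau>} h)"

definition weight_transform :: "real \<Rightarrow> (real \<Rightarrow> real) \<Rightarrow> real \<Rightarrow> real" where
  "weight_transform T h l = sqrt (LBINT t:{0..<T}. h t * exp (- 2 * t * l))"

end

theory Submission
  imports Defs "HOL-Probability.Probability"
begin

text \<open>
  Write \<open>\<psi>\<^sub>u(l) = cosh (R * sqrt l) * exp (- u * l)\<close>. By the Davies-Gaffney estimates the waves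
  \<open>cos (y * sqrt A)\<close> have unit propagation speed, and \<open>\<psi>\<^sub>u(A)\<close> is a superposition of them with density
  of size \<open>exp ((R\<^sup>2 - y\<^sup>2) / (4 * u))\<close>. Between sets at distance more than \<open>R\<close> the operators \<open>\<psi>\<^sub>u(A)\<close>
  are therefore bounded uniformly in \<open>u > 0\<close>, although \<open>\<psi>\<^sub>u\<close> amplifies the frequency \<open>l\<close> by
  \<open>exp (R * sqrt l)\<close>. The observability inequality is applied to \<open>\<psi>\<^sub>s(A) P\<^sub>\<sigma>\<^sub>,\<^sub>x v\<close> with \<open>s\<close> and \<open>\<sigma>\<close> of
  order \<open>1 / l\<close>, at a generic point \<open>x\<close> near the centre of a ball of radius more than \<open>R\<close> that misses
  \<open>\<omega>\<close>: the right-hand side grows at most polynomially in \<open>l\<close>, whereas by the local Weyl law the left-hand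
  side is at least \<open>H\<^sub>T(l)\<^sup>2 * exp (2 * R * sqrt l)\<close> up to polynomial factors.
\<close>

section \<open>Gaussian integrals and finite propagation speed for scalar waves\<close>

text \<open>The Davies-Gaffney hypothesis controls the heat semigroup only in L2 and only between
  sets, whereas \<open>P\<^sub>\<sigma>\<^sub>,\<^sub>x v\<close> belongs to a single point. This
  forces two detours: a pointwise off-diagonal estimate, obtained by iterating over shrinking balls,
  and the separability of L2, which yields null sets that do not depend on the section. The wave
  equation is never solved; finite speed is derived for scalar spectral measures by inverting a
  Laplace transform. The choice \<open>s = k * \<sigma>\<close> with \<open>\<sigma> = 1 / l\<close>
  balances three effects. On a window ending at \<open>l\<close> the damping
  \<open>exp (- s * l)\<close> costs only the constant \<open>exp (- k)\<close>. Away from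
  \<open>x\<close> the norm of \<open>P\<^sub>\<sigma>\<^sub>,\<^sub>x v\<close> is of order
  \<open>exp (- c / \<sigma>)\<close>, which pays for the crude bound
  \<open>exp (R\<^sup>2 / (4 * s))\<close> of the multiplier as soon as \<open>k\<close> is at least
  \<open>R\<^sup>2 / (4 * c)\<close>. The Weyl law sees the smoothing only through
  \<open>exp (2 * \<sigma> * l)\<close>, again a constant. The remaining polynomial factors, and the
  loss from using geometric windows only, are absorbed by working with a radius strictly between the
  one claimed and that of the ball.\<close>

lemma gauss_cos:
  fixes a x :: real
  assumes "0 < a"
  shows "has_bochner_integral lborel (\<lambda>y. exp (- a * y\<^sup>2) * cos (y * x))
           (sqrt (pi / a) * exp (- x\<^sup>2 / (4 * a)))"
proof -
  \<comment> \<open>The real part of the characteristic function of the standard normal law.\<close>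
  have *: "has_bochner_integral lborel (\<lambda>y. std_normal_density y * cos (t * y)) (exp (- t\<^sup>2 / 2))" for t
  proof -
    interpret real_distribution std_normal_distribution by (rule real_dist_normal_dist)
    have i: "integrable std_normal_distribution (\<lambda>y. iexp (t * y))"
      by (rule integrable_iexp) simp_all
    have "(LINT y|std_normal_distribution. cos (t * y)) = Re (char std_normal_distribution t)"
      unfolding char_def using integral_Re[OF i] by (simp add: Re_exp)
    also have "\<dots> = exp (- t\<^sup>2 / 2)"
      unfolding char_std_normal_distribution by (metis Re_complex_of_real)
    finally have 1: "(LINT y|std_normal_distribution. cos (t * y)) = exp (- t\<^sup>2 / 2)" .
    have 2: "integrable std_normal_distribution (\<lambda>y. cos (t * y))"
      using integrable_Re[OF i] by (simp add: Re_exp)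
    show ?thesis
      using 1 2 by (simp add: has_bochner_integral_iff integrable_density integral_density)
  qed
  \<comment> \<open>The substitution of \<open>c * y\<close> for \<open>y\<close> turns
    \<open>exp (- y\<^sup>2 / 2)\<close> into \<open>exp (- a * y\<^sup>2)\<close>.\<close>
  define c where "c = sqrt (2 * a)"
  have c: "c > 0" "c\<^sup>2 = 2 * a" using assms by (auto simp: c_def)
  have "has_bochner_integral lborel (\<lambda>y. std_normal_density (0 + c * y) * cos (x / c * (0 + c * y))) (exp (- (x / c)\<^sup>2 / 2) /\<^sub>R \<bar>c\<bar>)"
    using *[of "x / c"] c
    by (subst (asm) lborel_has_bochner_integral_real_affine_iff[where c=c and t=0]) auto
  then have "has_bochner_integral lborel (\<lambda>y. sqrt (2*pi) * (std_normal_density (0 + c * y) * cos (x / c * (0 + c * y)))) (sqrt (2*pi) * (exp (- (x / c)\<^sup>2 / 2) /\<^sub>R \<bar>c\<bar>))"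
    by (intro has_bochner_integral_mult_right)
  moreover have "sqrt (2*pi) * (std_normal_density (0 + c * y) * cos (x / c * (0 + c * y))) = exp (- a * y\<^sup>2) * cos (y * x)" for y
    using c by (simp add: std_normal_density_def power_mult_distrib mult.commute)
  moreover have "sqrt (2*pi) * (exp (- (x / c)\<^sup>2 / 2) /\<^sub>R \<bar>c\<bar>) = sqrt (pi / a) * exp (- x\<^sup>2 / (4 * a))"
    using c assms by (simp add: power_divide c_def real_sqrt_mult real_sqrt_divide field_simps)
  ultimately show ?thesis by simp
qed

lemma gauss_integrable [simp]:
  fixes a :: real assumes "0 < a"
  shows "integrable lborel (\<lambda>y. exp (- (a * y\<^sup>2)))"
  using gauss_cos[OF assms, of 0] by (simp add: has_bochner_integral_iff)

lemma gauss_integral: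
  fixes a :: real assumes "0 < a"
  shows "(LINT y|lborel. exp (- (a * y\<^sup>2))) = sqrt (pi / a)"
  using gauss_cos[OF assms, of 0] by (simp add: has_bochner_integral_iff)

text \<open>The product of cosines splits into the frequencies \<open>x + k\<close> and
  \<open>x - k\<close> with \<open>k = R / (2 * u)\<close>. This \<open>k\<close> makes the cross
  term of \<open>- u * (x + k)\<^sup>2\<close> equal to \<open>- R * x\<close>, so the two Gaussians
  add up to a \<open>cosh\<close>: an oscillating density in \<open>y\<close> produces exponential
  growth in \<open>x\<close>.\<close>

lemma gauss_cos_cosh:
  fixes u R x :: real
  assumes "0 < u"
  shows "has_bochner_integral lborel (\<lambda>y. exp (- (1 / (4 * u)) * y\<^sup>2) * cos (y * (R / (2 * u))) * cos (y * x))
           (sqrt (4 * pi * u) * exp (- (R\<^sup>2 / (4 * u))) * (cosh (R * x) * exp (- u * x\<^sup>2)))"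
proof -
  let ?a = "1 / (4 * u)" and ?k = "R / (2 * u)"
  have a: "0 < ?a" using assms by simp
  have "has_bochner_integral lborel
     (\<lambda>y. 1/2 * (exp (- ?a * y\<^sup>2) * cos (y * (x + ?k)) + exp (- ?a * y\<^sup>2) * cos (y * (x - ?k))))
     (1/2 * (sqrt (pi / ?a) * exp (- (x + ?k)\<^sup>2 / (4 * ?a)) + sqrt (pi / ?a) * exp (- (x - ?k)\<^sup>2 / (4 * ?a))))"
    by (intro has_bochner_integral_mult_right has_bochner_integral_add gauss_cos a)
  moreover have "1/2 * (exp (- ?a * y\<^sup>2) * cos (y * (x + ?k)) + exp (- ?a * y\<^sup>2) * cos (y * (x - ?k)))
      = exp (- ?a * y\<^sup>2) * cos (y * ?k) * cos (y * x)" for y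
    by (simp add: distrib_left right_diff_distrib cos_add cos_diff algebra_simps)
  moreover have "(x + ?k)\<^sup>2 / (4 * ?a) = R\<^sup>2 / (4 * u) + u * x\<^sup>2 + R * x"
    "(x - ?k)\<^sup>2 / (4 * ?a) = R\<^sup>2 / (4 * u) + u * x\<^sup>2 - R * x"
    using assms by (simp_all add: power2_eq_square field_simps)
  then have e: "exp (- (x + ?k)\<^sup>2 / (4 * ?a)) = exp (- (R\<^sup>2 / (4 * u))) * exp (- u * x\<^sup>2) * exp (- (R * x))"
    "exp (- (x - ?k)\<^sup>2 / (4 * ?a)) = exp (- (R\<^sup>2 / (4 * u))) * exp (- u * x\<^sup>2) * exp (R * x)"
    by (simp_all flip: exp_add)
  have "1/2 * (sqrt (pi / ?a) * exp (- (x + ?k)\<^sup>2 / (4 * ?a)) + sqrt (pi / ?a) * exp (- (x - ?k)\<^sup>2 / (4 * ?a)))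
     = sqrt (4 * pi * u) * exp (- (R\<^sup>2 / (4 * u))) * (cosh (R * x) * exp (- u * x\<^sup>2))"
    unfolding e cosh_def by (simp add: field_simps)
  ultimately show ?thesis by simp
qed

text \<open>Phragmen's inversion of the Laplace transform: in the variable \<open>y\<^sup>2\<close> the functions
  \<open>1 - exp (- exp (n (b - y\<^sup>2)))\<close> approximate the indicator of \<open>y\<^sup>2 < b\<close>, and their expansions only
  involve the transform at the points \<open>k n\<close>.\<close>

lemma laplace_support_integral:
  fixes W :: "real \<Rightarrow> real"
  assumes meas [measurable]: "W \<in> borel_measurable borel"
    and bnd: "\<And>y. \<bar>W y\<bar> \<le> K"
    and decay: "\<And>s. 0 < s \<Longrightarrow> \<bar>LINT y|lborel. exp (- (s * y\<^sup>2)) * W y\<bar> \<le> K * (sqrt (pi / s) * exp (- (r\<^sup>2 * s)))"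
    and b: "0 < b" "b < r\<^sup>2"
  shows "(LINT y|lborel. indicator {y. y\<^sup>2 < b} y * W y) = 0"
proof -
  have K: "K \<ge> 0" using bnd[of 0] by linarith
  define E where "E n y = exp (real (Suc n) * (b - y\<^sup>2))" for n y
  have E_le: "E n y > 0" for n y by (simp add: E_def)
  define g where "g n y = (1 - exp (- E n y)) * W y" for n y
  \<comment> \<open>The terms of the exponential series of \<open>1 - exp (- E n y)\<close>, times
    \<open>W y\<close>. Each is a multiple of \<open>exp (- s * y\<^sup>2) * W y\<close> with
    \<open>s = Suc k * Suc n\<close>, whose integral the decay hypothesis controls.\<close>
  define f where "f n k y = - ((- 1) ^ Suc k) / fact (Suc k) * (E n y ^ Suc k * W y)" for n k y
  \<comment> \<open>In a term with \<open>s = Suc k * Suc n\<close> the coefficient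
    \<open>exp (s * b)\<close> meets the decay \<open>exp (- r\<^sup>2 * s)\<close>; their product
    is \<open>q n ^ Suc k\<close>, which is small because \<open>b < r\<^sup>2\<close>.\<close>
  define q where "q n = exp (- (real (Suc n) * (r\<^sup>2 - b)))" for n
  have q1: "q n \<le> 1" "0 < q n" for n using b by (auto simp: q_def)
  have pow: "E n y ^ Suc k = exp (real (Suc k) * (real (Suc n) * b)) * exp (- (real (Suc k) * real (Suc n) * y\<^sup>2))" for n k y
    unfolding E_def exp_of_nat_mult[symmetric] exp_add[symmetric] by (simp add: algebra_simps del: of_nat_Suc)
  have f_int: "integrable lborel (f n k)" for n k
    unfolding f_def pow
  proof (rule integrable_mult_right, rule Bochner_Integration.integrable_bound)
    show "integrable lborel (\<lambda>y. exp (real (Suc k) * (real (Suc n) * b)) * K * exp (- (real (Suc k) * real (Suc n) * y\<^sup>2)))"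
      by (rule integrable_mult_right, rule gauss_integrable) simp
    show "AE y in lborel. norm (exp (real (Suc k) * (real (Suc n) * b)) * exp (- (real (Suc k) * real (Suc n) * y\<^sup>2)) * W y)
       \<le> norm (exp (real (Suc k) * (real (Suc n) * b)) * K * exp (- (real (Suc k) * real (Suc n) * y\<^sup>2)))"
      using bnd K by (auto simp: abs_mult mult_mono simp del: of_nat_Suc intro!: AE_I2)
  qed measurable
  \<comment> \<open>Absolute values lose the cancellation in \<open>W\<close>, and this bound
    explodes with \<open>n\<close>. For fixed \<open>n\<close> it is still summable in
    \<open>k\<close>, which is all that exchanging sum and integral requires.\<close>
  have f_norm: "(LINT y|lborel. norm (f n k y)) \<le> (sqrt pi * K) * (inverse (fact (Suc k)) * exp (real (Suc n) * b) ^ Suc k)" for n k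
  proof -
    have "(LINT y|lborel. norm (f n k y)) \<le> (LINT y|lborel. 1 / fact (Suc k) * exp (real (Suc k) * (real (Suc n) * b)) * K * exp (- (real (Suc k) * real (Suc n) * y\<^sup>2)))"
    proof (rule integral_mono)
      fix y show "norm (f n k y) \<le> 1 / fact (Suc k) * exp (real (Suc k) * (real (Suc n) * b)) * K * exp (- (real (Suc k) * real (Suc n) * y\<^sup>2))"
        unfolding f_def pow using bnd[of y] by (simp add: abs_mult power_abs divide_simps del: fact_Suc)
    qed (use f_int in \<open>simp_all del: of_nat_Suc fact_Suc\<close>)
    also have "\<dots> = 1 / fact (Suc k) * exp (real (Suc k) * (real (Suc n) * b)) * K * sqrt (pi / (real (Suc k) * real (Suc n)))"
      by (subst gauss_integral[symmetric]) (simp_all del: of_nat_Suc fact_Suc)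
    also have "\<dots> \<le> 1 / fact (Suc k) * exp (real (Suc k) * (real (Suc n) * b)) * K * sqrt pi"
    proof -
      have "1 \<le> real (Suc k) * real (Suc n)" by (simp add: algebra_simps)
      then have "pi / (real (Suc k) * real (Suc n)) \<le> pi" by (simp add: divide_le_eq del: of_nat_Suc)
      then show ?thesis using K by (intro mult_left_mono) (auto simp del: of_nat_Suc fact_Suc)
    qed
    finally show ?thesis unfolding exp_of_nat_mult[of "Suc k"] by (simp only: divide_inverse mult_ac mult_1_left)
  qed
  have exp_sum: "summable (\<lambda>k. inverse (fact (Suc k)) * x ^ Suc k)" for x :: real
    using summable_exp[of x] by (subst (asm) summable_Suc_iff[symmetric])
  have f_sums: "(\<lambda>k. f n k y) sums g n y" for n y
  proof -
    have "(\<lambda>k. inverse (fact k) * (- E n y) ^ k) sums exp (- E n y)"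
      using exp_converges[of "- E n y"] by (simp add: scaleR_conv_of_real)
    then have "(\<lambda>k. inverse (fact (Suc k)) * (- E n y) ^ Suc k) sums (exp (- E n y) - 1)"
      by (subst sums_Suc_iff) simp
    then have "(\<lambda>k. inverse (fact (Suc k)) * (- E n y) ^ Suc k * (- W y)) sums ((exp (- E n y) - 1) * (- W y))"
      by (rule sums_mult2)
    moreover have "inverse (fact (Suc k)) * (- E n y) ^ Suc k * (- W y) = f n k y" for k
      unfolding f_def by (subst power_minus) (simp add: divide_inverse mult_ac del: power_Suc fact_Suc)
    ultimately show ?thesis by (simp add: g_def algebra_simps)
  qed
  have g_eq: "(LINT y|lborel. g n y) = (\<Sum>k. LINT y|lborel. f n k y)" for n
  proof -
    have s: "summable (\<lambda>k. norm (f n k y))" for y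
    proof -
      have "norm (f n k y) = inverse (fact (Suc k)) * E n y ^ Suc k * \<bar>W y\<bar>" for k
        unfolding f_def using E_le[of n y]
        by (simp add: abs_mult power_abs divide_inverse del: power_Suc fact_Suc) 
      then show ?thesis using summable_mult2[OF exp_sum] by simp
    qed
    have s2: "summable (\<lambda>k. LINT y|lborel. norm (f n k y))"
      by (rule summable_comparison_test'[OF summable_mult[OF exp_sum]])
         (use f_norm in auto)
    show "(LINT y|lborel. g n y) = (\<Sum>k. LINT y|lborel. f n k y)"
      using integral_suminf[OF f_int _ s2] s f_sums by (simp add: sums_iff)
  qed
  \<comment> \<open>The signed integrals do profit from the decay hypothesis. One factor
    \<open>q n\<close> is kept for the limit in \<open>n\<close>; the factorials alone ensure
    summability in \<open>k\<close>.\<close>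
  have f_bound: "\<bar>LINT y|lborel. f n k y\<bar> \<le> (K * sqrt pi * q n) * (inverse (fact (Suc k)) * 1 ^ Suc k)" for n k
  proof -
    let ?s = "real (Suc k) * real (Suc n)"
    have s: "1 \<le> ?s" by (simp add: algebra_simps)
    have "f n k y = - ((- 1) ^ Suc k) / fact (Suc k) * exp (real (Suc k) * (real (Suc n) * b)) * (exp (- (?s * y\<^sup>2)) * W y)" for y
      unfolding f_def pow by (simp add: mult_ac)
    then have "\<bar>LINT y|lborel. f n k y\<bar> = 1 / fact (Suc k) * exp (real (Suc k) * (real (Suc n) * b)) * \<bar>LINT y|lborel. exp (- (?s * y\<^sup>2)) * W y\<bar>"
      by (simp add: abs_mult power_abs del: of_nat_Suc fact_Suc power_Suc)
    also have "\<dots> \<le> 1 / fact (Suc k) * exp (real (Suc k) * (real (Suc n) * b)) * (K * (sqrt (pi / ?s) * exp (- (r\<^sup>2 * ?s))))"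
      using s by (intro mult_left_mono decay) (auto simp del: of_nat_Suc fact_Suc)
    also have "\<dots> \<le> 1 / fact (Suc k) * exp (real (Suc k) * (real (Suc n) * b)) * (K * (sqrt pi * exp (- (r\<^sup>2 * ?s))))"
    proof -
      have "pi / ?s \<le> pi" using s by (simp add: divide_le_eq del: of_nat_Suc)
      then show ?thesis using K by (intro mult_left_mono mult_right_mono) (auto simp del: of_nat_Suc fact_Suc)
    qed
    also have "\<dots> = 1 / fact (Suc k) * (K * sqrt pi * q n ^ Suc k)"
    proof -
      have "exp (real (Suc k) * (real (Suc n) * b)) * exp (- (r\<^sup>2 * ?s)) = q n ^ Suc k"
        unfolding q_def exp_of_nat_mult[symmetric] exp_add[symmetric] by (simp add: algebra_simps del: of_nat_Suc)
      then show ?thesis by (simp only: mult_ac)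
    qed
    also have "\<dots> \<le> 1 / fact (Suc k) * (K * sqrt pi * q n)"
    proof -
      have "q n ^ Suc k \<le> q n ^ 1" using q1[of n] by (intro power_decreasing) auto
      then show ?thesis using K by (intro mult_left_mono) (auto simp del: fact_Suc)
    qed
    finally show ?thesis by (simp add: divide_inverse mult_ac del: fact_Suc)
  qed
  define S where "S = (\<Sum>k. inverse (fact (Suc k)) * (1::real) ^ Suc k)"
  have g_bound: "\<bar>LINT y|lborel. g n y\<bar> \<le> (K * sqrt pi * S) * q n" for n
  proof -
    have "\<bar>LINT y|lborel. g n y\<bar> \<le> (\<Sum>k. (K * sqrt pi * q n) * (inverse (fact (Suc k)) * (1::real) ^ Suc k))"
      unfolding g_eq using norm_suminf_le[OF _ summable_mult[OF exp_sum], of "\<lambda>k. LINT y|lborel. f n k y" "K * sqrt pi * q n" 1] f_bound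
      by (simp only: real_norm_def)
    also have "\<dots> = (K * sqrt pi * q n) * S"
      unfolding S_def by (rule suminf_mult[OF exp_sum])
    finally show ?thesis by (simp add: mult_ac)
  qed
  have "q \<longlonglongrightarrow> 0"
  proof -
    have "(\<lambda>n. exp (- (r\<^sup>2 - b)) ^ Suc n) \<longlonglongrightarrow> 0"
      using b by (intro LIMSEQ_Suc LIMSEQ_realpow_zero) auto
    moreover have "q = (\<lambda>n. exp (- (r\<^sup>2 - b)) ^ Suc n)"
      unfolding q_def exp_of_nat_mult[symmetric] by (simp only: mult_minus_right)
    ultimately show ?thesis by (simp only:)
  qed
  then have "(\<lambda>n. (K * sqrt pi * S) * q n) \<longlonglongrightarrow> 0" by (rule tendsto_mult_right_zero)
  then have lim0: "(\<lambda>n. LINT y|lborel. g n y) \<longlonglongrightarrow> 0"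
    by (rule Lim_null_comparison[rotated]) (use g_bound in auto)
  have "(\<lambda>n. LINT y|lborel. g n y) \<longlonglongrightarrow> (LINT y|lborel. indicator {y. y\<^sup>2 < b} y * W y)"
  proof (rule integral_dominated_convergence[where w="\<lambda>y. exp b * K * exp (- (1 * y\<^sup>2))"])
    show "integrable lborel (\<lambda>y. exp b * K * exp (- (1 * y\<^sup>2)))"
      by (intro integrable_mult_right gauss_integrable) simp
    \<comment> \<open>At \<open>y\<^sup>2 = b\<close> the approximants are constantly
      \<open>1 - exp (- 1)\<close>, so these two points are discarded.\<close>
    have "AE y in lborel. y \<noteq> sqrt b \<and> y \<noteq> - sqrt b"
      using AE_lborel_singleton[of "sqrt b"] AE_lborel_singleton[of "- sqrt b"] by eventually_elim auto
    then show "AE y in lborel. (\<lambda>n. g n y) \<longlonglongrightarrow> indicator {y. y\<^sup>2 < b} y * W y"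
    proof eventually_elim
      case (elim y)
      then have ne: "y\<^sup>2 \<noteq> b" by (metis real_sqrt_abs abs_eq_iff minus_minus abs_real_def)
      consider "y\<^sup>2 < b" | "y\<^sup>2 > b" using ne by linarith
      then have "(\<lambda>n. 1 - exp (- E n y)) \<longlonglongrightarrow> indicator {y. y\<^sup>2 < b} y"
      proof cases
        case 1
        then have "(\<lambda>n. 1 - exp (- E n y)) \<longlonglongrightarrow> 1" unfolding E_def by real_asymp
        then show ?thesis using 1 by simp
      next
        case 2
        then have "(\<lambda>n. 1 - exp (- E n y)) \<longlonglongrightarrow> 0" unfolding E_def by real_asymp
        then show ?thesis using 2 by simp
      qed
      then show ?case unfolding g_def by (intro tendsto_mult_right)
    qed
    fix n
    show "AE y in lborel. norm (g n y) \<le> exp b * K * exp (- (1 * y\<^sup>2))"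
    proof (intro AE_I2)
      fix y :: real
      \<comment> \<open>A majorant independent of \<open>n\<close>: below \<open>b\<close> the
        left-hand side is less than 1, above \<open>b\<close> it is at most \<open>E n y\<close>,
        where the negative exponent only decreases with \<open>n\<close>.\<close>
      have "1 - exp (- E n y) \<le> exp (b - y\<^sup>2)"
      proof (cases "y\<^sup>2 \<le> b")
        case True
        then have "1 \<le> exp (b - y\<^sup>2)" by simp
        moreover have "exp (- E n y) > 0" by simp
        ultimately show ?thesis by linarith
      next
        case False
        have "1 - exp (- E n y) \<le> E n y" using exp_ge_add_one_self[of "- E n y"] by linarith
        also have "\<dots> \<le> exp (1 * (b - y\<^sup>2))"
          unfolding E_def using False by (subst exp_le_cancel_iff, intro mult_right_mono_neg) auto
        finally show ?thesis by simp
      qed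
      moreover have "0 \<le> 1 - exp (- E n y)" using E_le[of n y] by simp
      ultimately have "norm (g n y) \<le> exp (b - y\<^sup>2) * K"
        unfolding g_def norm_mult using bnd[of y] by (intro mult_mono) auto
      then show "norm (g n y) \<le> exp b * K * exp (- (1 * y\<^sup>2))"
        by (simp add: exp_diff exp_minus divide_inverse mult_ac)
    qed
  qed (simp_all add: g_def E_def)
  with lim0 show ?thesis using LIMSEQ_unique by blast
qed

text \<open>The integral of \<open>W\<close> over \<open>(- c, c)\<close> vanishes for every
  \<open>c < r\<close>. Differentiating in the endpoint gives \<open>W y + W (- y) = 0\<close>, and
  evenness finishes. The odd part of \<open>W\<close> is invisible to a transform in
  \<open>y\<^sup>2\<close>.\<close>

lemma laplace_support:
  fixes W :: "real \<Rightarrow> real"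
  assumes cont: "continuous_on UNIV W" and even: "\<And>y. W (- y) = W y"
    and bnd: "\<And>y. \<bar>W y\<bar> \<le> K"
    and decay: "\<And>s. 0 < s \<Longrightarrow> \<bar>LINT y|lborel. exp (- (s * y\<^sup>2)) * W y\<bar> \<le> K * (sqrt (pi / s) * exp (- (r\<^sup>2 * s)))"
    and y: "\<bar>y\<bar> < r"
  shows "W y = 0"
proof -
  have [measurable]: "W \<in> borel_measurable borel" using cont by (rule borel_measurable_continuous_onI)
  have c: "continuous_on {a..b} W" for a b by (rule continuous_on_subset[OF cont]) simp
  define F where "F u = integral {-r..u} W" for u
  have pos: "integral {-c..c} W = 0" if "0 < c" "c < r" for c
  proof -
    have "(LINT y|lborel. indicator {y. y\<^sup>2 < c\<^sup>2} y * W y) = 0"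
      by (rule laplace_support_integral[OF _ bnd decay]) (use that in \<open>auto simp: power_strict_mono\<close>)
    moreover have "{y. y\<^sup>2 < c\<^sup>2} = {-c<..<c}"
    proof -
      have iff: "y\<^sup>2 < c\<^sup>2 \<longleftrightarrow> - c < y \<and> y < c" for y :: real
        using that(1) abs_le_square_iff[of c y] by linarith
      show ?thesis unfolding iff by auto
    qed
    ultimately have 0: "(LINT y:{-c<..<c}|lborel. W y) = 0"
      by (simp only: set_lebesgue_integral_def real_scaleR_def)
    have "set_integrable lborel {-c..c} W"
      unfolding set_integrable_def using borel_integrable_compact[OF compact_Icc c] by simp
    then have "set_integrable lborel {-c<..<c} W" by (rule set_integrable_subset) auto
    from set_borel_integral_eq_integral(2)[OF this] 0 have "integral {-c<..<c} W = 0" by simp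
    then show ?thesis by (simp add: integral_open_interval_real)
  qed
  have z: "F u - F (- u) = 0" if "\<bar>u\<bar> < r" for u
  proof -
    have *: "F u - F (- u) = integral {-u..u} W" if "0 \<le> u" "u < r" for u
      unfolding F_def using Henstock_Kurzweil_Integration.integral_combine[of "-r" "-u" u W] that integrable_continuous_real[OF c]
      by simp
    consider "u = 0" | "0 < u" | "0 < - u" by linarith
    then show ?thesis
    proof cases
      case 2 then show ?thesis using *[of u] pos[of u] that by simp
    next
      case 3 then show ?thesis using *[of "-u"] pos[of "-u"] that by simp
    qed simp
  qed
  have d: "(F has_real_derivative W u) (at u)" if "\<bar>u\<bar> < r" for u
  proof -
    have "(F has_real_derivative W u) (at u within {-r..r})"
      unfolding F_def by (rule integral_has_real_derivative[OF c]) (use that in auto)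
    moreover have "at u within {-r..r} = at u" by (rule at_within_Icc_at) (use that in auto)
    ultimately show ?thesis by simp
  qed
  have "((\<lambda>u. F u - F (- u)) has_real_derivative W y - W (- y) * (- 1)) (at y)"
    by (rule derivative_intros d DERIV_chain2 y)+ (use y d in \<open>auto intro!: derivative_eq_intros\<close>)
  moreover have "((\<lambda>u. F u - F (- u)) has_real_derivative 0) (at y)"
  proof (rule has_field_derivative_transform_within_open[where f="\<lambda>_. 0" and S="{-r<..<r}"])
    show "y \<in> {-r<..<r}" using y by auto
    show "0 = F x - F (- x)" if "x \<in> {-r<..<r}" for x using z[of x] that by auto
  qed auto
  ultimately have "W y - W (- y) * (- 1) = 0" by (rule DERIV_unique)
  then show ?thesis using even by simp
qed

lemma isCont_integral_cos:
  fixes \<nu> :: "real measure"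
  assumes "finite_measure \<nu>" and [measurable_cong]: "sets \<nu> = sets borel"
  shows "isCont (\<lambda>y. LINT l|\<nu>. cos (y * sqrt l)) y"
proof -
  interpret finite_measure \<nu> by fact
  show ?thesis
  proof (subst continuous_at_sequentially, intro allI impI)
    fix X :: "nat \<Rightarrow> real" assume X: "X \<longlonglongrightarrow> y"
    show "((\<lambda>y. LINT l|\<nu>. cos (y * sqrt l)) \<circ> X) \<longlonglongrightarrow> (LINT l|\<nu>. cos (y * sqrt l))"
      unfolding o_def
      by (rule integral_dominated_convergence[where w="\<lambda>_. 1"])
         (auto intro!: tendsto_intros X)
  qed
qed

lemma integral_cos_swap:
  fixes \<nu> :: "real measure" and m :: "real \<Rightarrow> real"
  assumes "finite_measure \<nu>" and [measurable_cong]: "sets \<nu> = sets borel"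
    and m: "integrable lborel m"
  shows "(LINT l|\<nu>. LINT y|lborel. m y * cos (y * sqrt l)) = (LINT y|lborel. m y * (LINT l|\<nu>. cos (y * sqrt l)))"
    and "integrable lborel (\<lambda>y. m y * (LINT l|\<nu>. cos (y * sqrt l)))"
proof -
  interpret finite_measure \<nu> by fact
  interpret pair_sigma_finite lborel \<nu> by standard
  have [measurable]: "m \<in> borel_measurable borel" using m by auto
  have i: "integrable (lborel \<Otimes>\<^sub>M \<nu>) (\<lambda>(y, l). m y * cos (y * sqrt l))"
  proof (rule Fubini_integrable)
    show "AE y in lborel. integrable \<nu> (\<lambda>l. case (y, l) of (y, l) \<Rightarrow> m y * cos (y * sqrt l))"
      by (auto intro!: AE_I2 integrable_const_bound[where B=1])
    show "integrable lborel (\<lambda>y. LINT l|\<nu>. norm (case (y, l) of (y, l) \<Rightarrow> m y * cos (y * sqrt l)))"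
    proof (rule Bochner_Integration.integrable_bound[OF integrable_mult_right[OF m, of "measure \<nu> (space \<nu>)"]])
      show "AE y in lborel. norm (LINT l|\<nu>. norm (case (y, l) of (y, l) \<Rightarrow> m y * cos (y * sqrt l)))
        \<le> norm (measure \<nu> (space \<nu>) * m y)"
      proof (rule AE_I2)
        fix y
        have "(LINT l|\<nu>. \<bar>m y\<bar> * \<bar>cos (y * sqrt l)\<bar>) \<le> (LINT l|\<nu>. \<bar>m y\<bar>)"
          by (rule integral_mono) (auto intro!: integrable_const_bound[where B="1"] mult_left_le)
        then show "norm (LINT l|\<nu>. norm (case (y, l) of (y, l) \<Rightarrow> m y * cos (y * sqrt l))) \<le> norm (measure \<nu> (space \<nu>) * m y)"
          by (simp add: abs_mult)
      qed
    qed measurable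
  qed measurable
  show "(LINT l|\<nu>. LINT y|lborel. m y * cos (y * sqrt l)) = (LINT y|lborel. m y * (LINT l|\<nu>. cos (y * sqrt l)))"
    using Fubini_integral[OF i] by simp
  show "integrable lborel (\<lambda>y. m y * (LINT l|\<nu>. cos (y * sqrt l)))"
    using integrable_fst'[OF i] by simp
qed

text \<open>The multiplier \<open>\<psi>\<^sub>u\<close> of the overview with \<open>R\<close> made
  explicit. It uses \<open>cosh\<close> and not \<open>exp\<close> because an even function of
  \<open>sqrt l\<close> of this kind has a Gaussian cosine density, by
  \<open>gauss_cos_cosh\<close>.\<close>

definition cosh_heat :: "real \<Rightarrow> real \<Rightarrow> real \<Rightarrow> real" where
  "cosh_heat R u l = cosh (R * sqrt l) * exp (- u * l)"

text \<open>The Laplace transform of the wave function \<open>W y = J (\<lambda>l. cos (y * sqrt l))\<close> in the variable \<open>y\<^sup>2\<close>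
  is a heat flow. The Davies-Gaffney bound therefore forces \<open>W\<close> to vanish on \<open>[0, r)\<close> (finite
  propagation speed), and \<open>cosh_heat R u\<close> is a superposition of the \<open>cos (y * sqrt l)\<close> with density of
  size \<open>exp ((R\<^sup>2 - y\<^sup>2) / (4 * u))\<close>.\<close>

lemma cosh_heat_bound:
  fixes \<nu>\<^sub>1 \<nu>\<^sub>2 :: "real measure"
  defines "J \<equiv> \<lambda>\<phi>. (LINT l|\<nu>\<^sub>1. \<phi> l) - (LINT l|\<nu>\<^sub>2. \<phi> l)"
  assumes fin: "finite_measure \<nu>\<^sub>1" "finite_measure \<nu>\<^sub>2"
    and sets [measurable_cong]: "sets \<nu>\<^sub>1 = sets borel" "sets \<nu>\<^sub>2 = sets borel"
    and nonneg: "AE l in \<nu>\<^sub>1. 0 \<le> l" "AE l in \<nu>\<^sub>2. 0 \<le> l"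
    and cos: "\<And>y. \<bar>J (\<lambda>l. cos (y * sqrt l))\<bar> \<le> K"
    and heat: "\<And>t. 0 < t \<Longrightarrow> \<bar>J (\<lambda>l. exp (- t * l))\<bar> \<le> K * exp (- r\<^sup>2 / (4 * t))"
    and R: "0 \<le> R" "R < r" and u: "0 < u"
  shows "\<bar>J (cosh_heat R u)\<bar> \<le> K / sqrt (1 - (R / r)\<^sup>2)"
proof -
  define W where "W y = J (\<lambda>l. cos (y * sqrt l))" for y
  have K: "0 \<le> K" using cos[of 0] by linarith
  have swap: "(LINT y|lborel. m y * W y) = J (\<lambda>l. LINT y|lborel. m y * cos (y * sqrt l))"
    and int: "integrable lborel (\<lambda>y. m y * W y)" if m: "integrable lborel m" for m
    using integral_cos_swap[OF fin(1) sets(1) m] integral_cos_swap[OF fin(2) sets(2) m]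
    by (simp_all add: W_def J_def right_diff_distrib)
  have contW: "continuous_on UNIV W"
    unfolding W_def J_def
    by (intro continuous_at_imp_continuous_on ballI continuous_intros isCont_integral_cos fin sets)
  then have [measurable]: "W \<in> borel_measurable borel" by (rule borel_measurable_continuous_onI)
  \<comment> \<open>For negative \<open>l\<close> the square of \<open>sqrt l\<close> is
    \<open>\<bar>l\<bar>\<close>, so the identities between multipliers used below hold only on the
    half-line that carries the measures.\<close>
  have cong: "J \<phi> = J \<psi>" if "\<phi> \<in> borel_measurable borel" "\<psi> \<in> borel_measurable borel" "\<And>l. 0 \<le> l \<Longrightarrow> \<phi> l = \<psi> l" for \<phi> \<psi>
  proof -
    note [measurable] = that(1,2)
    have "(LINT l|\<nu>\<^sub>1. \<phi> l) = (LINT l|\<nu>\<^sub>1. \<psi> l)" "(LINT l|\<nu>\<^sub>2. \<phi> l) = (LINT l|\<nu>\<^sub>2. \<psi> l)"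
      by (intro integral_cong_AE; use nonneg in \<open>auto intro: that\<close>)+
    then show ?thesis by (simp add: J_def)
  qed
  have W0: "W y = 0" if y: "\<bar>y\<bar> < r" for y
  proof (rule laplace_support[OF contW _ _ _ y, of K])
    fix s :: real assume s: "0 < s"
    have "(LINT y|lborel. exp (- (s * y\<^sup>2)) * W y) = J (\<lambda>l. sqrt (pi / s) * exp (- (sqrt l)\<^sup>2 / (4 * s)))"
      using swap[OF gauss_integrable[OF s]] gauss_cos[OF s] by (simp add: has_bochner_integral_iff)
    also have "\<dots> = J (\<lambda>l. sqrt (pi / s) * exp (- (1 / (4 * s)) * l))"
      by (rule cong) (simp_all add: divide_simps)
    also have "\<dots> = sqrt (pi / s) * J (\<lambda>l. exp (- (1 / (4 * s)) * l))"
      by (simp add: J_def right_diff_distrib)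
    also have "\<bar>\<dots>\<bar> \<le> sqrt (pi / s) * (K * exp (- r\<^sup>2 / (4 * (1 / (4 * s)))))"
      unfolding abs_mult using s by (intro mult_mono heat) auto
    also have "\<dots> = K * (sqrt (pi / s) * exp (- (r\<^sup>2 * s)))" using s by simp
    finally show "\<bar>LINT y|lborel. exp (- (s * y\<^sup>2)) * W y\<bar> \<le> K * (sqrt (pi / s) * exp (- (r\<^sup>2 * s)))" .
  next
    show "\<bar>W y\<bar> \<le> K" for y using cos by (simp add: W_def)
    show "W (- y) = W y" for y by (simp add: W_def)
  qed
  \<comment> \<open>Since \<open>W\<close> vanishes for \<open>\<bar>y\<bar> < r\<close>, only
    \<open>R\<^sup>2 \<le> \<theta> * y\<^sup>2\<close> matters. The fraction
    \<open>\<theta>\<close> of the Gaussian exponent pays for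
    \<open>exp (- (R\<^sup>2 / (4 * u)))\<close>, and the fraction \<open>1 - \<theta>\<close> is
    left to be integrated.\<close>
  define \<theta> where "\<theta> = (R / r)\<^sup>2"
  have r: "0 < r" using R by linarith
  have \<theta>: "0 \<le> \<theta>" "\<theta> < 1" "\<theta> * r\<^sup>2 = R\<^sup>2"
    using R r by (auto simp: \<theta>_def power_divide power_strict_mono)
  define m where "m y = exp (- (1 / (4 * u)) * y\<^sup>2) * cos (y * (R / (2 * u)))" for y
  have [measurable]: "m \<in> borel_measurable borel" unfolding m_def by measurable
  define C where "C = sqrt (4 * pi * u) * exp (- (R\<^sup>2 / (4 * u)))"
  have C: "0 < C" using u by (simp add: C_def)
  have m: "integrable lborel m"
    using gauss_cos_cosh[OF u, of R 0] by (simp add: has_bochner_integral_iff m_def[abs_def])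
  have a: "0 < (1 - \<theta>) / (4 * u)" using \<theta> u by simp
  have "(LINT y|lborel. m y * W y) = J (\<lambda>l. C * (cosh (R * sqrt l) * exp (- u * (sqrt l)\<^sup>2)))"
    using swap[OF m] gauss_cos_cosh[OF u, of R] by (simp add: has_bochner_integral_iff m_def C_def)
  also have "\<dots> = J (\<lambda>l. C * cosh_heat R u l)"
    by (rule cong) (simp_all add: cosh_heat_def cosh_def)
  also have "\<dots> = C * J (cosh_heat R u)"
    by (simp add: J_def right_diff_distrib)
  finally have eq: "C * J (cosh_heat R u) = (LINT y|lborel. m y * W y)" by simp
  have "C * \<bar>J (cosh_heat R u)\<bar> = \<bar>LINT y|lborel. m y * W y\<bar>"
    using C by (simp add: abs_mult flip: eq)
  also have "\<dots> \<le> (LINT y|lborel. K * exp (- (R\<^sup>2 / (4 * u))) * exp (- ((1 - \<theta>) / (4 * u) * y\<^sup>2)))"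
  proof (rule integral_abs_bound[THEN order_trans], rule integral_mono)
    show "integrable lborel (\<lambda>y. \<bar>m y * W y\<bar>)" using int[OF m] by (rule integrable_abs)
    show "integrable lborel (\<lambda>y. K * exp (- (R\<^sup>2 / (4 * u))) * exp (- ((1 - \<theta>) / (4 * u) * y\<^sup>2)))"
      by (rule integrable_mult_right, rule gauss_integrable[OF a])
    fix y
    show "\<bar>m y * W y\<bar> \<le> K * exp (- (R\<^sup>2 / (4 * u))) * exp (- ((1 - \<theta>) / (4 * u) * y\<^sup>2))"
    proof (cases "\<bar>y\<bar> < r")
      case True then show ?thesis using W0 K by simp
    next
      case False
      then have "r\<^sup>2 \<le> y\<^sup>2" using r by (simp add: abs_le_square_iff[symmetric])
      then have "R\<^sup>2 \<le> \<theta> * y\<^sup>2" unfolding \<theta>(3)[symmetric] by (rule mult_left_mono) (fact \<theta>(1))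
      then have "R\<^sup>2 / (4 * u) \<le> (\<theta> * y\<^sup>2) / (4 * u)" using u by (intro divide_right_mono) auto
      then have *: "- (1 / (4 * u)) * y\<^sup>2 \<le> - (R\<^sup>2 / (4 * u)) + - ((1 - \<theta>) / (4 * u) * y\<^sup>2)"
        by (simp add: left_diff_distrib diff_divide_distrib)
      have "\<bar>m y\<bar> \<le> exp (- (1 / (4 * u)) * y\<^sup>2)" by (simp add: m_def abs_mult)
      also have "\<dots> \<le> exp (- (R\<^sup>2 / (4 * u))) * exp (- ((1 - \<theta>) / (4 * u) * y\<^sup>2))"
        using * by (simp flip: exp_add)
      finally have "\<bar>m y\<bar> * \<bar>W y\<bar> \<le> (exp (- (R\<^sup>2 / (4 * u))) * exp (- ((1 - \<theta>) / (4 * u) * y\<^sup>2))) * K"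
        using cos[of y] by (intro mult_mono) (auto simp: W_def)
      then show ?thesis by (simp add: abs_mult mult_ac)
    qed
  qed
  \<comment> \<open>The factor \<open>sqrt (4 * pi * u)\<close> of the remaining Gaussian integral
    also occurs in \<open>C\<close>; after cancellation the bound no longer depends on
    \<open>u\<close>.\<close>
  also have "\<dots> = K * exp (- (R\<^sup>2 / (4 * u))) * sqrt (pi / ((1 - \<theta>) / (4 * u)))"
    unfolding gauss_integral[OF a, symmetric] by (rule integral_mult_right_zero)
  also have "sqrt (pi / ((1 - \<theta>) / (4 * u))) = sqrt (4 * pi * u) / sqrt (1 - \<theta>)"
    by (simp add: real_sqrt_divide real_sqrt_mult field_simps)
  also have "K * exp (- (R\<^sup>2 / (4 * u))) * (sqrt (4 * pi * u) / sqrt (1 - \<theta>)) = C * (K / sqrt (1 - \<theta>))"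
    by (simp add: C_def)
  finally show ?thesis using C unfolding \<theta>_def by (simp only: mult_le_cancel_left_pos)
qed

text \<open>Completing the square in \<open>sqrt l\<close>. The bound explodes as \<open>u\<close>
  tends to 0, so apart from mere boundedness it serves only for the part of a section that is
  already exponentially small.\<close>

lemma cosh_heat_le:
  assumes "0 < u" "0 \<le> l" "0 \<le> R"
  shows "0 \<le> cosh_heat R u l" "cosh_heat R u l \<le> exp (R\<^sup>2 / (4 * u))"
proof -
  have "cosh (R * sqrt l) \<le> exp (R * sqrt l)"
    using assms by (simp add: cosh_def)
  then have "cosh_heat R u l \<le> exp (R * sqrt l) * exp (- u * l)"
    unfolding cosh_heat_def by (intro mult_right_mono) auto
  also have "\<dots> = exp (R * sqrt l - u * l)" by (simp flip: exp_add)
  also have "R * sqrt l - u * l \<le> R\<^sup>2 / (4 * u)"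
  proof -
    have "0 \<le> (2 * u * sqrt l - R)\<^sup>2" by simp
    also have "\<dots> = 4 * u\<^sup>2 * l - 4 * u * R * sqrt l + R\<^sup>2"
      using assms by (simp add: power2_diff power_mult_distrib)
    finally have "(4 * u) * (R * sqrt l - u * l) \<le> R\<^sup>2"
      by (simp add: power2_eq_square algebra_simps)
    then show ?thesis using assms by (simp add: pos_le_divide_eq mult.commute)
  qed
  finally show "cosh_heat R u l \<le> exp (R\<^sup>2 / (4 * u))" by simp
  show "0 \<le> cosh_heat R u l" by (simp add: cosh_heat_def)
qed

section \<open>Fibrewise linear algebra of a Euclidean bundle\<close>

locale l2_bundle =
  fixes M :: "'x::{metric_space, second_countable_topology} measure"
    and B :: "('x, 'v::real_vector, 'e::euclidean_space) vbundle"
  assumes sets_M: "sets M = sets borel"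
    and finite_ball: "emeasure M (ball x r) < \<infinity>"
    and euclidean: "euclidean_bundle B"
begin

lemmas [measurable_cong] = sets_M

lemma space_M [simp]: "space M = UNIV"
  using sets_eq_imp_space_eq[OF sets_M] by simp

lemma subspace_fibre: "subspace (fibre B x)"
  and inner_product_ip: "inner_product_on (fibre B x) (ip B x)"
  using euclidean[unfolded euclidean_bundle_def, THEN conjunct1] by simp_all

lemma fibre_0 [simp]: "0 \<in> fibre B x"
  and fibre_add: "u \<in> fibre B x \<Longrightarrow> v \<in> fibre B x \<Longrightarrow> u + v \<in> fibre B x"
  and fibre_diff: "u \<in> fibre B x \<Longrightarrow> v \<in> fibre B x \<Longrightarrow> u - v \<in> fibre B x"
  and fibre_scale: "u \<in> fibre B x \<Longrightarrow> a *\<^sub>R u \<in> fibre B x"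
  using subspace_fibre[of x] by (auto simp: subspace_0 subspace_add subspace_diff subspace_scale)

lemmas fibre_intros = fibre_0 fibre_add fibre_diff fibre_scale

lemmas ip_axioms = inner_product_ip[unfolded inner_product_on_def]

lemma ip_commute: "u \<in> fibre B x \<Longrightarrow> v \<in> fibre B x \<Longrightarrow> ip B x u v = ip B x v u"
  by (rule ip_axioms[THEN conjunct1, THEN bspec, THEN bspec])

lemma ip_add_left: "u \<in> fibre B x \<Longrightarrow> v \<in> fibre B x \<Longrightarrow> w \<in> fibre B x \<Longrightarrow> ip B x (u + v) w = ip B x u w + ip B x v w"
  by (rule ip_axioms[THEN conjunct2, THEN conjunct1, THEN bspec, THEN bspec, THEN bspec])

lemma ip_scale_left: "u \<in> fibre B x \<Longrightarrow> v \<in> fibre B x \<Longrightarrow> ip B x (a *\<^sub>R u) v = a * ip B x u v"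
  by (rule ip_axioms[THEN conjunct2, THEN conjunct2, THEN conjunct1, THEN spec, THEN bspec, THEN bspec])

lemma ip_pos: "u \<in> fibre B x \<Longrightarrow> u \<noteq> 0 \<Longrightarrow> 0 < ip B x u u"
  by (rule ip_axioms[THEN conjunct2, THEN conjunct2, THEN conjunct2, THEN bspec, THEN mp])

lemma ip_add_right: "u \<in> fibre B x \<Longrightarrow> v \<in> fibre B x \<Longrightarrow> w \<in> fibre B x \<Longrightarrow> ip B x w (u + v) = ip B x w u + ip B x w v"
  by (metis ip_commute ip_add_left fibre_add)

lemma ip_scale_right: "u \<in> fibre B x \<Longrightarrow> v \<in> fibre B x \<Longrightarrow> ip B x u (a *\<^sub>R v) = a * ip B x u v"
  by (metis ip_commute ip_scale_left fibre_scale)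

lemma ip_0_left [simp]: "v \<in> fibre B x \<Longrightarrow> ip B x 0 v = 0"
  using ip_scale_left[of v x v 0] by simp

lemma ip_0_right [simp]: "v \<in> fibre B x \<Longrightarrow> ip B x v 0 = 0"
  using ip_scale_right[of v x v 0] by simp

lemma ip_diff_left: "u \<in> fibre B x \<Longrightarrow> v \<in> fibre B x \<Longrightarrow> w \<in> fibre B x \<Longrightarrow> ip B x (u - v) w = ip B x u w - ip B x v w"
  using ip_add_left[of "u - v" x v w] by (simp add: fibre_diff)

lemma ip_diff_right: "u \<in> fibre B x \<Longrightarrow> v \<in> fibre B x \<Longrightarrow> w \<in> fibre B x \<Longrightarrow> ip B x w (u - v) = ip B x w u - ip B x w v"
  using ip_add_right[of "u - v" x v w] by (simp add: fibre_diff)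

lemma ip_nonneg: "u \<in> fibre B x \<Longrightarrow> 0 \<le> ip B x u u"
  by (cases "u = 0") (auto intro: less_imp_le ip_pos)

lemma ip_eq_0: "u \<in> fibre B x \<Longrightarrow> ip B x u u = 0 \<longleftrightarrow> u = 0"
  by (metis ip_0_left ip_pos less_irrefl)

lemma ip_sum_left:
  "(\<And>i. i \<in> I \<Longrightarrow> f i \<in> fibre B x) \<Longrightarrow> w \<in> fibre B x \<Longrightarrow>
   ip B x (\<Sum>i\<in>I. a i *\<^sub>R f i) w = (\<Sum>i\<in>I. a i * ip B x (f i) w)"
  by (induction I rule: infinite_finite_induct)
    (simp_all add: ip_add_left ip_scale_left fibre_scale subspace_sum[OF subspace_fibre])

lemma ip_sum_right:
  "(\<And>i. i \<in> I \<Longrightarrow> f i \<in> fibre B x) \<Longrightarrow> w \<in> fibre B x \<Longrightarrow>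
   ip B x w (\<Sum>i\<in>I. a i *\<^sub>R f i) = (\<Sum>i\<in>I. a i * ip B x w (f i))"
  by (induction I rule: infinite_finite_induct)
    (simp_all add: ip_add_right ip_scale_right fibre_scale subspace_sum[OF subspace_fibre])

lemma fnorm_nonneg [simp]: "v \<in> fibre B x \<Longrightarrow> 0 \<le> fnorm B x v"
  and fnorm_power2: "v \<in> fibre B x \<Longrightarrow> (fnorm B x v)\<^sup>2 = ip B x v v"
  by (simp_all add: fnorm_def ip_nonneg)

lemma ip_Cauchy_Schwarz:
  assumes "u \<in> fibre B x" "v \<in> fibre B x"
  shows "\<bar>ip B x u v\<bar> \<le> fnorm B x u * fnorm B x v"
proof (cases "v = 0")
  case False
  then have p: "0 < ip B x v v" using assms by (simp add: ip_pos)
  define a where "a = ip B x u v / ip B x v v"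
  have "0 \<le> ip B x (u - a *\<^sub>R v) (u - a *\<^sub>R v)"
    using assms by (simp add: ip_nonneg fibre_intros)
  also have "\<dots> = ip B x u u - a * ip B x u v"
    using assms p by (simp add: ip_diff_left ip_diff_right ip_scale_left ip_scale_right ip_commute[of v x u] fibre_intros a_def)
  finally have "(ip B x u v)\<^sup>2 \<le> ip B x u u * ip B x v v"
    using p by (simp add: a_def field_simps power2_eq_square)
  then have "sqrt ((ip B x u v)\<^sup>2) \<le> sqrt (ip B x u u * ip B x v v)" by (rule real_sqrt_le_mono)
  then show ?thesis by (simp add: fnorm_def real_sqrt_mult)
qed (use assms in \<open>simp add: fnorm_def\<close>)

section \<open>Charts\<close>

lemma
  assumes "(U, \<phi>) \<in> charts B"
  shows chart_open: "open U"
    and chart_linear: "x \<in> U \<Longrightarrow> linear (\<phi> x)"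
    and chart_bij: "x \<in> U \<Longrightarrow> bij_betw (\<phi> x) UNIV (fibre B x)"
    and chart_ip: "continuous_on U (\<lambda>x. ip B x (\<phi> x a) (\<phi> x b))"
  using bspec[OF euclidean[unfolded euclidean_bundle_def, THEN conjunct2, THEN conjunct2, THEN conjunct1] assms]
  by simp_all

lemma chart_transition:
  "(U, \<phi>) \<in> charts B \<Longrightarrow> (W, \<psi>) \<in> charts B \<Longrightarrow> continuous_on (U \<inter> W) (\<lambda>x. inv (\<psi> x) (\<phi> x a))"
  using euclidean[unfolded euclidean_bundle_def, THEN conjunct2, THEN conjunct2, THEN conjunct2] by fast

lemma chart_measurable: "(U, \<phi>) \<in> charts B \<Longrightarrow> U \<in> sets M"
  using chart_open sets_M by auto

lemma chart_fibre: "(U, \<phi>) \<in> charts B \<Longrightarrow> x \<in> U \<Longrightarrow> \<phi> x a \<in> fibre B x"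
  using chart_bij by (blast dest: bij_betw_apply)

lemma chart_inv_right:
  assumes "(U, \<phi>) \<in> charts B" "x \<in> U" "v \<in> fibre B x"
  shows "\<phi> x (inv (\<phi> x) v) = v"
  using chart_bij[OF assms(1,2)] assms(3) by (auto simp: bij_betw_def f_inv_into_f)

lemma chart_inv_left:
  assumes "(U, \<phi>) \<in> charts B" "x \<in> U"
  shows "inv (\<phi> x) (\<phi> x a) = a"
  using chart_bij[OF assms] by (auto simp: bij_betw_def)

lemma chart_inv_lincomb:
  assumes "(U, \<phi>) \<in> charts B" "x \<in> U" "u \<in> fibre B x" "v \<in> fibre B x"
  shows "inv (\<phi> x) (c *\<^sub>R u + v) = c *\<^sub>R inv (\<phi> x) u + inv (\<phi> x) v"
proof -
  have "c *\<^sub>R u + v = \<phi> x (c *\<^sub>R inv (\<phi> x) u + inv (\<phi> x) v)"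
    using chart_linear[OF assms(1,2)]
    by (simp add: linear_add linear_scale chart_inv_right[OF assms(1,2,3)] chart_inv_right[OF assms(1,2,4)])
  then show ?thesis using chart_inv_left[OF assms(1,2)] by simp
qed

text \<open>The Lindelof property of a second countable space. Measurability is stated chart by
  chart and glues only over countably many pieces.\<close>

lemma countable_atlas:
  obtains C where "countable C" "C \<subseteq> charts B" "(\<Union>(U, \<phi>)\<in>C. U) = UNIV"
proof -
  have cov: "\<Union>(fst ` charts B) = UNIV"
    using euclidean[unfolded euclidean_bundle_def, THEN conjunct2, THEN conjunct1] by (simp add: case_prod_beta)
  have "\<And>S. S \<in> fst ` charts B \<Longrightarrow> open S" using chart_open by auto
  from Lindelof[OF this] obtain F where F: "F \<subseteq> fst ` charts B" "countable F" "\<Union>F = \<Union>(fst ` charts B)"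
    by metis
  then obtain C where "countable C" "C \<subseteq> charts B" "F = fst ` C"
    by (meson countable_subset_image)
  with F cov that[of C] show thesis by (auto simp: case_prod_beta)
qed

lemma borel_measurable_chartwise:
  assumes "\<And>U \<phi>. (U, \<phi>) \<in> charts B \<Longrightarrow> f \<in> measurable (restrict_space M U) N"
  shows "f \<in> measurable M N"
proof -
  obtain C where C: "countable C" "C \<subseteq> charts B" "(\<Union>(U, \<phi>)\<in>C. U) = UNIV" by (rule countable_atlas)
  show ?thesis
  proof (rule measurable_piecewise_restrict[where C="fst ` C"])
    show "countable (fst ` C)" using C by auto
    show "space M \<subseteq> \<Union> (fst ` C)" using C(3) by (auto simp: case_prod_beta)
    show "\<Omega> \<inter> space M \<in> sets M" "f \<in> measurable (restrict_space M \<Omega>) N" if "\<Omega> \<in> fst ` C" for \<Omega>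
    proof -
      from that C(2) obtain \<phi> where "(\<Omega>, \<phi>) \<in> charts B" by auto
      then show "\<Omega> \<inter> space M \<in> sets M" "f \<in> measurable (restrict_space M \<Omega>) N"
        using assms chart_measurable by auto
    qed
  qed
qed

section \<open>Measurable sections\<close>

lemma section_fibre: "measurable_section B M f \<Longrightarrow> f x \<in> fibre B x"
  by (simp add: measurable_section_def)

lemma section_chart:
  "measurable_section B M f \<Longrightarrow> (U, \<phi>) \<in> charts B \<Longrightarrow> (\<lambda>x. inv (\<phi> x) (f x)) \<in> borel_measurable (restrict_space M U)"
  unfolding measurable_section_def by auto

lemma section_lincomb:
  assumes f: "measurable_section B M f" and g: "measurable_section B M g" and [measurable]: "a \<in> borel_measurable M"
  shows "measurable_section B M (\<lambda>x. a x *\<^sub>R f x + g x)"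
  unfolding measurable_section_def
proof (intro conjI allI, goal_cases)
  case 1 show ?case using f g by (simp add: section_fibre fibre_intros)
next
  case 2
  show ?case
  proof safe
    fix U \<phi> assume c: "(U, \<phi>) \<in> charts B"
    note [measurable] = section_chart[OF f c] section_chart[OF g c]
    have "a \<in> borel_measurable (restrict_space M U)" by (rule measurable_restrict_space1) simp
    then have "(\<lambda>x. a x *\<^sub>R inv (\<phi> x) (f x) + inv (\<phi> x) (g x)) \<in> borel_measurable (restrict_space M U)"
      by measurable
    then show "(\<lambda>x. inv (\<phi> x) (a x *\<^sub>R f x + g x)) \<in> borel_measurable (restrict_space M U)"
      by (rule measurable_cong[THEN iffD1, rotated])
         (simp add: space_restrict_space chart_inv_lincomb[OF c] section_fibre[OF f] section_fibre[OF g])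
  qed
qed

lemma section_0: "measurable_section B M (\<lambda>_. 0)"
  unfolding measurable_section_def
proof (intro conjI allI, goal_cases)
  case 2
  show ?case
  proof safe
    fix U \<phi> assume c: "(U, \<phi>) \<in> charts B"
    have "(\<lambda>x. 0) \<in> borel_measurable (restrict_space M U)" by simp
    then show "(\<lambda>x. inv (\<phi> x) 0) \<in> borel_measurable (restrict_space M U)"
    proof (rule measurable_cong[THEN iffD1, rotated])
      fix x assume "x \<in> space (restrict_space M U)"
      then have x: "x \<in> U" by (simp add: space_restrict_space)
      then show "0 = inv (\<phi> x) 0"
        using chart_inv_left[OF c x, of 0] linear_0[OF chart_linear[OF c x]] by simp
    qed
  qed
qed simp

lemma section_scale:
  assumes "measurable_section B M f" "a \<in> borel_measurable M"
  shows "measurable_section B M (\<lambda>x. a x *\<^sub>R f x)"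
  using section_lincomb[OF assms(1) section_0 assms(2)] by simp

text \<open>This is where the continuity of the transition maps enters: seen in another chart, a
  local frame field has continuous coordinates.\<close>

lemma section_frame:
  assumes c: "(U, \<phi>) \<in> charts B" and [measurable]: "E \<in> sets M" and "E \<subseteq> U"
  shows "measurable_section B M (cutoff E (\<lambda>x. \<phi> x a))"
  unfolding measurable_section_def
proof (intro conjI allI, goal_cases)
  case (1 x) show ?case using chart_fibre[OF c, of x a] \<open>E \<subseteq> U\<close> by (auto simp: cutoff_def indicator_def)
next
  case 2
  show ?case
  proof safe
    fix W \<psi> assume d: "(W, \<psi>) \<in> charts B"
    have W: "W \<in> sets M" "U \<in> sets M" using c d by (auto intro: chart_measurable)
    have op: "open (U \<inter> W)" using c d by (auto intro: chart_open)
    have "(\<lambda>x. inv (\<psi> x) (\<phi> x a)) \<in> borel_measurable (restrict_space borel (U \<inter> W))"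
      by (rule borel_measurable_continuous_on_restrict[OF chart_transition[OF c d]])
    then have 1: "(\<lambda>x. indicator (U \<inter> W) x *\<^sub>R inv (\<psi> x) (\<phi> x a)) \<in> borel_measurable M"
      using op by (subst (asm) borel_measurable_restrict_space_iff) (auto cong: measurable_cong_sets simp: sets_M)
    have "(\<lambda>x. indicator E x *\<^sub>R (indicator (U \<inter> W) x *\<^sub>R inv (\<psi> x) (\<phi> x a))) \<in> borel_measurable (restrict_space M W)"
      by (rule measurable_restrict_space1) (use 1 in measurable)
    then show "(\<lambda>x. inv (\<psi> x) (cutoff E (\<lambda>x. \<phi> x a) x)) \<in> borel_measurable (restrict_space M W)"
    proof (rule measurable_cong[THEN iffD1, rotated])
      fix x assume "x \<in> space (restrict_space M W)"
      then have x: "x \<in> W" by (simp add: space_restrict_space)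
      have "inv (\<psi> x) 0 = 0" using chart_inv_left[OF d x, of 0] linear_0[OF chart_linear[OF d x]] by simp
      then show "indicator E x *\<^sub>R (indicator (U \<inter> W) x *\<^sub>R inv (\<psi> x) (\<phi> x a)) = inv (\<psi> x) (cutoff E (\<lambda>x. \<phi> x a) x)"
        using x \<open>E \<subseteq> U\<close> by (auto simp: cutoff_def indicator_def)
    qed
  qed
qed

text \<open>In a chart the fibrewise product is bilinear in the measurable coordinates, with the
  continuous Gram matrix of the frame as coefficients.\<close>

lemma ip_measurable:
  assumes f: "measurable_section B M f" and g: "measurable_section B M g"
  shows "(\<lambda>x. ip B x (f x) (g x)) \<in> borel_measurable M"
proof (rule borel_measurable_chartwise)
  fix U \<phi> assume c: "(U, \<phi>) \<in> charts B"
  note [measurable] = section_chart[OF f c] section_chart[OF g c]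
  have [measurable]: "(\<lambda>x. ip B x (\<phi> x a) (\<phi> x b)) \<in> borel_measurable (restrict_space M U)" for a b
  proof -
    have "(\<lambda>x. ip B x (\<phi> x a) (\<phi> x b)) \<in> borel_measurable (restrict_space borel U)"
      by (rule borel_measurable_continuous_on_restrict[OF chart_ip[OF c]])
    moreover have "sets (restrict_space M U) = sets (restrict_space borel U)"
      by (rule sets_restrict_space_cong) (rule sets_M)
    ultimately show ?thesis by (simp cong: measurable_cong_sets)
  qed
  have "(\<lambda>x. \<Sum>i\<in>Basis. \<Sum>j\<in>Basis. (inv (\<phi> x) (f x) \<bullet> i) * ((inv (\<phi> x) (g x) \<bullet> j) * ip B x (\<phi> x i) (\<phi> x j)))
     \<in> borel_measurable (restrict_space M U)"
    by measurable
  then show "(\<lambda>x. ip B x (f x) (g x)) \<in> borel_measurable (restrict_space M U)"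
  proof (rule measurable_cong[THEN iffD1, rotated])
    fix x assume "x \<in> space (restrict_space M U)"
    then have x: "x \<in> U" by (simp add: space_restrict_space)
    have rep: "v = (\<Sum>i\<in>Basis. (inv (\<phi> x) v \<bullet> i) *\<^sub>R \<phi> x i)" if "v \<in> fibre B x" for v
    proof -
      have "v = \<phi> x (\<Sum>i\<in>Basis. (inv (\<phi> x) v \<bullet> i) *\<^sub>R i)"
        by (simp add: euclidean_representation chart_inv_right[OF c x that])
      also have "\<dots> = (\<Sum>i\<in>Basis. (inv (\<phi> x) v \<bullet> i) *\<^sub>R \<phi> x i)"
        using chart_linear[OF c x] by (simp add: linear_sum linear_scale)
      finally show ?thesis .
    qed
    have "ip B x (f x) (g x) = ip B x (\<Sum>i\<in>Basis. (inv (\<phi> x) (f x) \<bullet> i) *\<^sub>R \<phi> x i) (\<Sum>i\<in>Basis. (inv (\<phi> x) (g x) \<bullet> i) *\<^sub>R \<phi> x i)"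
      using rep[OF section_fibre[OF f]] rep[OF section_fibre[OF g]] by simp
    also have "\<dots> = (\<Sum>i\<in>Basis. \<Sum>j\<in>Basis. (inv (\<phi> x) (f x) \<bullet> i) * ((inv (\<phi> x) (g x) \<bullet> j) * ip B x (\<phi> x i) (\<phi> x j)))"
      by (subst ip_sum_left; (subst ip_sum_right)?)
         (simp_all add: chart_fibre[OF c x] subspace_sum[OF subspace_fibre] fibre_scale sum_distrib_left)
    finally show "(\<Sum>i\<in>Basis. \<Sum>j\<in>Basis. (inv (\<phi> x) (f x) \<bullet> i) * ((inv (\<phi> x) (g x) \<bullet> j) * ip B x (\<phi> x i) (\<phi> x j)))
       = ip B x (f x) (g x)" by simp
  qed
qed

end

lemma cutoff_cutoff: "cutoff E (cutoff F f) = cutoff (E \<inter> F) f"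
  by (auto simp: cutoff_def indicator_def)

lemma cutoff_Compl: "f x = cutoff E f x + cutoff (- E) f x"
  by (auto simp: cutoff_def indicator_def)

context l2_bundle
begin

section \<open>Square integrable sections\<close>

abbreviation "H \<equiv> L2 B M"
abbreviation inner2 (infixl "\<odot>" 70) where "f \<odot> g \<equiv> l2inner B M f g"
abbreviation norm2 where "norm2 \<equiv> l2norm B M"

lemma L2_section: "f \<in> H \<Longrightarrow> measurable_section B M f"
  by (simp add: L2_def)

lemma L2_fibre: "f \<in> H \<Longrightarrow> f x \<in> fibre B x"
  by (simp add: L2_section section_fibre)

lemma ip_le_square:
  assumes "u \<in> fibre B x" "v \<in> fibre B x"
  shows "\<bar>ip B x u v\<bar> \<le> ip B x u u + ip B x v v"
proof -
  have "2 * \<bar>ip B x u v\<bar> \<le> 2 * (fnorm B x u * fnorm B x v)" using ip_Cauchy_Schwarz[OF assms] by simp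
  also have "\<dots> \<le> (fnorm B x u)\<^sup>2 + (fnorm B x v)\<^sup>2" by (metis sum_squares_bound mult.assoc)
  finally show ?thesis using assms ip_nonneg[of u x] ip_nonneg[of v x] by (simp add: fnorm_power2)
qed

lemma L2_integrable:
  assumes "f \<in> H" "g \<in> H"
  shows "integrable M (\<lambda>x. ip B x (f x) (g x))"
proof (rule Bochner_Integration.integrable_bound)
  show "integrable M (\<lambda>x. ip B x (f x) (f x) + ip B x (g x) (g x))"
    using assms by (simp add: L2_def)
  show "(\<lambda>x. ip B x (f x) (g x)) \<in> borel_measurable M"
    using assms by (intro ip_measurable L2_section)
  show "AE x in M. norm (ip B x (f x) (g x)) \<le> norm (ip B x (f x) (f x) + ip B x (g x) (g x))"
  proof (rule AE_I2)
    fix x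
    show "norm (ip B x (f x) (g x)) \<le> norm (ip B x (f x) (f x) + ip B x (g x) (g x))"
      using ip_le_square[OF L2_fibre[OF assms(1), of x] L2_fibre[OF assms(2), of x]] by simp
  qed
qed

lemma L2_bound:
  assumes f: "f \<in> H" and g: "measurable_section B M g"
    and le: "\<And>x. ip B x (g x) (g x) \<le> K * ip B x (f x) (f x)"
  shows "g \<in> H"
proof -
  have "integrable M (\<lambda>x. ip B x (g x) (g x))"
  proof (rule Bochner_Integration.integrable_bound)
    show "integrable M (\<lambda>x. K * ip B x (f x) (f x))" using f by (simp add: L2_def)
    show "AE x in M. norm (ip B x (g x) (g x)) \<le> norm (K * ip B x (f x) (f x))"
    proof (rule AE_I2)
      fix x show "norm (ip B x (g x) (g x)) \<le> norm (K * ip B x (f x) (f x))"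
        using le[of x] ip_nonneg[OF section_fibre[OF g], of x] by simp
    qed
  qed (intro ip_measurable g)
  with g show ?thesis by (simp add: L2_def)
qed

lemma L2_mult:
  assumes f: "f \<in> H" and u: "u \<in> borel_measurable M" "\<And>x. \<bar>u x\<bar> \<le> K"
  shows "(\<lambda>x. u x *\<^sub>R f x) \<in> H"
proof (rule L2_bound[OF f])
  show "measurable_section B M (\<lambda>x. u x *\<^sub>R f x)" by (rule section_scale[OF L2_section[OF f] u(1)])
  fix x
  have "(u x)\<^sup>2 \<le> K\<^sup>2" using u(2)[of x] by (simp add: abs_le_square_iff[symmetric])
  then have "(u x)\<^sup>2 * ip B x (f x) (f x) \<le> K\<^sup>2 * ip B x (f x) (f x)"
    by (rule mult_right_mono) (rule ip_nonneg[OF L2_fibre[OF f]])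
  then show "ip B x (u x *\<^sub>R f x) (u x *\<^sub>R f x) \<le> K\<^sup>2 * ip B x (f x) (f x)"
    using L2_fibre[OF f] by (simp add: ip_scale_left ip_scale_right fibre_scale power2_eq_square mult.assoc)
qed

lemma L2_lincomb:
  assumes f: "f \<in> H" and g: "g \<in> H"
  shows "(\<lambda>x. a *\<^sub>R f x + g x) \<in> H"
proof -
  have s: "measurable_section B M (\<lambda>x. a *\<^sub>R f x + g x)"
    by (rule section_lincomb[OF L2_section[OF f] L2_section[OF g]]) simp
  have "ip B x (a *\<^sub>R f x + g x) (a *\<^sub>R f x + g x) = a\<^sup>2 * ip B x (f x) (f x) + 2 * a * ip B x (f x) (g x) + ip B x (g x) (g x)" for x
    using L2_fibre[OF f, of x] L2_fibre[OF g, of x]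
    by (simp add: ip_add_left ip_add_right ip_scale_left ip_scale_right fibre_intros ip_commute[of "g x" x "f x"]
        power2_eq_square algebra_simps)
  then have "integrable M (\<lambda>x. ip B x (a *\<^sub>R f x + g x) (a *\<^sub>R f x + g x))"
    using L2_integrable[OF f f] L2_integrable[OF g g] L2_integrable[OF f g] by simp
  with s show ?thesis by (simp add: L2_def)
qed

lemma L2_0: "(\<lambda>_. 0) \<in> H"
  using section_0 by (simp add: L2_def)

lemma L2_scale: "f \<in> H \<Longrightarrow> (\<lambda>x. a *\<^sub>R f x) \<in> H"
  using L2_lincomb[OF _ L2_0] by simp

lemma L2_add: "f \<in> H \<Longrightarrow> g \<in> H \<Longrightarrow> (\<lambda>x. f x + g x) \<in> H"
  using L2_lincomb[of f g 1] by simp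

lemma L2_diff: "f \<in> H \<Longrightarrow> g \<in> H \<Longrightarrow> (\<lambda>x. f x - g x) \<in> H"
  using L2_lincomb[of g f "-1"] by simp

lemma L2_cutoff:
  assumes "f \<in> H" "E \<in> sets M" shows "cutoff E f \<in> H"
  unfolding cutoff_def by (rule L2_mult[OF assms(1), where K=1]) (use assms(2) in \<open>auto simp: indicator_def\<close>)

lemmas L2_intros = L2_0 L2_scale L2_add L2_diff L2_cutoff L2_lincomb

lemma inner_commute: "f \<in> H \<Longrightarrow> g \<in> H \<Longrightarrow> f \<odot> g = g \<odot> f"
  unfolding l2inner_def by (intro Bochner_Integration.integral_cong refl ip_commute L2_fibre)

lemma inner_lincomb_left:
  assumes "f \<in> H" "g \<in> H" "k \<in> H"
  shows "(\<lambda>x. a *\<^sub>R f x + g x) \<odot> k = a * (f \<odot> k) + g \<odot> k"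
proof -
  have "(\<lambda>x. a *\<^sub>R f x + g x) \<odot> k = (LINT x|M. a * ip B x (f x) (k x) + ip B x (g x) (k x))"
    unfolding l2inner_def
    by (intro Bochner_Integration.integral_cong refl)
       (simp add: ip_add_left ip_scale_left fibre_intros L2_fibre assms)
  then show ?thesis unfolding l2inner_def using L2_integrable assms by simp
qed

lemma inner_0_left: "k \<in> H \<Longrightarrow> (\<lambda>_. 0) \<odot> k = 0"
  by (simp add: l2inner_def L2_fibre)

lemma inner_scale_left: "f \<in> H \<Longrightarrow> k \<in> H \<Longrightarrow> (\<lambda>x. a *\<^sub>R f x) \<odot> k = a * (f \<odot> k)"
  using inner_lincomb_left[of f "\<lambda>_. 0" k a] L2_0 inner_0_left by simp

lemma inner_add_left: "f \<in> H \<Longrightarrow> g \<in> H \<Longrightarrow> k \<in> H \<Longrightarrow> (\<lambda>x. f x + g x) \<odot> k = f \<odot> k + g \<odot> k"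
  using inner_lincomb_left[of f g k 1] by simp

lemma inner_diff_left: "f \<in> H \<Longrightarrow> g \<in> H \<Longrightarrow> k \<in> H \<Longrightarrow> (\<lambda>x. f x - g x) \<odot> k = f \<odot> k - g \<odot> k"
  using inner_lincomb_left[of g f k "-1"] by simp

lemma inner_add_right: "f \<in> H \<Longrightarrow> g \<in> H \<Longrightarrow> k \<in> H \<Longrightarrow> k \<odot> (\<lambda>x. f x + g x) = k \<odot> f + k \<odot> g"
  by (simp add: inner_commute[of k] L2_add inner_add_left)

lemma inner_diff_right: "f \<in> H \<Longrightarrow> g \<in> H \<Longrightarrow> k \<in> H \<Longrightarrow> k \<odot> (\<lambda>x. f x - g x) = k \<odot> f - k \<odot> g"
  by (simp add: inner_commute[of k] L2_diff inner_diff_left)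

lemma inner_scale_right: "f \<in> H \<Longrightarrow> k \<in> H \<Longrightarrow> k \<odot> (\<lambda>x. a *\<^sub>R f x) = a * (k \<odot> f)"
  by (simp add: inner_commute[of k] L2_scale inner_scale_left)

lemma inner_lincomb_right:
  "f \<in> H \<Longrightarrow> g \<in> H \<Longrightarrow> k \<in> H \<Longrightarrow> k \<odot> (\<lambda>x. a *\<^sub>R f x + g x) = a * (k \<odot> f) + k \<odot> g"
  by (simp add: inner_commute[of k] L2_lincomb inner_lincomb_left)

lemma inner_nonneg: "f \<in> H \<Longrightarrow> 0 \<le> f \<odot> f"
  unfolding l2inner_def by (intro Bochner_Integration.integral_nonneg ip_nonneg L2_fibre)

lemma norm_nonneg [simp]: "f \<in> H \<Longrightarrow> 0 \<le> norm2 f"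
  and norm_power2: "f \<in> H \<Longrightarrow> (norm2 f)\<^sup>2 = f \<odot> f"
  by (simp_all add: l2norm_def inner_nonneg)

lemma norm_scale: "f \<in> H \<Longrightarrow> norm2 (\<lambda>x. a *\<^sub>R f x) = \<bar>a\<bar> * norm2 f"
  by (simp add: l2norm_def inner_scale_left inner_scale_right L2_scale real_sqrt_mult flip: mult.assoc)

lemma Cauchy_Schwarz:
  assumes f: "f \<in> H" and g: "g \<in> H"
  shows "\<bar>f \<odot> g\<bar> \<le> norm2 f * norm2 g"
proof -
  have q: "0 \<le> a\<^sup>2 * (f \<odot> f) + 2 * a * (f \<odot> g) + g \<odot> g" for a
  proof -
    let ?s = "\<lambda>x. a *\<^sub>R f x + g x"
    have "0 \<le> ?s \<odot> ?s" by (intro inner_nonneg L2_lincomb f g)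
    also have "?s \<odot> ?s = a * (f \<odot> ?s) + g \<odot> ?s" by (intro inner_lincomb_left L2_lincomb f g)
    also have "\<dots> = a\<^sup>2 * (f \<odot> f) + 2 * a * (f \<odot> g) + g \<odot> g"
      by (simp add: inner_lincomb_right[OF f g f] inner_lincomb_right[OF f g g] inner_commute[OF g f]
          power2_eq_square distrib_left mult.assoc)
    finally show ?thesis .
  qed
  have "(f \<odot> g)\<^sup>2 \<le> (f \<odot> f) * (g \<odot> g)"
  proof (cases "f \<odot> f = 0")
    case True
    have "f \<odot> g = 0"
    proof (rule ccontr)
      assume "f \<odot> g \<noteq> 0"
      \<comment> \<open>Here \<open>f\<close> may be nonzero on a null set, so
        \<open>f \<odot> f = 0\<close> is a genuine case. The quadratic degenerates to an affine
        function of \<open>a\<close>, and this \<open>a\<close> gives it the value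
        \<open>- 1\<close>.\<close>
      then show False using q[of "- (g \<odot> g + 1) / (2 * (f \<odot> g))"] True by (simp add: field_simps)
    qed
    then show ?thesis using True by simp
  next
    case False
    then have p: "0 < f \<odot> f" using inner_nonneg[OF f] by simp
    from q[of "- (f \<odot> g) / (f \<odot> f)"] p show ?thesis
      by (simp add: field_simps power2_eq_square)
  qed
  then have "sqrt ((f \<odot> g)\<^sup>2) \<le> sqrt ((f \<odot> f) * (g \<odot> g))" by (rule real_sqrt_le_mono)
  then show ?thesis by (simp add: l2norm_def real_sqrt_mult)
qed

lemma norm_triangle:
  assumes f: "f \<in> H" and g: "g \<in> H"
  shows "norm2 (\<lambda>x. f x + g x) \<le> norm2 f + norm2 g"
proof (rule power2_le_imp_le)
  have "(norm2 (\<lambda>x. f x + g x))\<^sup>2 = (norm2 f)\<^sup>2 + 2 * (f \<odot> g) + (norm2 g)\<^sup>2"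
    using f g by (simp add: norm_power2 L2_add inner_add_left inner_add_right inner_commute[of g f])
  also have "\<dots> \<le> (norm2 f + norm2 g)\<^sup>2"
    using Cauchy_Schwarz[OF f g] by (simp add: power2_sum)
  finally show "(norm2 (\<lambda>x. f x + g x))\<^sup>2 \<le> (norm2 f + norm2 g)\<^sup>2" .
qed (use assms in simp)

lemma norm_diff_commute: "f \<in> H \<Longrightarrow> g \<in> H \<Longrightarrow> norm2 (\<lambda>x. f x - g x) = norm2 (\<lambda>x. g x - f x)"
  using norm_scale[OF L2_diff, of g f "-1"] by simp

lemma norm_diff_triangle:
  assumes "f \<in> H" "g \<in> H" "k \<in> H"
  shows "norm2 (\<lambda>x. f x - k x) \<le> norm2 (\<lambda>x. f x - g x) + norm2 (\<lambda>x. g x - k x)"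
  using norm_triangle[OF L2_diff[OF assms(1,2)] L2_diff[OF assms(2,3)]] by simp

lemma norm_le_diff:
  assumes "f \<in> H" "g \<in> H"
  shows "norm2 f \<le> norm2 (\<lambda>x. f x - g x) + norm2 g"
  using norm_triangle[OF L2_diff[OF assms] assms(2)] by simp

lemma inner_cutoff:
  assumes "f \<in> H" "g \<in> H"
  shows "cutoff E f \<odot> g = f \<odot> cutoff E g"
  unfolding l2inner_def cutoff_def
  by (intro Bochner_Integration.integral_cong refl) (simp add: ip_scale_left ip_scale_right L2_fibre assms)

lemma norm_mono:
  assumes "f \<in> H" "g \<in> H" "AE x in M. ip B x (f x) (f x) \<le> ip B x (g x) (g x)"
  shows "norm2 f \<le> norm2 g"
  unfolding l2norm_def l2inner_def real_sqrt_le_iff by (intro integral_mono_AE L2_integrable assms)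

lemma norm_cong: "AE x in M. f x = g x \<Longrightarrow> f \<in> H \<Longrightarrow> g \<in> H \<Longrightarrow> norm2 f = norm2 g"
  by (intro antisym norm_mono) auto

lemma inner_cong_left:
  assumes "AE x in M. f x = g x" "f \<in> H" "g \<in> H" "k \<in> H"
  shows "f \<odot> k = g \<odot> k"
  unfolding l2inner_def using assms
  by (intro integral_cong_AE) (auto intro!: ip_measurable L2_section)

lemma norm_cutoff_le: "f \<in> H \<Longrightarrow> E \<in> sets M \<Longrightarrow> norm2 (cutoff E f) \<le> norm2 f"
  by (intro norm_mono L2_cutoff AE_I2)
     (auto simp: cutoff_def indicator_def ip_nonneg L2_fibre)

lemma norm_eq_0:
  assumes f: "f \<in> H"
  shows "norm2 f = 0 \<longleftrightarrow> (AE x in M. f x = 0)"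
proof -
  have "norm2 f = 0 \<longleftrightarrow> (AE x in M. ip B x (f x) (f x) = 0)"
    unfolding l2norm_def l2inner_def
    using integral_nonneg_eq_0_iff_AE[OF L2_integrable[OF f f]] ip_nonneg L2_fibre[OF f] by simp
  also have "\<dots> \<longleftrightarrow> (AE x in M. f x = 0)" by (simp add: ip_eq_0 L2_fibre[OF f])
  finally show ?thesis .
qed

text \<open>Partial unions, simple functions and truncations all enter the density argument as
  bounded scalar multipliers of one fixed section, so this form of dominated convergence covers them
  all.\<close>

lemma norm_tendsto_dominated:
  assumes f: "f \<in> H" and [measurable]: "\<And>n. u n \<in> borel_measurable M" "v \<in> borel_measurable M"
    and bnd: "\<And>n x. \<bar>u n x\<bar> \<le> K" and lim: "\<And>x. (\<lambda>n. u n x) \<longlonglongrightarrow> v x"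
  shows "(\<lambda>n. norm2 (\<lambda>x. v x *\<^sub>R f x - u n x *\<^sub>R f x)) \<longlonglongrightarrow> 0"
proof -
  have [measurable]: "(\<lambda>x. ip B x (f x) (f x)) \<in> borel_measurable M" by (intro ip_measurable L2_section f)
  have vb: "\<bar>v x\<bar> \<le> K" for x
    by (rule LIMSEQ_le_const2[OF tendsto_rabs[OF lim]]) (use bnd in auto)
  have "(\<lambda>n. LINT x|M. (v x - u n x)\<^sup>2 * ip B x (f x) (f x)) \<longlonglongrightarrow> (LINT x|M. 0)"
  proof (rule integral_dominated_convergence[where w="\<lambda>x. (2 * K)\<^sup>2 * ip B x (f x) (f x)"])
    show "integrable M (\<lambda>x. (2 * K)\<^sup>2 * ip B x (f x) (f x))"
      using L2_integrable[OF f f] by simp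
    show "AE x in M. (\<lambda>n. (v x - u n x)\<^sup>2 * ip B x (f x) (f x)) \<longlonglongrightarrow> 0"
    proof (rule AE_I2)
      fix x
      have "(\<lambda>n. (v x - u n x)\<^sup>2 * ip B x (f x) (f x)) \<longlonglongrightarrow> (v x - v x)\<^sup>2 * ip B x (f x) (f x)"
        by (intro tendsto_intros lim)
      then show "(\<lambda>n. (v x - u n x)\<^sup>2 * ip B x (f x) (f x)) \<longlonglongrightarrow> 0" by simp
    qed
    fix n
    show "AE x in M. norm ((v x - u n x)\<^sup>2 * ip B x (f x) (f x)) \<le> (2 * K)\<^sup>2 * ip B x (f x) (f x)"
    proof (rule AE_I2)
      fix x
      have "\<bar>v x - u n x\<bar> \<le> \<bar>2 * K\<bar>" using vb[of x] bnd[of n x] by linarith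
      then have "(v x - u n x)\<^sup>2 \<le> (2 * K)\<^sup>2" by (simp only: abs_le_square_iff)
      then show "norm ((v x - u n x)\<^sup>2 * ip B x (f x) (f x)) \<le> (2 * K)\<^sup>2 * ip B x (f x) (f x)"
        using ip_nonneg[OF L2_fibre[OF f], of x] by (simp add: mult_right_mono)
    qed
  qed measurable
  moreover have "(norm2 (\<lambda>x. v x *\<^sub>R f x - u n x *\<^sub>R f x)) = sqrt (LINT x|M. (v x - u n x)\<^sup>2 * ip B x (f x) (f x))" for n
    unfolding l2norm_def l2inner_def
    by (intro arg_cong[where f=sqrt] Bochner_Integration.integral_cong refl)
       (simp flip: scaleR_diff_left add: ip_scale_left ip_scale_right L2_fibre[OF f] fibre_scale power2_eq_square)
  ultimately show ?thesis using tendsto_real_sqrt by fastforce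
qed

end

context l2_bundle
begin

section \<open>Separability of \<open>L\<^sup>2\<close>\<close>

text \<open>The closure of \<open>C\<close> in L2.\<close>

definition approximable :: "('x \<Rightarrow> 'v) set \<Rightarrow> ('x \<Rightarrow> 'v) set" where
  "approximable C = {f \<in> H. \<forall>\<epsilon>>0. \<exists>g\<in>C. norm2 (\<lambda>x. f x - g x) < \<epsilon>}"

lemma approximable_limit:
  assumes C: "C \<subseteq> H" and f: "f \<in> H" and fn: "\<And>n. fn n \<in> approximable C"
    and lim: "(\<lambda>n. norm2 (\<lambda>x. f x - fn n x)) \<longlonglongrightarrow> 0"
  shows "f \<in> approximable C"
  unfolding approximable_def
proof (intro CollectI conjI f allI impI)
  fix \<epsilon> :: real assume \<epsilon>: "0 < \<epsilon>"
  from order_tendstoD(2)[OF lim half_gt_zero[OF \<epsilon>]] obtain n where n: "norm2 (\<lambda>x. f x - fn n x) < \<epsilon> / 2"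
    by (auto simp: eventually_sequentially)
  obtain g where g: "g \<in> C" "norm2 (\<lambda>x. fn n x - g x) < \<epsilon> / 2"
    using fn[of n] \<epsilon> unfolding approximable_def by (auto dest!: spec[of _ "\<epsilon> / 2"])
  have "norm2 (\<lambda>x. f x - g x) \<le> norm2 (\<lambda>x. f x - fn n x) + norm2 (\<lambda>x. fn n x - g x)"
    using fn[of n] g C f by (intro norm_diff_triangle) (auto simp: approximable_def)
  with n g show "\<exists>g\<in>C. norm2 (\<lambda>x. f x - g x) < \<epsilon>" by (intro bexI[of _ g]) auto
qed

text \<open>Rational coefficients keep the dense set countable. Replacing a real coefficient by a
  rational one costs only \<open>\<bar>a - q\<bar> * norm2 f\<close>, so the closure is a real
  subspace.\<close>

lemma approximable_lincomb:
  assumes C: "C \<subseteq> H" and Ccl: "\<And>q f g. f \<in> C \<Longrightarrow> g \<in> C \<Longrightarrow> (\<lambda>x. real_of_rat q *\<^sub>R f x + g x) \<in> C"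
    and f: "f \<in> approximable C" and g: "g \<in> approximable C"
  shows "(\<lambda>x. a *\<^sub>R f x + g x) \<in> approximable C"
  unfolding approximable_def
proof (intro CollectI conjI allI impI)
  have H: "f \<in> H" "g \<in> H" using f g by (auto simp: approximable_def)
  then show "(\<lambda>x. a *\<^sub>R f x + g x) \<in> H" by (rule L2_lincomb)
  fix \<epsilon> :: real assume \<epsilon>: "0 < \<epsilon>"
  have cancel: "c * (\<epsilon> / (3 * c)) = \<epsilon> / 3" if "0 < c" for c using that by simp
  define \<delta> where "\<delta> = \<epsilon> / (3 * (1 + norm2 f))"
  have nf: "0 < 1 + norm2 f" using norm_nonneg[OF H(1)] by linarith
  then have \<delta>: "0 < \<delta>" using \<epsilon> by (simp add: \<delta>_def)
  obtain q where q: "a - \<delta> < real_of_rat q" "real_of_rat q < a"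
    using of_rat_dense[of "a - \<delta>" a] \<delta> by auto
  let ?q = "real_of_rat q"
  \<comment> \<open>The accuracy demanded of \<open>f'\<close> depends on the rational coefficient,
    which therefore has to be chosen before it.\<close>
  obtain f' where f': "f' \<in> C" "norm2 (\<lambda>x. f x - f' x) < \<epsilon> / (3 * (1 + \<bar>?q\<bar>))"
  proof -
    have "0 < \<epsilon> / (3 * (1 + \<bar>?q\<bar>))" 
      using \<epsilon> by (intro divide_pos_pos mult_pos_pos add_pos_nonneg[OF zero_less_one abs_ge_zero]) simp_all
    then show thesis using f that unfolding approximable_def by blast
  qed
  obtain g' where g': "g' \<in> C" "norm2 (\<lambda>x. g x - g' x) < \<epsilon> / 3"
    using g \<epsilon> unfolding approximable_def by (auto dest!: spec[of _ "\<epsilon> / 3"])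
  have H': "f' \<in> H" "g' \<in> H" using f' g' C by auto
  have "norm2 (\<lambda>x. (a *\<^sub>R f x + g x) - (?q *\<^sub>R f' x + g' x))
      = norm2 (\<lambda>x. ((a - ?q) *\<^sub>R f x + ?q *\<^sub>R (f x - f' x)) + (g x - g' x))"
    by (intro arg_cong[where f=norm2] ext) (simp add: algebra_simps)
  also have "\<dots> \<le> norm2 (\<lambda>x. (a - ?q) *\<^sub>R f x + ?q *\<^sub>R (f x - f' x)) + norm2 (\<lambda>x. g x - g' x)"
    by (intro norm_triangle L2_intros H H')
  also have "\<dots> \<le> norm2 (\<lambda>x. (a - ?q) *\<^sub>R f x) + norm2 (\<lambda>x. ?q *\<^sub>R (f x - f' x)) + norm2 (\<lambda>x. g x - g' x)"
    by (intro add_right_mono norm_triangle L2_intros H H')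
  also have "\<dots> = \<bar>a - ?q\<bar> * norm2 f + \<bar>?q\<bar> * norm2 (\<lambda>x. f x - f' x) + norm2 (\<lambda>x. g x - g' x)"
    by (simp add: norm_scale L2_intros H H')
  also have "\<dots> < \<epsilon> / 3 + \<epsilon> / 3 + \<epsilon> / 3"
  proof (intro add_le_less_mono add_mono g')
    have "\<bar>a - ?q\<bar> * norm2 f \<le> \<delta> * (1 + norm2 f)"
      using q H by (intro mult_mono) auto
    also have "\<dots> = \<epsilon> / 3" using cancel[of "1 + norm2 f"] nf by (simp add: \<delta>_def mult.commute)
    finally show "\<bar>a - ?q\<bar> * norm2 f \<le> \<epsilon> / 3" .
    have "\<bar>?q\<bar> * norm2 (\<lambda>x. f x - f' x) \<le> (1 + \<bar>?q\<bar>) * (\<epsilon> / (3 * (1 + \<bar>?q\<bar>)))"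
      using f' by (intro mult_mono norm_nonneg L2_diff H H') auto
    also have "\<dots> = \<epsilon> / 3" by (rule cancel) (metis abs_ge_zero add_pos_nonneg zero_less_one)
    finally show "\<bar>?q\<bar> * norm2 (\<lambda>x. f x - f' x) \<le> \<epsilon> / 3" .
  qed
  finally show "\<exists>g'\<in>C. norm2 (\<lambda>x. (a *\<^sub>R f x + g x) - g' x) < \<epsilon>"
    using Ccl[OF f'(1) g'(1)] by (intro bexI[of _ "\<lambda>x. ?q *\<^sub>R f' x + g' x"]) auto
qed

text \<open>Finite combinations are encoded by lists of pairs of a coefficient and a section, so
  that countability is that of the lists over a countable set.\<close>

definition rat_span :: "('x \<Rightarrow> 'v) set \<Rightarrow> ('x \<Rightarrow> 'v) set" where
  "rat_span S = (\<lambda>l x. \<Sum>(q, f)\<leftarrow>l. real_of_rat q *\<^sub>R f x) ` lists (UNIV \<times> S)"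

lemma countable_rat_span: "countable S \<Longrightarrow> countable (rat_span S)"
  unfolding rat_span_def by (intro countable_image countable_lists) auto

lemma rat_span_base: "f \<in> S \<Longrightarrow> f \<in> rat_span S"
  unfolding rat_span_def by (rule image_eqI[of _ _ "[(1, f)]"]) auto

lemma rat_span_0: "(\<lambda>x. 0) \<in> rat_span S"
  unfolding rat_span_def by (rule image_eqI[of _ _ "[]"]) auto

lemma rat_span_lincomb:
  assumes "f \<in> rat_span S" "g \<in> rat_span S"
  shows "(\<lambda>x. real_of_rat q *\<^sub>R f x + g x) \<in> rat_span S"
proof -
  obtain k l where kl: "k \<in> lists (UNIV \<times> S)" "l \<in> lists (UNIV \<times> S)"
    "f = (\<lambda>x. \<Sum>(q, f)\<leftarrow>k. real_of_rat q *\<^sub>R f x)" "g = (\<lambda>x. \<Sum>(q, f)\<leftarrow>l. real_of_rat q *\<^sub>R f x)"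
    using assms unfolding rat_span_def by auto
  have *: "(\<Sum>(q, f)\<leftarrow>map (\<lambda>(r, f). (q * r, f)) k. real_of_rat q *\<^sub>R f x) = real_of_rat q *\<^sub>R (\<Sum>(q, f)\<leftarrow>k. real_of_rat q *\<^sub>R f x)" for x
    by (induction k) (auto simp: of_rat_mult scaleR_add_right)
  show ?thesis
    unfolding rat_span_def
  proof (rule image_eqI)
    show "map (\<lambda>(r, f). (q * r, f)) k @ l \<in> lists (UNIV \<times> S)" using kl by auto
    show "(\<lambda>x. real_of_rat q *\<^sub>R f x + g x) = (\<lambda>x. \<Sum>(q, f)\<leftarrow>map (\<lambda>(r, f). (q * r, f)) k @ l. real_of_rat q *\<^sub>R f x)"
      unfolding map_append sum_list_append * kl(3,4) by simp
  qed
qed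

lemma rat_span_L2: "S \<subseteq> H \<Longrightarrow> rat_span S \<subseteq> H"
proof -
  assume S: "S \<subseteq> H"
  have "(\<lambda>x. \<Sum>(q, f)\<leftarrow>l. real_of_rat q *\<^sub>R f x) \<in> H" if "l \<in> lists (UNIV \<times> S)" for l
    using that
  proof (induction l)
    case Nil then show ?case by (simp add: L2_0)
  next
    case (Cons a l)
    obtain q f where a: "a = (q, f)" by (cases a)
    then show ?case using Cons S by (auto intro!: L2_intros)
  qed
  then show ?thesis by (auto simp: rat_span_def)
qed

text \<open>Stability under intersections makes the generator fit for Dynkin's theorem in
  \<open>separable_L2\<close>, and the member \<open>UNIV\<close> supplies the minuend when
  complements are written as differences.\<close>

lemma countable_Int_stable_basis:
  obtains \<O> :: "'x set set" where "countable \<O>" "\<O> \<subseteq> Collect open" "Int_stable \<O>" "UNIV \<in> \<O>"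
    "sets borel = sigma_sets UNIV \<O>"
proof -
  obtain \<B> :: "'x set set" where \<B>: "countable \<B>" "topological_basis \<B>" using ex_countable_basis by auto
  define \<O> where "\<O> = Inter ` {F. finite F \<and> F \<subseteq> \<B>}"
  show thesis
  proof
    show "countable \<O>" unfolding \<O>_def by (intro countable_image countable_Collect_finite_subset \<B>)
    show op: "\<O> \<subseteq> Collect open"
      using topological_basis_open[OF \<B>(2)] by (auto simp: \<O>_def intro!: open_Inter)
    show "Int_stable \<O>"
    proof (rule Int_stableI)
      fix a b assume "a \<in> \<O>" "b \<in> \<O>"
      then obtain F G where "finite F" "F \<subseteq> \<B>" "a = \<Inter>F" "finite G" "G \<subseteq> \<B>" "b = \<Inter>G" by (auto simp: \<O>_def)
      then show "a \<inter> b \<in> \<O>" unfolding \<O>_def by (intro image_eqI[of _ _ "F \<union> G"]) auto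
    qed
    show "UNIV \<in> \<O>" unfolding \<O>_def by (intro image_eqI[of _ _ "{}"]) auto
    have sub: "\<B> \<subseteq> \<O>"
    proof
      fix b assume "b \<in> \<B>" then show "b \<in> \<O>" unfolding \<O>_def by (intro image_eqI[of _ _ "{b}"]) auto
    qed
    have "topological_basis \<O>"
      unfolding topological_basis_def
    proof (intro conjI ballI allI impI)
      show "open b" if "b \<in> \<O>" for b using op that by auto
      show "\<exists>B'\<subseteq>\<O>. \<Union>B' = x" if "open x" for x
        using topological_basisE \<B>(2) sub that unfolding topological_basis_def by (meson subset_trans)
    qed
    from arg_cong[OF borel_eq_countable_basis[OF \<open>countable \<O>\<close> this], of sets]
    have "sets borel = sets (sigma UNIV \<O>)" .
    also have "\<dots> = sigma_sets UNIV \<O>" by (rule sets_measure_of) simp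
    finally show "sets borel = sigma_sets UNIV \<O>" .
  qed
qed

text \<open>The part of a chart domain on which the frame is bounded and which has finite measure,
  so that frame fields cut off to it are square integrable. The point \<open>undefined\<close> is
  just some fixed centre.\<close>

definition piece :: "'x set \<Rightarrow> ('x \<Rightarrow> 'e \<Rightarrow> 'v) \<Rightarrow> nat \<Rightarrow> 'x set" where
  "piece U \<phi> N = {x \<in> U \<inter> ball undefined (real N). \<forall>i\<in>Basis. ip B x (\<phi> x i) (\<phi> x i) \<le> real N}"

lemma frame_measurable:
  assumes c: "(U, \<phi>) \<in> charts B"
  shows "(\<lambda>x. indicator U x * ip B x (\<phi> x a) (\<phi> x b)) \<in> borel_measurable M"
proof -
  have s: "measurable_section B M (cutoff U (\<lambda>x. \<phi> x a))" for a
    by (rule section_frame[OF c chart_measurable[OF c]]) simp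
  have "(\<lambda>x. ip B x (cutoff U (\<lambda>x. \<phi> x a) x) (cutoff U (\<lambda>x. \<phi> x b) x)) \<in> borel_measurable M"
    by (intro ip_measurable s)
  moreover have "ip B x (cutoff U (\<lambda>x. \<phi> x a) x) (cutoff U (\<lambda>x. \<phi> x b) x) = indicator U x * ip B x (\<phi> x a) (\<phi> x b)" for x
    by (cases "x \<in> U") (auto simp: cutoff_def)
  ultimately show ?thesis by simp
qed

lemma piece_measurable:
  assumes c: "(U, \<phi>) \<in> charts B"
  shows "piece U \<phi> N \<in> sets M"
proof -
  note [measurable] = frame_measurable[OF c] chart_measurable[OF c]
  have "U \<inter> ball undefined (real N) \<inter> (\<Inter>i\<in>Basis. {x \<in> space M. indicator U x * ip B x (\<phi> x i) (\<phi> x i) \<le> real N}) \<in> sets M"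
    using borel_measurable_le[OF frame_measurable[OF c] borel_measurable_const] chart_measurable[OF c]
    by (intro sets.Int sets.finite_INT) (auto simp: sets_M)
  also have "U \<inter> ball undefined (real N) \<inter> (\<Inter>i\<in>Basis. {x \<in> space M. indicator U x * ip B x (\<phi> x i) (\<phi> x i) \<le> real N}) = piece U \<phi> N"
    by (auto simp: piece_def)
  finally show ?thesis .
qed

lemma piece_frame_L2:
  assumes c: "(U, \<phi>) \<in> charts B" and E: "E \<in> sets M" and i: "i \<in> Basis"
  shows "cutoff (piece U \<phi> N \<inter> E) (\<lambda>x. \<phi> x i) \<in> H"
proof -
  let ?P = "piece U \<phi> N \<inter> E"
  have P: "?P \<in> sets M" using piece_measurable[OF c] E by auto
  have s: "measurable_section B M (cutoff ?P (\<lambda>x. \<phi> x i))"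
    by (rule section_frame[OF c P]) (auto simp: piece_def)
  have "emeasure M ?P \<le> emeasure M (ball undefined (real N))"
    by (rule emeasure_mono) (auto simp: piece_def sets_M)
  then have fin: "emeasure M ?P < \<infinity>" using finite_ball[of undefined "real N"] by (rule le_less_trans)
  have "integrable M (\<lambda>x. ip B x (cutoff ?P (\<lambda>x. \<phi> x i) x) (cutoff ?P (\<lambda>x. \<phi> x i) x))"
  proof (rule Bochner_Integration.integrable_bound)
    show "integrable M (\<lambda>x. real N * indicator ?P x)"
      using P fin by simp
    show "AE x in M. norm (ip B x (cutoff ?P (\<lambda>x. \<phi> x i) x) (cutoff ?P (\<lambda>x. \<phi> x i) x)) \<le> norm (real N * indicator ?P x)"
    proof (rule AE_I2)
      fix x
      show "norm (ip B x (cutoff ?P (\<lambda>x. \<phi> x i) x) (cutoff ?P (\<lambda>x. \<phi> x i) x)) \<le> norm (real N * indicator ?P x)"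
        using i chart_fibre[OF c, of x i] by (cases "x \<in> ?P") (auto simp: cutoff_def piece_def ip_nonneg)
    qed
  qed (intro ip_measurable s)
  with s show ?thesis by (simp add: L2_def)
qed

text \<open>The countable set consists of rational combinations of frame fields cut off to pieces
  and to sets of a countable basis. The closure contains the frame fields cut off to arbitrary Borel
  sets, hence those with bounded measurable coefficients, hence every section once the charts are
  made disjoint and the coordinates are truncated.\<close>

lemma separable_L2:
  obtains C where "countable C" "C \<subseteq> H" "approximable C = H"
proof -
  obtain A where A: "countable A" "A \<subseteq> charts B" "(\<Union>(U, \<phi>)\<in>A. U) = UNIV" by (rule countable_atlas)
  obtain \<O> :: "'x set set" where \<O>: "countable \<O>" "\<O> \<subseteq> Collect open" "Int_stable \<O>" "UNIV \<in> \<O>"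
    "sets borel = sigma_sets UNIV \<O>" by (rule countable_Int_stable_basis)
  define S where "S = (\<lambda>(c, N, i, W). cutoff (piece (fst c) (snd c) N \<inter> W) (\<lambda>x. snd c x i)) ` (A \<times> UNIV \<times> Basis \<times> \<O>)"
  define C where "C = rat_span S"
  have "countable S" unfolding S_def using A \<O>
    by (intro countable_image countable_SIGMA) (auto intro: countable_finite)
  then have cC: "countable C" unfolding C_def by (rule countable_rat_span)
  have "S \<subseteq> H" using A(2) \<O>(2) by (auto simp: S_def sets_M intro!: piece_frame_L2)
  then have CH: "C \<subseteq> H" unfolding C_def by (rule rat_span_L2)
  have CA: "f \<in> approximable C" if "f \<in> C" for f
    using that CH unfolding approximable_def
    by (auto intro!: bexI[of _ f] simp: l2norm_def l2inner_def subset_iff)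
  have lin: "(\<lambda>x. a *\<^sub>R f x + g x) \<in> approximable C" if "f \<in> approximable C" "g \<in> approximable C" for a f g
    by (rule approximable_lincomb[OF CH _ that]) (simp add: C_def rat_span_lincomb)
  have zero: "(\<lambda>x. 0) \<in> approximable C" by (rule CA) (simp add: C_def rat_span_0)
  have sum: "(\<lambda>x. \<Sum>i\<in>I. f i x) \<in> approximable C" if "\<And>i. i \<in> I \<Longrightarrow> f i \<in> approximable C" for f and I :: "'i set"
    using that
  proof (induction I rule: infinite_finite_induct)
    case (insert i I)
    then show ?case using lin[of "f i" "\<lambda>x. \<Sum>i\<in>I. f i x" 1] by simp
  qed (simp_all add: zero)
  have gen: "cutoff (piece U \<phi> N \<inter> W) (\<lambda>x. \<phi> x i) \<in> approximable C"
    if "(U, \<phi>) \<in> A" "i \<in> Basis" "W \<in> \<O>" for U \<phi> N i W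
    unfolding C_def S_def
    by (rule CA[unfolded C_def S_def, OF rat_span_base], rule image_eqI[of _ _ "((U, \<phi>), N, i, W)"]) (use that in auto)
  have indic: "cutoff (piece U \<phi> N \<inter> E) (\<lambda>x. \<phi> x i) \<in> approximable C"
    if c: "(U, \<phi>) \<in> A" and i: "i \<in> Basis" and E: "E \<in> sigma_sets UNIV \<O>" for U \<phi> N i E
  proof -
    have ch: "(U, \<phi>) \<in> charts B" using c A by auto
    have EM: "E \<in> sets M" if "E \<in> sigma_sets UNIV \<O>" for E using that \<O>(5) sets_M by simp
    have "\<O> \<subseteq> Pow UNIV" by simp
    \<comment> \<open>Dynkin's theorem: complements are differences from the case of
      \<open>UNIV\<close>, and disjoint unions are L2 limits of their partial sums.\<close>
    from \<O>(3) this E show ?thesis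
    proof (induction rule: sigma_sets_induct_disjoint)
      case (basic W)
      then show ?case using c i by (intro gen)
    next
      case empty
      then show ?case using zero by (simp add: cutoff_def)
    next
      case (compl E)
      have "cutoff (piece U \<phi> N \<inter> UNIV) (\<lambda>x. \<phi> x i) \<in> approximable C"
        using c i \<O>(4) by (intro gen)
      from lin[OF compl.IH this, of "-1"] show ?case
        by (rule back_subst[of "\<lambda>f. f \<in> approximable C"]) (auto simp: cutoff_def indicator_def fun_eq_iff)
    next
      case (union F)
      let ?f = "cutoff (piece U \<phi> N \<inter> UNIV) (\<lambda>x. \<phi> x i)"
      have f: "?f \<in> H" by (rule piece_frame_L2[OF ch _ i]) (simp add: sets_M)
      have F: "F n \<in> sets M" for n using union EM by auto
      let ?fn = "\<lambda>n x. \<Sum>j<n. cutoff (piece U \<phi> N \<inter> F j) (\<lambda>x. \<phi> x i) x"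
      have eq: "?fn n x = indicator (\<Union>j<n. F j) x *\<^sub>R ?f x" for n x
      proof -
        have "indicator (\<Union>j<n. F j) x = (\<Sum>j<n. indicator (F j) x :: real)"
          by (rule indicator_UN_disjoint) (use union(1) in \<open>auto simp: disjoint_family_on_def\<close>)
        then show "?fn n x = indicator (\<Union>j<n. F j) x *\<^sub>R ?f x"
          unfolding scaleR_sum_left by (simp only: scaleR_sum_left) (intro sum.cong refl, auto simp: cutoff_def indicator_def)
      qed
      show ?case
      proof (rule approximable_limit[OF CH])
        show "cutoff (piece U \<phi> N \<inter> \<Union> (range F)) (\<lambda>x. \<phi> x i) \<in> H"
          using F by (intro piece_frame_L2[OF ch _ i]) auto
        show "?fn n \<in> approximable C" for n by (rule sum) (rule union)
        have "(\<lambda>n. norm2 (\<lambda>x. indicator (\<Union>(range F)) x *\<^sub>R ?f x - indicator (\<Union>j<n. F j) x *\<^sub>R ?f x)) \<longlonglongrightarrow> 0"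
        proof (rule norm_tendsto_dominated[OF f, where K=1])
          show "(\<lambda>n. indicator (\<Union>j<n. F j) x :: real) \<longlonglongrightarrow> indicator (\<Union>(range F)) x" for x
            by (rule LIMSEQ_indicator_UN)
        qed (use F in \<open>auto simp: indicator_def\<close>)
        moreover have "indicator (\<Union>(range F)) x *\<^sub>R ?f x = cutoff (piece U \<phi> N \<inter> \<Union> (range F)) (\<lambda>x. \<phi> x i) x" for x
          by (auto simp: cutoff_def indicator_def fun_eq_iff)
        ultimately show "(\<lambda>n. norm2 (\<lambda>x. cutoff (piece U \<phi> N \<inter> \<Union> (range F)) (\<lambda>x. \<phi> x i) x - ?fn n x)) \<longlonglongrightarrow> 0"
          by (simp only: eq)
      qed
    qed
  qed
  have nonneg_coeff: "(\<lambda>x. u x *\<^sub>R cutoff (piece U \<phi> N) (\<lambda>x. \<phi> x i) x) \<in> approximable C"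
    if c: "(U, \<phi>) \<in> A" and i: "i \<in> Basis" and u: "u \<in> borel_measurable M" "\<And>x. 0 \<le> u x" "\<And>x. u x \<le> K"
    for U \<phi> N i u K
  proof -
    have ch: "(U, \<phi>) \<in> charts B" using c A by auto
    let ?f = "cutoff (piece U \<phi> N) (\<lambda>x. \<phi> x i)"
    have f: "?f \<in> H" using piece_frame_L2[OF ch _ i, of UNIV] sets_M by simp
    have "(\<forall>x. u x \<le> K) \<longrightarrow> (\<lambda>x. u x *\<^sub>R ?f x) \<in> approximable C" for K
      using u(1,2)
    proof (induction arbitrary: K rule: borel_measurable_induct_real)
      case (set E)
      have "cutoff (piece U \<phi> N \<inter> E) (\<lambda>x. \<phi> x i) \<in> approximable C"
        using set \<O>(5) sets_M by (intro indic c i) auto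
      then show ?case
        by (rule impI[OF back_subst[of "\<lambda>f. f \<in> approximable C"]]) (auto simp: cutoff_def indicator_def fun_eq_iff)
    next
      case (mult u c)
      show ?case
      proof (cases "c = 0")
        case False
        then have "0 < c" using mult by simp
        show ?thesis
        proof
          assume "\<forall>x. c * u x \<le> K"
          then have "\<forall>x. u x \<le> K / c" using \<open>0 < c\<close> by (simp add: pos_le_divide_eq mult.commute)
          then have "(\<lambda>x. u x *\<^sub>R ?f x) \<in> approximable C" using mult by blast
          from lin[OF this zero, of c] show "(\<lambda>x. (c * u x) *\<^sub>R ?f x) \<in> approximable C" by simp
        qed
      qed (simp add: zero)
    next
      case (add u v)
      show ?case
      proof
        assume "\<forall>x. v x + u x \<le> K"
        then have "u x \<le> K" "v x \<le> K" for x
          using add.hyps(2)[of x] add.hyps(4)[of x] by (smt (verit))+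
        then have "\<forall>x. u x \<le> K" "\<forall>x. v x \<le> K" by blast+
        then have "(\<lambda>x. u x *\<^sub>R ?f x) \<in> approximable C" "(\<lambda>x. v x *\<^sub>R ?f x) \<in> approximable C"
          using add by blast+
        from lin[OF this, of 1] show "(\<lambda>x. (v x + u x) *\<^sub>R ?f x) \<in> approximable C"
          by (simp add: scaleR_add_left add.commute)
      qed
    next
      case (seq V)
      show ?case
      proof
        assume K: "\<forall>x. u x \<le> K"
        have Vu: "V n x \<le> u x" for n x
          using incseq_le[of "\<lambda>n. V n x" "u x" n] seq.hyps(3,4) by (auto simp: incseq_def le_fun_def)
        show "(\<lambda>x. u x *\<^sub>R ?f x) \<in> approximable C"
        proof (rule approximable_limit[OF CH])
          show "(\<lambda>x. u x *\<^sub>R ?f x) \<in> H" by (rule L2_mult[OF f, where K=K]) (use K u in auto)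
          show "(\<lambda>x. V n x *\<^sub>R ?f x) \<in> approximable C" for n
            using seq.IH[of n K] Vu[of n] K order_trans by blast
          show "(\<lambda>n. norm2 (\<lambda>x. u x *\<^sub>R ?f x - V n x *\<^sub>R ?f x)) \<longlonglongrightarrow> 0"
          proof (rule norm_tendsto_dominated[OF f, where K=K])
            show "\<bar>V n x\<bar> \<le> K" for n x using seq.hyps(2)[of n x] Vu[of n x] K[rule_format, of x] by linarith
          qed (use seq u in auto)
        qed
      qed
    qed
    then show ?thesis using u(3) by blast
  qed
  have coeff: "(\<lambda>x. u x *\<^sub>R cutoff (piece U \<phi> N) (\<lambda>x. \<phi> x i) x) \<in> approximable C"
    if c: "(U, \<phi>) \<in> A" and i: "i \<in> Basis" and u: "u \<in> borel_measurable M" "\<And>x. \<bar>u x\<bar> \<le> K"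
    for U \<phi> N i u K
  proof -
    note [measurable] = u(1)
    let ?f = "cutoff (piece U \<phi> N) (\<lambda>x. \<phi> x i)"
    have "(\<lambda>x. max 0 (u x) *\<^sub>R ?f x) \<in> approximable C"
    proof (rule nonneg_coeff[OF c i])
      show "max 0 (u x) \<le> K" for x using u(2)[of x] by auto
    qed auto
    moreover have "(\<lambda>x. max 0 (- u x) *\<^sub>R ?f x) \<in> approximable C"
    proof (rule nonneg_coeff[OF c i])
      show "max 0 (- u x) \<le> K" for x using u(2)[of x] by auto
    qed auto
    ultimately have "(\<lambda>x. - 1 *\<^sub>R (max 0 (- u x) *\<^sub>R ?f x) + max 0 (u x) *\<^sub>R ?f x) \<in> approximable C"
      by (intro lin)
    moreover have "- 1 *\<^sub>R (max 0 (- u x) *\<^sub>R ?f x) + max 0 (u x) *\<^sub>R ?f x = u x *\<^sub>R ?f x" for x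
      by (cases "0 \<le> u x") auto
    ultimately show ?thesis by simp
  qed
  have "f \<in> approximable C" if f: "f \<in> H" for f
  proof -
    have "A \<noteq> {}" using A(3) by auto
    \<comment> \<open>A finite atlas is enumerated with repetitions. They do no harm, since points
      of earlier chart domains are removed in \<open>Q\<close> below.\<close>
    define c where "c = from_nat_into A"
    define U where "U k = fst (c k)" for k
    define \<phi> where "\<phi> k = snd (c k)" for k
    have cA: "(U k, \<phi> k) \<in> A" for k
      unfolding U_def \<phi>_def c_def using from_nat_into[OF \<open>A \<noteq> {}\<close>] by simp
    then have ch: "(U k, \<phi> k) \<in> charts B" for k using A by auto
    have Umem: "\<exists>k. x \<in> U k" for x
    proof -
      obtain W \<psi> where "(W, \<psi>) \<in> A" "x \<in> W" using UNIV_I[of x, folded A(3)] by auto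
      moreover then obtain k where "c k = (W, \<psi>)"
        unfolding c_def using from_nat_into_surj[OF A(1)] by metis
      ultimately show ?thesis by (auto simp: U_def intro!: exI[of _ k])
    qed
    define w where "w k i x = indicator (U k) x * (inv (\<phi> k x) (f x) \<bullet> i)" for k i x
    have w [measurable]: "w k i \<in> borel_measurable M" for k i
    proof -
      have "(\<lambda>x. inv (\<phi> k x) (f x) \<bullet> i) \<in> borel_measurable (restrict_space M (U k))"
        using section_chart[OF L2_section[OF f] ch] by measurable
      then show ?thesis unfolding w_def
        using chart_measurable[OF ch] by (subst (asm) borel_measurable_restrict_space_iff) (auto simp: mult.commute)
    qed
    note [measurable] = piece_measurable[OF ch] chart_measurable[OF ch]
    \<comment> \<open>For fixed \<open>N\<close> these sets are disjoint in \<open>k\<close>,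
      because a point is assigned to the first chart containing it. On \<open>Q N k\<close> the
      frame and the coordinates of \<open>f\<close> are bounded by \<open>N\<close>.\<close>
    define Q where "Q N k = {x \<in> piece (U k) (\<phi> k) N. (\<forall>j<k. x \<notin> U j) \<and> (\<forall>i\<in>Basis. \<bar>w k i x\<bar> \<le> real N)}" for N k
    have Qm [measurable]: "Q N k \<in> sets M" for N k
    proof -
      have "{x \<in> space M. x \<in> piece (U k) (\<phi> k) N \<and> (\<forall>j<k. x \<notin> U j) \<and> (\<forall>i\<in>Basis. \<bar>w k i x\<bar> \<le> real N)} \<in> sets M"
        by measurable
      then show ?thesis by (simp add: Q_def)
    qed
    have QU: "Q N k \<subseteq> U k" for N k by (auto simp: Q_def piece_def)
    have part: "cutoff (Q N k) f \<in> approximable C" for N k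
    proof -
      have "(\<lambda>x. \<Sum>i\<in>Basis. (indicator (Q N k) x * w k i x) *\<^sub>R cutoff (piece (U k) (\<phi> k) N) (\<lambda>x. \<phi> k x i) x) \<in> approximable C"
      proof (rule sum)
        fix i :: 'e assume "i \<in> Basis"
        then show "(\<lambda>x. (indicator (Q N k) x * w k i x) *\<^sub>R cutoff (piece (U k) (\<phi> k) N) (\<lambda>x. \<phi> k x i) x) \<in> approximable C"
          by (intro coeff[OF cA]) (auto simp: indicator_def Q_def)
      qed
      moreover have "(\<Sum>i\<in>Basis. (indicator (Q N k) x * w k i x) *\<^sub>R cutoff (piece (U k) (\<phi> k) N) (\<lambda>x. \<phi> k x i) x) = cutoff (Q N k) f x" for x
      proof (cases "x \<in> Q N k")
        case True
        then have x: "x \<in> U k" "x \<in> piece (U k) (\<phi> k) N" using QU by (auto simp: Q_def)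
        have "f x = \<phi> k x (\<Sum>i\<in>Basis. (inv (\<phi> k x) (f x) \<bullet> i) *\<^sub>R i)"
          by (simp add: euclidean_representation chart_inv_right[OF ch x(1) L2_fibre[OF f]])
        also have "\<dots> = (\<Sum>i\<in>Basis. (inv (\<phi> k x) (f x) \<bullet> i) *\<^sub>R \<phi> k x i)"
          using chart_linear[OF ch x(1)] by (simp add: linear_sum linear_scale)
        finally show ?thesis using True x by (simp add: cutoff_def w_def)
      qed (simp add: cutoff_def)
      ultimately show ?thesis by simp
    qed
    have lim: "(\<lambda>N. \<Sum>k<N. indicator (Q N k) x :: real) \<longlonglongrightarrow> 1" for x
    proof -
      define k where "k = (LEAST k. x \<in> U k)"
      have k: "x \<in> U k" "j < k \<Longrightarrow> x \<notin> U j" for j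
        using LeastI_ex[OF Umem[of x]] not_less_Least unfolding k_def by auto
      \<comment> \<open>Every quantity that has to lie below \<open>N\<close> for \<open>x\<close>
        to belong to \<open>Q N k\<close> with \<open>k < N\<close> is nonnegative after taking
        absolute values, so their sum serves as a common threshold. The last summand 1 makes the
        inequalities for the ball and for \<open>k\<close> strict.\<close>
      define K where "K = dist undefined x + (\<Sum>i\<in>Basis. \<bar>ip B x (\<phi> k x i) (\<phi> k x i)\<bar>) + (\<Sum>i\<in>Basis. \<bar>w k i x\<bar>) + real k + 1"
      have K: "real N \<ge> dist undefined x + 1 \<and> (\<forall>i\<in>Basis. ip B x (\<phi> k x i) (\<phi> k x i) \<le> real N) \<and> (\<forall>i\<in>Basis. \<bar>w k i x\<bar> \<le> real N) \<and> real N \<ge> real k + 1"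
        if N: "K \<le> real N" for N
      proof -
        have 0: "0 \<le> dist undefined x" "0 \<le> (\<Sum>i\<in>Basis. \<bar>ip B x (\<phi> k x i) (\<phi> k x i)\<bar>)" "0 \<le> (\<Sum>i\<in>Basis. \<bar>w k i x\<bar>)" "0 \<le> real k"
          by (auto intro: sum_nonneg)
        have 1: "\<bar>ip B x (\<phi> k x i) (\<phi> k x i)\<bar> \<le> (\<Sum>i\<in>Basis. \<bar>ip B x (\<phi> k x i) (\<phi> k x i)\<bar>)" "\<bar>w k i x\<bar> \<le> (\<Sum>i\<in>Basis. \<bar>w k i x\<bar>)"
          if "i \<in> Basis" for i by (rule member_le_sum[OF that]; simp)+
        show ?thesis
        proof (intro conjI ballI)
          show "dist undefined x + 1 \<le> real N" "real k + 1 \<le> real N" using 0 N unfolding K_def by linarith+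
          fix i :: 'e assume "i \<in> Basis"
          from 1[OF this] show "ip B x (\<phi> k x i) (\<phi> k x i) \<le> real N" "\<bar>w k i x\<bar> \<le> real N"
            using 0 N unfolding K_def by linarith+
        qed
      qed
      obtain N0 where N0: "K \<le> real N0" using real_arch_simple by auto
      have "(\<Sum>j<N. indicator (Q N j) x :: real) = 1" if N: "N0 \<le> N" for N
      proof -
        have KN: "K \<le> real N" using N0 N by (meson of_nat_mono order_trans)
        from K[OF this] have "x \<in> Q N k" "k < N" using k by (auto simp: Q_def piece_def)
        moreover have "x \<notin> Q N j" if "j \<noteq> k" for j
        proof (cases "j < k")
          case True then show ?thesis using k(2) QU by auto
        next
          case False
          then have "k < j" using that by simp
          then show ?thesis using k(1) by (auto simp: Q_def)
        qed
        ultimately have "(\<Sum>j<N. indicator (Q N j) x :: real) = (\<Sum>j<N. if j = k then 1 else 0)"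
          by (intro sum.cong) auto
        then show ?thesis using \<open>k < N\<close> by simp
      qed
      then have "eventually (\<lambda>N. (\<Sum>k<N. indicator (Q N k) x :: real) = 1) sequentially"
        by (auto simp: eventually_sequentially)
      then show ?thesis by (rule tendsto_eventually)
    qed
    have bnd: "\<bar>\<Sum>k<N. indicator (Q N k) x :: real\<bar> \<le> 1" for N x
    proof (cases "\<exists>k. x \<in> Q N k")
      case True
      then obtain k where k: "x \<in> Q N k" by auto
      have "x \<notin> Q N j" if "j \<noteq> k" for j
      proof (cases "j < k")
        case True
        then have "x \<notin> U j" using k by (simp add: Q_def)
        then show ?thesis using QU[of N j] by blast
      next
        case False
        then have "k < j" using that by simp
        moreover have "x \<in> U k" using k QU[of N k] by blast
        ultimately show ?thesis by (auto simp: Q_def)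
      qed
      then have "(\<Sum>j<N. indicator (Q N j) x :: real) = (\<Sum>j<N. if j = k then 1 else 0)"
        using k by (intro sum.cong) auto
      then show ?thesis by simp
    qed simp
    show ?thesis
    proof (rule approximable_limit[OF CH f])
      show "(\<lambda>x. \<Sum>k<N. cutoff (Q N k) f x) \<in> approximable C" for N by (rule sum) (rule part)
      have "(\<lambda>N. norm2 (\<lambda>x. 1 *\<^sub>R f x - (\<Sum>k<N. indicator (Q N k) x :: real) *\<^sub>R f x)) \<longlonglongrightarrow> 0"
        by (rule norm_tendsto_dominated[OF f _ _ bnd lim]) measurable
      then show "(\<lambda>N. norm2 (\<lambda>x. f x - (\<Sum>k<N. cutoff (Q N k) f x))) \<longlonglongrightarrow> 0"
        by (simp add: cutoff_def scaleR_sum_left)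
    qed
  qed
  then have "approximable C = H" by (auto simp: approximable_def)
  with cC CH that show thesis by blast
qed

end

section \<open>Bounded Borel multipliers and the functional calculus\<close>

lemma bounded_borelI:
  assumes "\<phi> \<in> borel_measurable borel" "\<And>l. 0 \<le> l \<Longrightarrow> \<bar>\<phi> l\<bar> \<le> C"
  shows "\<phi> \<in> bounded_borel"
  using assms by (auto simp: bounded_borel_def bounded_iff intro!: exI[of _ C])

lemma bounded_borel_measurable [measurable_dest]: "\<phi> \<in> bounded_borel \<Longrightarrow> \<phi> \<in> borel_measurable borel"
  by (simp add: bounded_borel_def)

lemma bounded_borelE:
  assumes "\<phi> \<in> bounded_borel"
  obtains C where "0 \<le> C" "\<forall>l\<ge>0. \<bar>\<phi> l\<bar> \<le> C"
proof -
  obtain C where "\<forall>x\<in>\<phi> ` {0..}. norm x \<le> C" using assms by (auto simp: bounded_borel_def bounded_iff)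
  then have "\<forall>l\<ge>0. \<bar>\<phi> l\<bar> \<le> max 0 C" by (auto simp: le_max_iff_disj)
  then show thesis by (intro that[of "max 0 C"]) simp_all
qed

lemma bounded_borel_lincomb:
  assumes "\<phi> \<in> bounded_borel" "\<psi> \<in> bounded_borel"
  shows "(\<lambda>l. a * \<phi> l + \<psi> l) \<in> bounded_borel"
proof -
  obtain C where C: "0 \<le> C" "\<forall>l\<ge>0. \<bar>\<phi> l\<bar> \<le> C" by (rule bounded_borelE[OF assms(1)])
  obtain D where D: "0 \<le> D" "\<forall>l\<ge>0. \<bar>\<psi> l\<bar> \<le> D" by (rule bounded_borelE[OF assms(2)])
  note [measurable] = assms[THEN bounded_borel_measurable]
  show ?thesis
  proof (rule bounded_borelI)
    fix l :: real assume l: "0 \<le> l"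
    have "\<bar>a * \<phi> l + \<psi> l\<bar> \<le> \<bar>a\<bar> * \<bar>\<phi> l\<bar> + \<bar>\<psi> l\<bar>" by (metis abs_mult abs_triangle_ineq)
    also have "\<dots> \<le> \<bar>a\<bar> * C + D" using C(2) D(2) l by (intro add_mono mult_left_mono) auto
    finally show "\<bar>a * \<phi> l + \<psi> l\<bar> \<le> \<bar>a\<bar> * C + D" .
  qed measurable
qed

lemma bounded_borel_mult:
  assumes "\<phi> \<in> bounded_borel" "\<psi> \<in> bounded_borel"
  shows "(\<lambda>l. \<phi> l * \<psi> l) \<in> bounded_borel"
proof -
  obtain C where C: "0 \<le> C" "\<forall>l\<ge>0. \<bar>\<phi> l\<bar> \<le> C" by (rule bounded_borelE[OF assms(1)])
  obtain D where D: "0 \<le> D" "\<forall>l\<ge>0. \<bar>\<psi> l\<bar> \<le> D" by (rule bounded_borelE[OF assms(2)])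
  note [measurable] = assms[THEN bounded_borel_measurable]
  show ?thesis
    by (rule bounded_borelI[where C="C * D"]) (use C D in \<open>auto simp: abs_mult intro!: mult_mono\<close>)
qed

lemma bounded_borel_const: "(\<lambda>_. c) \<in> bounded_borel"
  by (rule bounded_borelI[where C="\<bar>c\<bar>"]) auto

lemma bounded_borel_indicator: "S \<in> sets borel \<Longrightarrow> indicat_real S \<in> bounded_borel"
  by (rule bounded_borelI[where C=1]) (auto simp: indicator_def)

lemma bounded_borel_exp: "0 \<le> t \<Longrightarrow> (\<lambda>l. exp (- t * l)) \<in> bounded_borel"
  by (rule bounded_borelI[where C=1]) auto

lemma bounded_borel_cos: "(\<lambda>l. cos (y * sqrt l)) \<in> bounded_borel"
  by (rule bounded_borelI[where C=1]) auto

lemma cosh_heat_measurable [measurable]: "cosh_heat R u \<in> borel_measurable borel"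
  unfolding cosh_heat_def cosh_def by measurable

lemma bounded_borel_cosh_heat: "0 < u \<Longrightarrow> 0 \<le> R \<Longrightarrow> cosh_heat R u \<in> bounded_borel"
  by (rule bounded_borelI[where C="exp (R\<^sup>2 / (4 * u))"]) (use cosh_heat_le in \<open>auto simp: abs_of_nonneg\<close>)

locale l2_calculus = l2_bundle M B
  for M :: "'x::{metric_space, second_countable_topology} measure"
    and B :: "('x, 'v::real_vector, 'e::euclidean_space) vbundle" +
  fixes D :: "('x \<Rightarrow> 'v) set"
    and A :: "('x \<Rightarrow> 'v) \<Rightarrow> ('x \<Rightarrow> 'v)"
    and \<Phi> :: "(real \<Rightarrow> real) \<Rightarrow> ('x \<Rightarrow> 'v) \<Rightarrow> ('x \<Rightarrow> 'v)"
  assumes calculus: "functional_calculus B M D A \<Phi>"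
begin

lemmas calculus_1 = calculus[unfolded functional_calculus_def, THEN conjunct1, THEN bspec]
lemmas calculus_2 = calculus[unfolded functional_calculus_def, THEN conjunct2, THEN conjunct1, THEN bspec, THEN bspec, THEN bspec]

lemma calc_L2: "\<phi> \<in> bounded_borel \<Longrightarrow> f \<in> H \<Longrightarrow> \<Phi> \<phi> f \<in> H"
  using calculus_1[THEN conjunct1] by blast

lemma calc_lincomb:
  "\<phi> \<in> bounded_borel \<Longrightarrow> f \<in> H \<Longrightarrow> g \<in> H \<Longrightarrow> AE x in M. \<Phi> \<phi> (\<lambda>x. a *\<^sub>R f x + g x) x = a *\<^sub>R \<Phi> \<phi> f x + \<Phi> \<phi> g x"
  using calculus_1[THEN conjunct2, THEN conjunct1] by blast

lemma calc_symmetric: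
  "\<phi> \<in> bounded_borel \<Longrightarrow> f \<in> H \<Longrightarrow> g \<in> H \<Longrightarrow> \<Phi> \<phi> f \<odot> g = f \<odot> \<Phi> \<phi> g"
  using calculus_1[THEN conjunct2, THEN conjunct2, THEN conjunct1] by blast

lemma calc_norm_le:
  assumes "\<phi> \<in> bounded_borel" "\<And>l. 0 \<le> l \<Longrightarrow> \<bar>\<phi> l\<bar> \<le> C" "f \<in> H"
  shows "norm2 (\<Phi> \<phi> f) \<le> C * norm2 f"
  using calculus_1[OF assms(1), THEN conjunct2, THEN conjunct2, THEN conjunct2, THEN spec, of C] assms(2,3) by blast

lemma calc_fun_lincomb:
  "\<phi> \<in> bounded_borel \<Longrightarrow> \<psi> \<in> bounded_borel \<Longrightarrow> f \<in> H \<Longrightarrow>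
   AE x in M. \<Phi> (\<lambda>l. a * \<phi> l + \<psi> l) f x = a *\<^sub>R \<Phi> \<phi> f x + \<Phi> \<psi> f x"
  using calculus_2 by blast

lemma calc_mult:
  "\<phi> \<in> bounded_borel \<Longrightarrow> \<psi> \<in> bounded_borel \<Longrightarrow> f \<in> H \<Longrightarrow> AE x in M. \<Phi> (\<lambda>l. \<phi> l * \<psi> l) f x = \<Phi> \<phi> (\<Phi> \<psi> f) x"
  using calculus_2 by blast

lemma calc_tendsto:
  assumes "\<And>n. \<phi> n \<in> bounded_borel" "\<psi> \<in> bounded_borel" "\<And>n l. 0 \<le> l \<Longrightarrow> \<bar>\<phi> n l\<bar> \<le> C"
    "\<And>l. 0 \<le> l \<Longrightarrow> (\<lambda>n. \<phi> n l) \<longlonglongrightarrow> \<psi> l" "f \<in> H"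
  shows "(\<lambda>n. norm2 (\<lambda>x. \<Phi> (\<phi> n) f x - \<Phi> \<psi> f x)) \<longlonglongrightarrow> 0"
proof -
  note c = calculus[unfolded functional_calculus_def, THEN conjunct2, THEN conjunct2, THEN conjunct2, THEN conjunct1,
      THEN spec[of _ \<phi>], THEN spec[of _ \<psi>], THEN spec[of _ C], THEN mp]
  show ?thesis
    by (rule c[THEN bspec, OF _ assms(5)]) (use assms(1-4) in blast)
qed

lemma calc_inner_tendsto:
  assumes "\<And>n. \<phi> n \<in> bounded_borel" "\<psi> \<in> bounded_borel" "\<And>n l. 0 \<le> l \<Longrightarrow> \<bar>\<phi> n l\<bar> \<le> C"
    "\<And>l. 0 \<le> l \<Longrightarrow> (\<lambda>n. \<phi> n l) \<longlonglongrightarrow> \<psi> l" "f \<in> H" "g \<in> H"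
  shows "(\<lambda>n. \<Phi> (\<phi> n) f \<odot> g) \<longlonglongrightarrow> \<Phi> \<psi> f \<odot> g"
proof -
  have "(\<lambda>n. \<Phi> (\<phi> n) f \<odot> g - \<Phi> \<psi> f \<odot> g) \<longlonglongrightarrow> 0"
  proof (rule Lim_null_comparison)
    show "\<forall>\<^sub>F n in sequentially. norm (\<Phi> (\<phi> n) f \<odot> g - \<Phi> \<psi> f \<odot> g) \<le> norm2 (\<lambda>x. \<Phi> (\<phi> n) f x - \<Phi> \<psi> f x) * norm2 g"
    proof (intro always_eventually allI)
      fix n
      show "norm (\<Phi> (\<phi> n) f \<odot> g - \<Phi> \<psi> f \<odot> g) \<le> norm2 (\<lambda>x. \<Phi> (\<phi> n) f x - \<Phi> \<psi> f x) * norm2 g"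
        using Cauchy_Schwarz[OF L2_diff[OF calc_L2[OF assms(1) assms(5)] calc_L2[OF assms(2,5)]] assms(6), of n]
        by (simp add: inner_diff_left calc_L2 assms)
    qed
    show "(\<lambda>n. norm2 (\<lambda>x. \<Phi> (\<phi> n) f x - \<Phi> \<psi> f x) * norm2 g) \<longlonglongrightarrow> 0"
      by (intro tendsto_mult_left_zero calc_tendsto[where C=C] assms)
  qed
  then show ?thesis by (rule LIM_zero_cancel)
qed

text \<open>Pairing with a section turns the almost everywhere identities of the calculus into
  equations between real numbers, which can be rewritten with.\<close>

lemma calc_inner_fun_lincomb:
  assumes "\<phi> \<in> bounded_borel" "\<psi> \<in> bounded_borel" "f \<in> H" "g \<in> H"
  shows "\<Phi> (\<lambda>l. a * \<phi> l + \<psi> l) f \<odot> g = a * (\<Phi> \<phi> f \<odot> g) + \<Phi> \<psi> f \<odot> g"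
proof -
  have "\<Phi> (\<lambda>l. a * \<phi> l + \<psi> l) f \<odot> g = (\<lambda>x. a *\<^sub>R \<Phi> \<phi> f x + \<Phi> \<psi> f x) \<odot> g"
    by (rule inner_cong_left[OF calc_fun_lincomb]) (intro assms calc_L2 bounded_borel_lincomb L2_lincomb)+
  then show ?thesis by (simp add: inner_lincomb_left calc_L2 assms)
qed

lemma calc_inner_zero:
  assumes "f \<in> H" "g \<in> H"
  shows "\<Phi> (\<lambda>_. 0) f \<odot> g = 0"
proof -
  have "norm2 (\<Phi> (\<lambda>_. 0) f) \<le> 0 * norm2 f"
    by (rule calc_norm_le[OF bounded_borel_const _ assms(1)]) simp
  then have "norm2 (\<Phi> (\<lambda>_. 0) f) = 0"
    using norm_nonneg[OF calc_L2[OF bounded_borel_const assms(1)], of 0] by simp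
  then show ?thesis using Cauchy_Schwarz[OF calc_L2[OF bounded_borel_const assms(1)] assms(2), of 0] by simp
qed

lemma calc_inner_lincomb:
  assumes "\<phi> \<in> bounded_borel" "f \<in> H" "g \<in> H" "k \<in> H"
  shows "\<Phi> \<phi> (\<lambda>x. a *\<^sub>R f x + g x) \<odot> k = a * (\<Phi> \<phi> f \<odot> k) + \<Phi> \<phi> g \<odot> k"
  using assms by (simp add: calc_symmetric inner_lincomb_left L2_lincomb calc_L2)

lemma calc_inner_mult:
  assumes "\<phi> \<in> bounded_borel" "\<psi> \<in> bounded_borel" "f \<in> H" "g \<in> H"
  shows "\<Phi> (\<lambda>l. \<phi> l * \<psi> l) f \<odot> g = \<Phi> \<psi> f \<odot> \<Phi> \<phi> g"
proof -
  have "\<Phi> (\<lambda>l. \<phi> l * \<psi> l) f \<odot> g = \<Phi> \<phi> (\<Phi> \<psi> f) \<odot> g"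
    by (rule inner_cong_left[OF calc_mult]) (intro assms calc_L2 bounded_borel_mult)+
  then show ?thesis by (simp add: calc_symmetric calc_L2 assms)
qed

text \<open>The difference of the two arguments has norm 0, and the operator bound sends it to a
  section of norm 0; linearity then separates the two images.\<close>

lemma calc_AE_cong:
  assumes "\<phi> \<in> bounded_borel" "f \<in> H" "g \<in> H" "AE x in M. f x = g x"
  shows "AE x in M. \<Phi> \<phi> f x = \<Phi> \<phi> g x"
proof -
  obtain C where C: "0 \<le> C" "\<forall>l\<ge>0. \<bar>\<phi> l\<bar> \<le> C" by (rule bounded_borelE[OF assms(1)])
  let ?d = "\<lambda>x. - 1 *\<^sub>R g x + f x"
  have d: "?d \<in> H" by (intro L2_lincomb assms)
  have "AE x in M. ?d x = 0" using assms(4) by eventually_elim simp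
  then have "norm2 ?d = 0" using norm_eq_0[OF d] by blast
  then have "norm2 (\<Phi> \<phi> ?d) \<le> 0" using calc_norm_le[OF assms(1) C(2)[rule_format] d] by simp
  then have "AE x in M. \<Phi> \<phi> ?d x = 0"
    using norm_eq_0[OF calc_L2[OF assms(1) d]] norm_nonneg[OF calc_L2[OF assms(1) d]] by simp
  with calc_lincomb[OF assms(1,3,2), of "-1"] show ?thesis by eventually_elim simp
qed

text \<open>The operator bound only sees a multiplier on the nonnegative half-line, and there the
  difference of the two vanishes.\<close>

lemma calc_fun_cong:
  assumes "\<phi> \<in> bounded_borel" "\<psi> \<in> bounded_borel" "f \<in> H" "\<And>l. 0 \<le> l \<Longrightarrow> \<phi> l = \<psi> l"
  shows "AE x in M. \<Phi> \<phi> f x = \<Phi> \<psi> f x"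
proof -
  have b: "(\<lambda>l. - 1 * \<psi> l + \<phi> l) \<in> bounded_borel" by (intro bounded_borel_lincomb assms)
  have "norm2 (\<Phi> (\<lambda>l. - 1 * \<psi> l + \<phi> l) f) \<le> 0 * norm2 f"
    by (rule calc_norm_le[OF b _ assms(3)]) (simp add: assms(4))
  then have "AE x in M. \<Phi> (\<lambda>l. - 1 * \<psi> l + \<phi> l) f x = 0"
    using norm_eq_0[OF calc_L2[OF b assms(3)]] norm_nonneg[OF calc_L2[OF b assms(3)]] by simp
  with calc_fun_lincomb[OF assms(2,1,3), of "-1"] show ?thesis by eventually_elim simp
qed

lemma calc_inner_fun_cong:
  assumes "\<phi> \<in> bounded_borel" "\<psi> \<in> bounded_borel" "f \<in> H" "g \<in> H" "\<And>l. 0 \<le> l \<Longrightarrow> \<phi> l = \<psi> l"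
  shows "\<Phi> \<phi> f \<odot> g = \<Phi> \<psi> f \<odot> g"
  by (rule inner_cong_left[OF calc_fun_cong]) (use assms calc_L2 in auto)

section \<open>Spectral measures\<close>

text \<open>The scalar spectral measure of the operator at \<open>f\<close>. It lives on the whole
  real line, and \<open>AE_spec_nonneg\<close> shows that the negative half-line is null.\<close>

definition spec :: "('x \<Rightarrow> 'v) \<Rightarrow> real measure" where
  "spec f = measure_of UNIV (sets borel) (\<lambda>S. ennreal (\<Phi> (indicat_real S) f \<odot> f))"

lemma sets_spec [simp, measurable_cong]: "sets (spec f) = sets borel"
  and space_spec [simp]: "space (spec f) = UNIV"
  using sets.sigma_sets_eq[of "borel :: real measure"] by (simp_all add: spec_def)

lemma calc_indicator_nonneg:
  assumes "S \<in> sets borel" "f \<in> H"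
  shows "0 \<le> \<Phi> (indicat_real S) f \<odot> f"
proof -
  note b = bounded_borel_indicator[OF assms(1)]
  have "indicat_real S = (\<lambda>l. indicat_real S l * indicat_real S l)" by (auto simp: indicator_def)
  then have "\<Phi> (indicat_real S) f \<odot> f = \<Phi> (indicat_real S) f \<odot> \<Phi> (indicat_real S) f"
    using calc_inner_mult[OF b b assms(2,2)] by simp
  then show ?thesis using inner_nonneg[OF calc_L2[OF b assms(2)]] by simp
qed

text \<open>Finite additivity is linearity of the calculus in the multiplier; the passage to
  countable unions is its continuity under bounded pointwise convergence.\<close>

lemma emeasure_spec:
  assumes f: "f \<in> H" and S: "S \<in> sets borel"
  shows "emeasure (spec f) S = ennreal (\<Phi> (indicat_real S) f \<odot> f)"
  unfolding spec_def
proof (rule emeasure_measure_of_sigma[OF _ _ _ S])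
  let ?m = "\<lambda>S. \<Phi> (indicat_real S) f \<odot> f"
  show "sigma_algebra UNIV (sets (borel :: real measure))" using sets.sigma_algebra_axioms[of "borel :: real measure"] by simp
  have emp: "?m {} = 0"
  proof -
    have "indicat_real ({} :: real set) = (\<lambda>_. 0)" by (simp add: fun_eq_iff)
    then show ?thesis using calc_inner_zero[OF f f] by (simp only:)
  qed
  show "positive (sets borel) (\<lambda>S. ennreal (?m S))"
    unfolding positive_def emp by (rule ennreal_0)
  show "countably_additive (sets borel) (\<lambda>S. ennreal (?m S))"
    unfolding countably_additive_def
  proof (intro allI impI)
    fix F :: "nat \<Rightarrow> real set" assume F: "range F \<subseteq> sets borel" "disjoint_family F" "\<Union> (range F) \<in> sets borel"
    have Fn: "F n \<in> sets borel" "(\<Union>i<n. F i) \<in> sets borel" for n using F(1) by auto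
    have fin: "?m (\<Union>i<n. F i) = (\<Sum>i<n. ?m (F i))" for n
    proof (induction n)
      case 0 then show ?case unfolding lessThan_0 UN_empty emp by simp
    next
      case (Suc n)
      have "F n \<inter> F i = {}" if "i < n" for i
        using that by (intro disjoint_family_onD[OF F(2)]) auto
      then have "F n \<inter> (\<Union>i<n. F i) = {}" by blast
      then have "indicat_real (\<Union>i<Suc n. F i) = (\<lambda>l. 1 * indicat_real (F n) l + indicat_real (\<Union>i<n. F i) l)"
        by (auto simp: lessThan_Suc indicator_def fun_eq_iff)
      then show ?case
        using calc_inner_fun_lincomb[OF bounded_borel_indicator[OF Fn(1)] bounded_borel_indicator[OF Fn(2)] f f, of 1 n n] Suc by simp
    qed
    have "(\<lambda>n. ?m (\<Union>i<n. F i)) \<longlonglongrightarrow> ?m (\<Union> (range F))"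
    proof (rule calc_inner_tendsto[where C=1])
      show "(\<lambda>n. indicat_real (\<Union>i<n. F i) l) \<longlonglongrightarrow> indicat_real (\<Union> (range F)) l" for l
        by (rule LIMSEQ_indicator_UN)
    qed (use F Fn f in \<open>auto intro!: bounded_borel_indicator simp: indicator_def\<close>)
    then have "(\<lambda>i. ?m (F i)) sums ?m (\<Union> (range F))" by (simp add: sums_def fin)
    then show "(\<Sum>i. ennreal (?m (F i))) = ennreal (?m (\<Union> (range F)))"
      by (rule suminf_ennreal_eq[rotated]) (use Fn f in \<open>auto intro: calc_indicator_nonneg\<close>)
  qed
qed

lemma finite_measure_spec: "f \<in> H \<Longrightarrow> finite_measure (spec f)"
  by (rule finite_measureI) (simp add: emeasure_spec)

lemma measure_spec:
  "f \<in> H \<Longrightarrow> S \<in> sets borel \<Longrightarrow> measure (spec f) S = \<Phi> (indicat_real S) f \<odot> f"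
  by (simp add: measure_def emeasure_spec calc_indicator_nonneg)

lemma AE_spec_nonneg:
  assumes f: "f \<in> H"
  shows "AE l in spec f. 0 \<le> l"
proof (rule AE_I)
  have "\<Phi> (indicat_real {..<0}) f \<odot> f = \<Phi> (indicat_real {}) f \<odot> f"
    by (rule calc_inner_fun_cong) (auto intro: bounded_borel_indicator f)
  then show "emeasure (spec f) {..<0} = 0"
    using emeasure_spec[OF f, of "{..<0}"] emeasure_spec[OF f, of "{}"] by simp
qed auto

lemma integral_spec:
  assumes f: "f \<in> H" and \<phi>: "\<phi> \<in> bounded_borel"
  shows "integrable (spec f) \<phi>" "(LINT l|spec f. \<phi> l) = \<Phi> \<phi> f \<odot> f"
proof -
  interpret finite_measure "spec f" by (rule finite_measure_spec[OF f])
  have pos: "(LINT l|spec f. \<psi> l) = \<Phi> \<psi> f \<odot> f"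
    if \<psi>: "\<psi> \<in> borel_measurable borel" "\<And>l. 0 \<le> \<psi> l" "\<And>l. \<psi> l \<le> C" for \<psi> C
  proof -
    have "(\<forall>l. \<psi> l \<le> C) \<longrightarrow> (LINT l|spec f. \<psi> l) = \<Phi> \<psi> f \<odot> f" for C
      using \<psi>(1,2)
    proof (induction arbitrary: C rule: borel_measurable_induct_real)
      case (set S)
      then show ?case by (simp add: measure_spec f)
    next
      case (mult u c)
      show ?case
      proof (cases "c = 0")
        case True
        then show ?thesis using calc_inner_zero[OF f f] by simp
      next
        case False
        then have c: "0 < c" using mult by simp
        show ?thesis
        proof
          assume "\<forall>l. c * u l \<le> C"
          then have uC: "\<forall>l. u l \<le> C / c" using c by (simp add: pos_le_divide_eq mult.commute)
          then have "u \<in> bounded_borel" by (intro bounded_borelI[where C="C / c"]) (use mult in auto)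
          from calc_inner_fun_lincomb[OF this bounded_borel_const[of 0] f f, of c] calc_inner_zero[OF f f]
          have "\<Phi> (\<lambda>l. c * u l) f \<odot> f = c * (\<Phi> u f \<odot> f)" by simp
          then show "(LINT l|spec f. c * u l) = \<Phi> (\<lambda>l. c * u l) f \<odot> f" using mult.IH uC by simp
        qed
      qed
    next
      case (add u v)
      show ?case
      proof
        assume *: "\<forall>l. v l + u l \<le> C"
        then have "u l \<le> C" "v l \<le> C" for l
          using add.hyps(2)[of l] add.hyps(4)[of l] by (smt (verit))+
        then have uC: "\<forall>l. u l \<le> C" "\<forall>l. v l \<le> C" by blast+
        have b: "u \<in> bounded_borel" "v \<in> bounded_borel"
          by (rule bounded_borelI[where C=C]; use add uC in simp)+
        have "\<Phi> (\<lambda>l. v l + u l) f \<odot> f = \<Phi> v f \<odot> f + \<Phi> u f \<odot> f"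
          using calc_inner_fun_lincomb[OF b(2,1) f f, of 1] by simp
        moreover have "integrable (spec f) u" "integrable (spec f) v"
          by (rule integrable_const_bound[where B=C]; use add uC in simp)+
        ultimately show "(LINT l|spec f. v l + u l) = \<Phi> (\<lambda>l. v l + u l) f \<odot> f"
          using add uC by simp
      qed
    next
      case (seq V)
      show ?case
      proof
        assume C: "\<forall>l. \<psi> l \<le> C"
        have "V n l \<le> \<psi> l" for n l
          using incseq_le[of "\<lambda>n. V n l" "\<psi> l" n] seq.hyps(3,4) by (auto simp: incseq_def le_fun_def)
        then have VC: "V n l \<le> C" for n l using C order_trans by blast
        have "(\<lambda>n. LINT l|spec f. V n l) \<longlonglongrightarrow> (LINT l|spec f. \<psi> l)"
          by (rule integral_dominated_convergence[where w="\<lambda>_. C"]) (use seq VC \<psi>(1) in auto)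
        moreover have "(\<lambda>n. \<Phi> (V n) f \<odot> f) \<longlonglongrightarrow> \<Phi> \<psi> f \<odot> f"
          by (rule calc_inner_tendsto[where C=C])
             (use seq VC \<psi> C f in \<open>auto intro!: bounded_borelI[where C=C]\<close>)
        moreover have "(LINT l|spec f. V n l) = \<Phi> (V n) f \<odot> f" for n using seq.IH[of n C] VC by blast
        ultimately show "(LINT l|spec f. \<psi> l) = \<Phi> \<psi> f \<odot> f" using LIMSEQ_unique by simp
      qed
    qed
    then show ?thesis using \<psi>(3) by blast
  qed
  obtain C where C: "0 \<le> C" "\<forall>l\<ge>0. \<bar>\<phi> l\<bar> \<le> C" by (rule bounded_borelE[OF \<phi>])
  note [measurable] = bounded_borel_measurable[OF \<phi>]
  show "integrable (spec f) \<phi>"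
    by (rule integrable_const_bound[where B=C]) (use AE_spec_nonneg[OF f] C in \<open>auto elim: eventually_mono\<close>)
  \<comment> \<open>A multiplier may be unbounded on the negative half-line. Restricting to
    \<open>{0..}\<close> before splitting into positive and negative parts makes both parts bounded
    everywhere, as \<open>pos\<close> requires.\<close>
  let ?p = "\<lambda>l. max 0 (indicator {0..} l * \<phi> l)" and ?n = "\<lambda>l. max 0 (- (indicator {0..} l * \<phi> l))"
  have bd: "?p l \<le> C" "?n l \<le> C" for l using C(1) C(2) by (auto simp: indicator_def)
  have bd': "\<bar>?p l\<bar> \<le> C" "\<bar>?n l\<bar> \<le> C" for l
    using bd[of l] by (simp_all only: abs_of_nonneg max.cobounded1)
  have [measurable]: "?p \<in> borel_measurable borel" "?n \<in> borel_measurable borel" by measurable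
  have b: "?p \<in> bounded_borel" "?n \<in> bounded_borel"
    by (rule bounded_borelI[where C=C], measurable, rule bd')+
  have i: "integrable (spec f) ?p" "integrable (spec f) ?n"
    by (rule integrable_const_bound[where B=C], rule AE_I2, simp only: real_norm_def bd', measurable)+
  have "(LINT l|spec f. \<phi> l) = (LINT l|spec f. ?p l - ?n l)"
    using AE_spec_nonneg[OF f] by (intro integral_cong_AE) (auto elim!: eventually_mono)
  also have "\<dots> = \<Phi> ?p f \<odot> f - \<Phi> ?n f \<odot> f"
    using i by (simp add: pos[OF _ _ bd(1)] pos[OF _ _ bd(2)])
  also have "\<dots> = \<Phi> (\<lambda>l. - 1 * ?n l + ?p l) f \<odot> f"
    using calc_inner_fun_lincomb[OF b(2,1) f f, of "-1"] by simp
  also have "\<dots> = \<Phi> \<phi> f \<odot> f"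
    by (rule calc_inner_fun_cong[OF bounded_borel_lincomb[OF b(2,1)] \<phi> f f]) auto
  finally show "(LINT l|spec f. \<phi> l) = \<Phi> \<phi> f \<odot> f" .
qed

text \<open>Polarization writes the signed spectral measure of a pair of sections as a difference of
  two positive finite measures, which is the input format of \<open>cosh_heat_bound\<close>.\<close>

lemma integral_spec_polarization:
  assumes f: "f \<in> H" and g: "g \<in> H" and \<phi>: "\<phi> \<in> bounded_borel"
  shows "(LINT l|spec (\<lambda>x. f x + g x). \<phi> l) - (LINT l|spec (\<lambda>x. f x - g x). \<phi> l) = 4 * (\<Phi> \<phi> f \<odot> g)"
proof -
  have c: "\<Phi> \<phi> g \<odot> f = \<Phi> \<phi> f \<odot> g"
    using f g \<phi> by (simp add: calc_symmetric inner_commute[of g] calc_L2)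
  have "\<Phi> \<phi> (\<lambda>x. f x + g x) \<odot> k = \<Phi> \<phi> f \<odot> k + \<Phi> \<phi> g \<odot> k"
    "\<Phi> \<phi> (\<lambda>x. f x - g x) \<odot> k = \<Phi> \<phi> f \<odot> k - \<Phi> \<phi> g \<odot> k" if "k \<in> H" for k
    using calc_inner_lincomb[OF \<phi> f g that, of 1] calc_inner_lincomb[OF \<phi> g f that, of "-1"] by simp_all
  then show ?thesis
    using f g \<phi> by (simp add: integral_spec L2_add L2_diff inner_add_right inner_diff_right calc_L2 c)
qed

section \<open>Finite propagation speed\<close>

text \<open>Duality: the cut-off output \<open>k\<close> is paired with itself, so its norm is a
  value of the signed spectral measure of \<open>cutoff E g\<close> and \<open>k\<close>. For this
  measure the cosine hypothesis of \<open>cosh_heat_bound\<close> is Cauchy-Schwarz, and the heat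
  hypothesis is the Davies-Gaffney estimate.\<close>

lemma cosh_heat_cutoff:
  assumes dg: "davies_gaffney B M \<Phi>" and E: "E \<in> sets M" and F: "F \<in> sets M"
    and r: "r \<le> setdist E F" and R: "0 \<le> R" "R < r" and u: "0 < u" and g: "g \<in> H"
  shows "norm2 (cutoff F (\<Phi> (cosh_heat R u) (cutoff E g))) \<le> norm2 g / sqrt (1 - (R / r)\<^sup>2)"
proof -
  note ch = bounded_borel_cosh_heat[OF u R(1)]
  let ?a = "cutoff E g"
  have a: "?a \<in> H" by (intro L2_cutoff g E)
  define k where "k = cutoff F (\<Phi> (cosh_heat R u) ?a)"
  have k: "k \<in> H" unfolding k_def by (intro L2_cutoff calc_L2 ch a F)
  have kF: "cutoff F k = k" by (simp add: k_def cutoff_cutoff)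
  have pol: "(LINT l|spec (\<lambda>x. ?a x + k x). \<phi> l) - (LINT l|spec (\<lambda>x. ?a x - k x). \<phi> l) = 4 * (\<Phi> \<phi> ?a \<odot> k)"
    if "\<phi> \<in> bounded_borel" for \<phi> by (rule integral_spec_polarization[OF a k that])
  have "\<bar>4 * (\<Phi> (cosh_heat R u) ?a \<odot> k)\<bar> \<le> (4 * (norm2 g * norm2 k)) / sqrt (1 - (R / r)\<^sup>2)"
    unfolding pol[OF ch, symmetric]
  proof (rule cosh_heat_bound)
    fix y
    have "\<bar>\<Phi> (\<lambda>l. cos (y * sqrt l)) ?a \<odot> k\<bar> \<le> norm2 (\<Phi> (\<lambda>l. cos (y * sqrt l)) ?a) * norm2 k"
      by (intro Cauchy_Schwarz calc_L2 bounded_borel_cos a k)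
    also have "\<dots> \<le> (1 * norm2 ?a) * norm2 k"
      by (intro mult_right_mono calc_norm_le bounded_borel_cos a norm_nonneg k) simp
    also have "\<dots> \<le> norm2 g * norm2 k"
      using norm_cutoff_le[OF g E] norm_nonneg[OF k] by (simp add: mult_right_mono)
    finally show "\<bar>(LINT l|spec (\<lambda>x. ?a x + k x). cos (y * sqrt l)) - (LINT l|spec (\<lambda>x. ?a x - k x). cos (y * sqrt l))\<bar>
        \<le> 4 * (norm2 g * norm2 k)"
      unfolding pol[OF bounded_borel_cos] by simp
  next
    fix t :: real assume t: "0 < t"
    then have bb: "(\<lambda>l. exp (- t * l)) \<in> bounded_borel" by (intro bounded_borel_exp) simp
    have "\<Phi> (\<lambda>l. exp (- t * l)) ?a \<odot> k = cutoff F (heat \<Phi> t ?a) \<odot> k"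
      using inner_cutoff[OF calc_L2[OF bb a] k, of F] by (simp add: heat_def kF)
    also have "\<bar>\<dots>\<bar> \<le> norm2 (cutoff F (heat \<Phi> t ?a)) * norm2 k"
      unfolding heat_def by (intro Cauchy_Schwarz L2_cutoff calc_L2 bb a k F)
    also have "\<dots> \<le> (exp (- (setdist E F)\<^sup>2 / (4 * t)) * norm2 g) * norm2 k"
      using dg E F t g unfolding davies_gaffney_def by (intro mult_right_mono norm_nonneg k) blast
    also have "\<dots> \<le> (exp (- r\<^sup>2 / (4 * t)) * norm2 g) * norm2 k"
    proof (intro mult_right_mono norm_nonneg k g)
      have "r\<^sup>2 \<le> (setdist E F)\<^sup>2" using r R by (intro power_mono) auto
      then show "exp (- (setdist E F)\<^sup>2 / (4 * t)) \<le> exp (- r\<^sup>2 / (4 * t))"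
        using t by (simp add: divide_right_mono)
    qed
    finally show "\<bar>(LINT l|spec (\<lambda>x. ?a x + k x). exp (- t * l)) - (LINT l|spec (\<lambda>x. ?a x - k x). exp (- t * l))\<bar>
        \<le> 4 * (norm2 g * norm2 k) * exp (- r\<^sup>2 / (4 * t))"
      unfolding pol[OF bb] by (simp add: mult_ac)
  qed (use a k R u in \<open>auto intro!: finite_measure_spec AE_spec_nonneg L2_add L2_diff\<close>)
  moreover have "\<Phi> (cosh_heat R u) ?a \<odot> k = (norm2 k)\<^sup>2"
    using inner_cutoff[OF calc_L2[OF ch a] k, of F] k by (simp add: kF norm_power2 flip: k_def)
  ultimately have kk: "norm2 k * norm2 k \<le> (norm2 g / sqrt (1 - (R / r)\<^sup>2)) * norm2 k"
    by (simp add: power2_eq_square)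
  have pos: "0 \<le> norm2 g / sqrt (1 - (R / r)\<^sup>2)"
    using R g by (intro divide_nonneg_nonneg real_sqrt_ge_zero norm_nonneg) (auto simp: power_le_one)
  have "norm2 k \<le> norm2 g / sqrt (1 - (R / r)\<^sup>2)"
  proof (cases "norm2 k = 0")
    case False
    then have "0 < norm2 k" using norm_nonneg[OF k] by simp
    with kk show ?thesis by (rule mult_right_le_imp_le)
  qed (use pos in simp)
  then show ?thesis by (simp add: k_def)
qed

end

section \<open>Pointwise bounds from L2 limits and properties of the heat semigroup\<close>

lemma exp_minus_le_inverse_power:
  fixes y :: real
  assumes "0 < y"
  shows "exp (- y) \<le> fact n / y ^ n"
proof -
  \<comment> \<open>A single term of the exponential series, all of whose terms are
    nonnegative.\<close>
  have "y ^ n / fact n \<le> exp y"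
  proof -
    have "summable (\<lambda>n. y ^ n /\<^sub>R fact n)" by (rule summable_exp_generic)
    then have "(\<Sum>k\<in>{n}. y ^ k /\<^sub>R fact k) \<le> (\<Sum>k. y ^ k /\<^sub>R fact k)"
      using assms by (intro sum_le_suminf) auto
    then show ?thesis by (simp add: exp_def divide_inverse mult.commute)
  qed
  then show ?thesis using assms by (simp add: exp_minus field_simps)
qed

context l2_bundle
begin

text \<open>The excess of the pointwise norm of \<open>y\<close> over \<open>N\<close> is dominated
  on \<open>S\<close> by every \<open>R n\<close>, so its square has integral 0 there. Thus a
  remainder that is small only in L2 does not spoil a pointwise bound.\<close>

lemma AE_fnorm_le_limit:
  assumes y: "y \<in> H" and R: "\<And>n. R n \<in> H" and S: "S \<in> sets M" and N: "0 \<le> N"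
    and le: "\<And>n. AE x in M. x \<in> S \<longrightarrow> fnorm B x (y x) \<le> N + fnorm B x (R n x)"
    and lim: "(\<lambda>n. norm2 (cutoff S (R n))) \<longlonglongrightarrow> 0"
  shows "AE x in M. x \<in> S \<longrightarrow> fnorm B x (y x) \<le> N"
proof -
  note [measurable] = S
  have fm [measurable]: "(\<lambda>x. fnorm B x (f x)) \<in> borel_measurable M" if "f \<in> H" for f
    unfolding fnorm_def using ip_measurable[OF L2_section[OF that] L2_section[OF that]] by measurable
  note [measurable] = fm[OF y]
  define e where "e x = indicator S x * (max 0 (fnorm B x (y x) - N))\<^sup>2" for x
  have [measurable]: "e \<in> borel_measurable M" unfolding e_def by measurable
  have e0: "0 \<le> e x" for x by (simp add: e_def)
  have le': "AE x in M. e x \<le> ip B x (cutoff S (R n) x) (cutoff S (R n) x)" for n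
    using le[of n]
  proof eventually_elim
    case (elim x)
    show ?case
    proof (cases "x \<in> S")
      case True
      then have "max 0 (fnorm B x (y x) - N) \<le> fnorm B x (R n x)"
        using elim fnorm_nonneg[OF L2_fibre[OF R]] by simp
      then have "(max 0 (fnorm B x (y x) - N))\<^sup>2 \<le> (fnorm B x (R n x))\<^sup>2" by (intro power_mono) auto
      then show ?thesis using True by (simp add: e_def cutoff_def fnorm_power2[OF L2_fibre[OF R]])
    next
      case False
      then show ?thesis by (simp add: e_def cutoff_def)
    qed
  qed
  have ei: "integrable M e"
  proof (rule Bochner_Integration.integrable_bound[OF L2_integrable[OF y y]])
    show "AE x in M. norm (e x) \<le> norm (ip B x (y x) (y x))"
    proof (rule AE_I2)
      fix x
      have "(max 0 (fnorm B x (y x) - N))\<^sup>2 \<le> (fnorm B x (y x))\<^sup>2"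
        using N fnorm_nonneg[OF L2_fibre[OF y]] by (intro power_mono) auto
      then show "norm (e x) \<le> norm (ip B x (y x) (y x))"
        by (auto simp: e_def indicator_def fnorm_power2[OF L2_fibre[OF y]])
    qed
  qed measurable
  have "(LINT x|M. e x) \<le> (norm2 (cutoff S (R n)))\<^sup>2" for n
    unfolding norm_power2[OF L2_cutoff[OF R S]] l2inner_def
    by (intro integral_mono_AE ei L2_integrable L2_cutoff R S le')
  moreover have "(\<lambda>n. (norm2 (cutoff S (R n)))\<^sup>2) \<longlonglongrightarrow> 0\<^sup>2" by (intro tendsto_power lim)
  ultimately have "(LINT x|M. e x) \<le> 0\<^sup>2" by (intro LIMSEQ_le_const[of "\<lambda>n. (norm2 (cutoff S (R n)))\<^sup>2"] exI[of _ 0]) blast+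
  then have "(LINT x|M. e x) \<le> 0" by simp
  moreover have "0 \<le> (LINT x|M. e x)" using e0 by (intro Bochner_Integration.integral_nonneg)
  ultimately have "(LINT x|M. e x) = 0" by linarith
  then have "AE x in M. e x = 0" using integral_nonneg_eq_0_iff_AE[OF ei] e0 by simp
  then show ?thesis
  proof eventually_elim
    case (elim x)
    show ?case
    proof
      assume "x \<in> S"
      then have "(max 0 (fnorm B x (y x) - N))\<^sup>2 = 0" using elim by (simp add: e_def)
      then show "fnorm B x (y x) \<le> N" by (simp add: max_def split: if_splits)
    qed
  qed
qed

lemma fnorm_triangle:
  assumes "u \<in> fibre B x" "v \<in> fibre B x"
  shows "fnorm B x (u + v) \<le> fnorm B x u + fnorm B x v"
proof (rule power2_le_imp_le)
  have "(fnorm B x (u + v))\<^sup>2 = (fnorm B x u)\<^sup>2 + 2 * ip B x u v + (fnorm B x v)\<^sup>2"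
    using assms by (simp add: fnorm_power2 fibre_add ip_add_left ip_add_right ip_commute[of v x u])
  also have "\<dots> \<le> (fnorm B x u + fnorm B x v)\<^sup>2"
    using ip_Cauchy_Schwarz[OF assms] by (simp add: power2_sum)
  finally show "(fnorm B x (u + v))\<^sup>2 \<le> (fnorm B x u + fnorm B x v)\<^sup>2" .
qed (use assms in simp)

lemma fnorm_sum_le:
  assumes "\<And>i. i \<in> I \<Longrightarrow> f i \<in> fibre B x"
  shows "fnorm B x (\<Sum>i\<in>I. f i) \<le> (\<Sum>i\<in>I. fnorm B x (f i))"
  using assms
proof (induction I rule: infinite_finite_induct)
  case (insert i I)
  have "fnorm B x (f i + (\<Sum>i\<in>I. f i)) \<le> fnorm B x (f i) + fnorm B x (\<Sum>i\<in>I. f i)"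
    using insert.prems by (intro fnorm_triangle subspace_sum[OF subspace_fibre]) auto
  then show ?case using insert by fastforce
qed (simp_all add: fnorm_def)

end

context l2_calculus
begin

lemma heat_L2: "0 \<le> t \<Longrightarrow> f \<in> H \<Longrightarrow> heat \<Phi> t f \<in> H"
  unfolding heat_def by (intro calc_L2 bounded_borel_exp)

lemma heat_norm_le: "0 \<le> t \<Longrightarrow> f \<in> H \<Longrightarrow> norm2 (heat \<Phi> t f) \<le> norm2 f"
  using calc_norm_le[OF bounded_borel_exp, of t 1 f] by (simp add: heat_def)

lemma heat_add:
  assumes "0 \<le> s" "0 \<le> t" "f \<in> H"
  shows "AE x in M. heat \<Phi> (s + t) f x = heat \<Phi> s (heat \<Phi> t f) x"
proof -
  have "(\<lambda>l. exp (- s * l) * exp (- t * l)) = (\<lambda>l. exp (- (s + t) * l))"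
    by (simp add: fun_eq_iff algebra_simps flip: exp_add)
  then show ?thesis unfolding heat_def
    using calc_mult[OF bounded_borel_exp[OF assms(1)] bounded_borel_exp[OF assms(2)] assms(3)] by (simp only:)
qed

lemma heat_sum:
  assumes "0 \<le> t" "f \<in> H" "g \<in> H"
  shows "AE x in M. heat \<Phi> t (\<lambda>x. f x + g x) x = heat \<Phi> t f x + heat \<Phi> t g x"
  using calc_lincomb[OF bounded_borel_exp[OF assms(1)] assms(2,3), of 1] by (simp add: heat_def)

text \<open>The gap is required for pairs of points and not for \<open>setdist\<close>, which is 0
  if one of the sets is empty. In \<open>heat_off_diagonal\<close> the complement of a ball may well
  be empty.\<close>

lemma davies_gaffney_dist:
  assumes dg: "davies_gaffney B M \<Phi>" and E: "E \<in> sets M" and F: "F \<in> sets M" and t: "0 < t" and f: "f \<in> H"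
    and \<delta>: "0 \<le> \<delta>" "\<And>x y. x \<in> E \<Longrightarrow> y \<in> F \<Longrightarrow> \<delta> \<le> dist x y"
  shows "norm2 (cutoff F (heat \<Phi> t (cutoff E f))) \<le> exp (- \<delta>\<^sup>2 / (4 * t)) * norm2 f"
proof (cases "E = {} \<or> F = {}")
  case True
  have 0: "norm2 (\<lambda>_. 0) = 0" using norm_eq_0[OF L2_0] by simp
  have "norm2 (cutoff F (heat \<Phi> t (cutoff E f))) \<le> 0"
  proof (cases "F = {}")
    case True
    then show ?thesis using 0 by (simp add: cutoff_def)
  next
    case False
    with \<open>E = {} \<or> F = {}\<close> have "norm2 (cutoff E f) = 0" using 0 by (simp add: cutoff_def)
    moreover have "norm2 (cutoff F (heat \<Phi> t (cutoff E f))) \<le> norm2 (cutoff E f)"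
      using t by (intro norm_cutoff_le[THEN order_trans] heat_norm_le heat_L2 L2_cutoff E F f) auto
    ultimately show ?thesis by simp
  qed
  also have "0 \<le> exp (- \<delta>\<^sup>2 / (4 * t)) * norm2 f" using f by simp
  finally show ?thesis .
next
  case False
  then have "\<delta> \<le> setdist E F" using \<delta>(2) by (intro le_setdistI) auto
  then have "\<delta>\<^sup>2 \<le> (setdist E F)\<^sup>2" using \<delta>(1) by (intro power_mono) auto
  then have "exp (- (setdist E F)\<^sup>2 / (4 * t)) \<le> exp (- \<delta>\<^sup>2 / (4 * t))" using t by (simp add: divide_right_mono)
  then have "exp (- (setdist E F)\<^sup>2 / (4 * t)) * norm2 f \<le> exp (- \<delta>\<^sup>2 / (4 * t)) * norm2 f"
    by (rule mult_right_mono) (rule norm_nonneg[OF f])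
  moreover have "norm2 (cutoff F (heat \<Phi> t (cutoff E f))) \<le> exp (- (setdist E F)\<^sup>2 / (4 * t)) * norm2 f"
    using dg E F t f unfolding davies_gaffney_def by blast
  ultimately show ?thesis by linarith
qed

text \<open>For \<open>t \<le> 1\<close> the exponent may be rounded up. A natural exponent lets
  \<open>exp_minus_le_inverse_power\<close> absorb the singularity.\<close>

lemma ultracontractive_power:
  assumes "ultracontractive B M \<Phi>"
  obtains C m where "0 < C" "\<forall>t. 0 < t \<and> t \<le> 1 \<longrightarrow> bounded_2_inf B M (heat \<Phi> t) (C * (1 / t) ^ m)"
proof -
  obtain \<alpha> C where *: "\<alpha> > 0" "C > 0" "\<And>t. 0 < t \<and> t \<le> 1 \<Longrightarrow> bounded_2_inf B M (heat \<Phi> t) (C * t powr (- \<alpha> / 2))"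
    using assms unfolding ultracontractive_def by auto
  define m where "m = nat \<lceil>\<alpha> / 2\<rceil>"
  show thesis
  proof (rule that[OF *(2)], intro allI impI)
    fix t :: real assume "0 < t \<and> t \<le> 1"
    then have t: "0 < t" "t \<le> 1" by auto
    have "t powr (- \<alpha> / 2) = (1 / t) powr (\<alpha> / 2)" using t by (simp add: powr_minus_divide powr_divide)
    also have "\<dots> \<le> (1 / t) powr (real m)"
      using t real_nat_ceiling_ge[of "\<alpha> / 2"] unfolding m_def by (intro powr_mono) auto
    also have "\<dots> = (1 / t) ^ m" using t by (simp add: powr_realpow)
    finally have le: "C * t powr (- \<alpha> / 2) \<le> C * (1 / t) ^ m" using *(2) by simp
    show "bounded_2_inf B M (heat \<Phi> t) (C * (1 / t) ^ m)"
      unfolding bounded_2_inf_def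
    proof
      fix f assume f: "f \<in> H"
      have "AE x in M. fnorm B x (heat \<Phi> t f x) \<le> C * t powr (- \<alpha> / 2) * norm2 f"
        using *(3)[of t] t f unfolding bounded_2_inf_def by blast
      then show "AE x in M. fnorm B x (heat \<Phi> t f x) \<le> C * (1 / t) ^ m * norm2 f"
        by eventually_elim (use mult_right_mono[OF le norm_nonneg[OF f]] in linarith)
    qed
  qed
qed

section \<open>Off-diagonal smoothing\<close>

text \<open>Put \<open>X = sqrt 2 ^ k / s\<close>. Since \<open>s \<le> 1\<close>, the smoothing
  factor is at most \<open>(2 * X\<^sup>2) ^ m\<close>. Half of the exponent \<open>a * X\<close>
  yields \<open>exp (- (a / 2) / s)\<close>, the other half beats \<open>X ^ (2 * m)\<close> with
  one power of \<open>X\<close> to spare, and \<open>1 / X\<close> is at most the term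
  \<open>(1 / sqrt 2) ^ k\<close> of a geometric series.\<close>

lemma off_diagonal_sum:
  fixes a C s :: real
  assumes a: "0 < a" and C: "0 < C" and s: "0 < s" "s \<le> 1"
  shows "(\<Sum>k<n. C * (2 ^ Suc k / s) ^ m * exp (- (a * sqrt 2 ^ k / s)))
     \<le> C * 2 ^ m * (fact (2 * m + 1) * (2 / a) ^ (2 * m + 1)) * (1 / (1 - 1 / sqrt 2)) * exp (- (a / 2) / s)"
proof -
  define K where "K = fact (2 * m + 1) * (2 / a) ^ (2 * m + 1)"
  have K: "0 < K" using a by (simp add: K_def)
  have trm: "C * (2 ^ Suc k / s) ^ m * exp (- (a * sqrt 2 ^ k / s)) \<le> C * 2 ^ m * K * exp (- (a / 2) / s) * (1 / sqrt 2) ^ k" for k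
  proof -
    define X where "X = sqrt 2 ^ k / s"
    have sq: "1 \<le> sqrt 2 ^ k" by simp
    have X: "1 / s \<le> X" "sqrt 2 ^ k \<le> X" "0 < X"
      using s sq by (auto simp: X_def divide_right_mono pos_le_divide_eq mult_left_le)
    have two: "(sqrt 2 ^ k)\<^sup>2 = 2 ^ k"
      by (simp add: power_mult[symmetric] mult.commute[of k] power_mult[of "sqrt 2" 2])
    have "2 ^ Suc k / s = 2 * (sqrt 2 ^ k * sqrt 2 ^ k / s)" using two by (simp add: power2_eq_square)
    also have "\<dots> \<le> 2 * (X * X)"
    proof -
      have "sqrt 2 ^ k * (sqrt 2 ^ k / s) \<le> X * (sqrt 2 ^ k / s)"
        using X(2) s by (intro mult_right_mono) auto
      then show ?thesis by (simp add: X_def)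
    qed
    finally have 1: "(2 ^ Suc k / s) ^ m \<le> (2 * (X * X)) ^ m"
      using s by (intro power_mono) auto
    have "exp (- (a * sqrt 2 ^ k / s)) = exp (- (a / 2 * X)) * exp (- (a / 2 * X))"
      by (simp add: X_def flip: exp_add)
    also have "\<dots> \<le> exp (- (a / 2) / s) * (fact (2 * m + 1) / (a / 2 * X) ^ (2 * m + 1))"
    proof (intro mult_mono exp_minus_le_inverse_power)
      have "a / 2 * (1 / s) \<le> a / 2 * X" using a X by (intro mult_left_mono) auto
      then show "exp (- (a / 2 * X)) \<le> exp (- (a / 2) / s)" by simp
    qed (use a X in auto)
    also have "\<dots> = exp (- (a / 2) / s) * (K / X ^ (2 * m + 1))"
      using a X by (simp add: K_def power_mult_distrib power_divide field_simps)
    finally have 2: "exp (- (a * sqrt 2 ^ k / s)) \<le> exp (- (a / 2) / s) * (K / X ^ (2 * m + 1))" .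
    have "C * (2 ^ Suc k / s) ^ m * exp (- (a * sqrt 2 ^ k / s)) \<le> C * (2 * (X * X)) ^ m * (exp (- (a / 2) / s) * (K / X ^ (2 * m + 1)))"
      using C s by (intro mult_mono mult_left_mono 1 2) auto
    also have "\<dots> = C * 2 ^ m * K * exp (- (a / 2) / s) * (1 / X)"
    proof -
      have "(2 * (X * X)) ^ m = 2 ^ m * X ^ (2 * m)"
        by (simp add: power_mult_distrib power_mult power2_eq_square)
      then show ?thesis using X by simp
    qed
    also have "\<dots> \<le> C * 2 ^ m * K * exp (- (a / 2) / s) * (1 / sqrt 2 ^ k)"
      using C K X by (intro mult_left_mono divide_left_mono) auto
    finally show ?thesis by (simp add: power_one_over)
  qed
  have geo: "(\<Sum>k<n. (1 / sqrt 2) ^ k) \<le> 1 / (1 - 1 / sqrt 2)"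
  proof -
    have r: "norm (1 / sqrt 2) < 1" by simp
    have "(\<Sum>k<n. (1 / sqrt 2) ^ k) \<le> (\<Sum>k. (1 / sqrt 2) ^ k)"
      by (intro sum_le_suminf summable_geometric r) auto
    then show ?thesis using suminf_geometric[OF r] by simp
  qed
  have "(\<Sum>k<n. C * (2 ^ Suc k / s) ^ m * exp (- (a * sqrt 2 ^ k / s)))
     \<le> (\<Sum>k<n. C * 2 ^ m * K * exp (- (a / 2) / s) * (1 / sqrt 2) ^ k)"
    by (intro sum_mono trm)
  also have "\<dots> = C * 2 ^ m * K * exp (- (a / 2) / s) * (\<Sum>k<n. (1 / sqrt 2) ^ k)"
    by (simp add: sum_distrib_left)
  also have "\<dots> \<le> C * 2 ^ m * K * exp (- (a / 2) / s) * (1 / (1 - 1 / sqrt 2))"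
    using C K by (intro mult_left_mono geo) auto
  finally show ?thesis by (simp add: K_def mult_ac)
qed

text \<open>The time interval is split into the steps \<open>s / 2, s / 4, \<dots>\<close> and the spatial gap into steps of length
  proportional to \<open>q ^ k\<close> with \<open>q ^ 4 = 1 / 2\<close>, so that \<open>(gap)\<^sup>2 / time\<close> grows like \<open>sqrt 2 ^ k\<close> and beats the
  smoothing norms. The final remainder is only small in \<open>L\<^sup>2\<close>, which suffices in the limit.\<close>

lemma heat_off_diagonal:
  assumes dg: "davies_gaffney B M \<Phi>" and uc: "ultracontractive B M \<Phi>" and \<epsilon>: "0 < \<epsilon>"
  obtains K c where "0 < K" "0 < c"
    "\<forall>s g. 0 < s \<and> s \<le> 1 \<and> g \<in> H \<longrightarrow>
      (AE x in M. x \<in> ball x0 \<epsilon> \<longrightarrow> fnorm B x (heat \<Phi> s (cutoff (- ball x0 (2 * \<epsilon>)) g) x) \<le> K * exp (- c / s) * norm2 g)"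
proof -
  obtain C m where C: "0 < C" "\<forall>t. 0 < t \<and> t \<le> 1 \<longrightarrow> bounded_2_inf B M (heat \<Phi> t) (C * (1 / t) ^ m)"
    by (rule ultracontractive_power[OF uc])
  \<comment> \<open>With \<open>2 * q\<^sup>2 = sqrt 2\<close> the squared gap
    \<open>(\<epsilon> * q ^ k * (1 - q))\<^sup>2\<close> over four times the duration
    \<open>s / 2 ^ Suc k\<close> equals \<open>a * sqrt 2 ^ k / s\<close> for the constant
    \<open>a\<close> below.\<close>
  define q where "q = sqrt (1 / sqrt 2)"
  have q: "0 < q" "q < 1" "q\<^sup>2 = 1 / sqrt 2" by (auto simp: q_def)
  have q2: "(q ^ k)\<^sup>2 * 2 ^ k = sqrt 2 ^ k" for k
  proof -
    have "(q ^ k)\<^sup>2 * 2 ^ k = (q\<^sup>2 * 2) ^ k" by (simp add: power_mult_distrib power_mult[symmetric] mult.commute)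
    also have "q\<^sup>2 * 2 = sqrt 2" unfolding q(3) by (simp add: real_div_sqrt)
    finally show ?thesis .
  qed
  \<comment> \<open>The radii decrease from \<open>2 * \<epsilon>\<close> to
    \<open>\<epsilon>\<close>; consecutive ones differ by
    \<open>\<epsilon> * q ^ k * (1 - q)\<close>.\<close>
  define \<rho> where "\<rho> k = \<epsilon> * (1 + q ^ k)" for k
  define F where "F k = - ball x0 (\<rho> k)" for k
  have Fm: "F k \<in> sets M" and ballm: "ball x0 r \<in> sets M" for k r by (auto simp: F_def sets_M)
  define a where "a = \<epsilon>\<^sup>2 * (1 - q)\<^sup>2 / 2"
  have a: "0 < a" using \<epsilon> q by (simp add: a_def)
  define K where "K = C * 2 ^ m * (fact (2 * m + 1) * (2 / a) ^ (2 * m + 1)) * (1 / (1 - 1 / sqrt 2))"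
  have K: "0 < K" using C a by (auto simp: K_def intro!: mult_pos_pos divide_pos_pos)
  show thesis
  proof (rule that[OF K, of "a / 2"], goal_cases)
    case 1 show ?case using a by simp
  next
    case 2 show ?case
    proof (intro allI impI)
      fix s :: real and g assume "0 < s \<and> s \<le> 1 \<and> g \<in> H"
      then have s: "0 < s" "s \<le> 1" and g: "g \<in> H" by auto
      define \<tau> where "\<tau> k = s / 2 ^ Suc k" for k
      have \<tau>: "0 < \<tau> k" "\<tau> k \<le> 1" for k
        using s by (auto simp: \<tau>_def divide_le_eq intro: order_trans[OF s(2)] simp del: power_Suc)
      have \<tau>_Suc: "s / 2 ^ k = \<tau> k + \<tau> k" for k by (simp add: \<tau>_def)
      \<comment> \<open>\<open>h k\<close> is what still lies outside the \<open>k\<close>-th ball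
        after half of the remaining time has been used up \<open>k\<close> times. The time left is
        then \<open>s / 2 ^ k\<close>, which is twice \<open>\<tau> k\<close>.\<close>
      define h where "h = rec_nat (cutoff (F 0) g) (\<lambda>k f. cutoff (F (Suc k)) (heat \<Phi> (\<tau> k) f))"
      have h0: "h 0 = cutoff (F 0) g" and hS: "h (Suc k) = cutoff (F (Suc k)) (heat \<Phi> (\<tau> k) (h k))" for k
        by (simp_all add: h_def)
      have hH: "h k \<in> H" for k
        by (induction k) (auto simp: h0 hS intro!: L2_cutoff heat_L2 g Fm less_imp_le[OF \<tau>(1)])
      have hn: "norm2 (h k) \<le> norm2 g" for k
      proof (induction k)
        case 0 then show ?case by (simp add: h0 norm_cutoff_le g Fm)
      next
        case (Suc k)
        have "norm2 (h (Suc k)) \<le> norm2 (heat \<Phi> (\<tau> k) (h k))"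
          unfolding hS by (intro norm_cutoff_le heat_L2 hH Fm less_imp_le[OF \<tau>(1)])
        also have "\<dots> \<le> norm2 (h k)" by (intro heat_norm_le hH less_imp_le[OF \<tau>(1)])
        finally show ?case using Suc by simp
      qed
      have hF: "cutoff (F k) (h k) = h k" for k by (cases k) (simp_all add: h0 hS cutoff_cutoff)
      \<comment> \<open>The part that jumps into the next, smaller ball during step
        \<open>k\<close>. It is tiny by Davies-Gaffney, and the time \<open>\<tau> k\<close>
        remaining after the jump suffices to turn its L2 norm into a pointwise bound.\<close>
      define w where "w k = cutoff (ball x0 (\<rho> (Suc k))) (heat \<Phi> (\<tau> k) (h k))" for k
      have wH: "w k \<in> H" for k unfolding w_def by (intro L2_cutoff heat_L2 hH ballm less_imp_le[OF \<tau>(1)])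
      have split: "heat \<Phi> (\<tau> k) (h k) = (\<lambda>x. w k x + h (Suc k) x)" for k
        unfolding w_def hS F_def using cutoff_Compl[of "heat \<Phi> (\<tau> k) (h k)" _ "ball x0 (\<rho> (Suc k))"] by (auto simp: fun_eq_iff)
      define R where "R n = heat \<Phi> (s / 2 ^ n) (h n)" for n
      have RH: "R n \<in> H" for n unfolding R_def using s by (intro heat_L2 hH) auto
      have step: "AE x in M. R n x = heat \<Phi> (\<tau> n) (w n) x + R (Suc n) x" for n
      proof -
        have "AE x in M. R n x = heat \<Phi> (\<tau> n) (heat \<Phi> (\<tau> n) (h n)) x"
          unfolding R_def \<tau>_Suc by (rule heat_add) (use \<tau> hH in \<open>auto intro: less_imp_le\<close>)
        moreover have "AE x in M. heat \<Phi> (\<tau> n) (\<lambda>x. w n x + h (Suc n) x) x = heat \<Phi> (\<tau> n) (w n) x + heat \<Phi> (\<tau> n) (h (Suc n)) x"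
          by (rule heat_sum) (use \<tau> hH wH in \<open>auto intro: less_imp_le\<close>)
        ultimately show ?thesis unfolding split by eventually_elim (simp add: R_def \<tau>_def)
      qed
      have tele: "AE x in M. R 0 x = (\<Sum>k<n. heat \<Phi> (\<tau> k) (w k) x) + R n x" for n
      proof (induction n)
        case (Suc n)
        from Suc step[of n] show ?case by eventually_elim (simp add: add.assoc)
      qed simp
      have gap: "norm2 (w k) \<le> exp (- (a * sqrt 2 ^ k / s)) * norm2 g" for k
      proof -
        let ?\<delta> = "\<epsilon> * q ^ k * (1 - q)"
        have "norm2 (w k) = norm2 (cutoff (ball x0 (\<rho> (Suc k))) (heat \<Phi> (\<tau> k) (cutoff (F k) (h k))))"
          by (simp add: w_def hF)
        also have "\<dots> \<le> exp (- ?\<delta>\<^sup>2 / (4 * \<tau> k)) * norm2 (h k)"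
        proof (rule davies_gaffney_dist[OF dg Fm ballm \<tau>(1) hH])
          show "0 \<le> ?\<delta>" using \<epsilon> q by simp
          fix x y assume "x \<in> F k" "y \<in> ball x0 (\<rho> (Suc k))"
          then have "\<rho> k \<le> dist x0 x" "dist x0 y < \<rho> (Suc k)" by (auto simp: F_def)
          moreover have "dist x0 x \<le> dist x0 y + dist x y" by (metis dist_commute dist_triangle)
          moreover have "\<rho> k - \<rho> (Suc k) = ?\<delta>" by (simp add: \<rho>_def algebra_simps)
          ultimately show "?\<delta> \<le> dist x y" by linarith
        qed
        also have "\<dots> = exp (- (a * sqrt 2 ^ k / s)) * norm2 (h k)"
        proof -
          have "?\<delta>\<^sup>2 = \<epsilon>\<^sup>2 * (q ^ k)\<^sup>2 * (1 - q)\<^sup>2" by (simp only: power_mult_distrib)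
          then have "?\<delta>\<^sup>2 / (4 * \<tau> k) = a * sqrt 2 ^ k / s"
            unfolding q2[symmetric] using s by (simp only: a_def \<tau>_def) (simp add: mult_ac)
          then show ?thesis by simp
        qed
        also have "\<dots> \<le> exp (- (a * sqrt 2 ^ k / s)) * norm2 g"
          using hn by (intro mult_left_mono) auto
        finally show ?thesis .
      qed
      have trm: "AE x in M. fnorm B x (heat \<Phi> (\<tau> k) (w k) x) \<le> C * (2 ^ Suc k / s) ^ m * exp (- (a * sqrt 2 ^ k / s)) * norm2 g" for k
      proof -
        have "AE x in M. fnorm B x (heat \<Phi> (\<tau> k) (w k) x) \<le> C * (1 / \<tau> k) ^ m * norm2 (w k)"
          using C(2)[rule_format, OF conjI, OF \<tau>] wH unfolding bounded_2_inf_def by blast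
        then have *: "AE x in M. fnorm B x (heat \<Phi> (\<tau> k) (w k) x) \<le> C * (2 ^ Suc k / s) ^ m * norm2 (w k)"
          by (simp add: \<tau>_def)
        have "0 \<le> C * (2 ^ Suc k / s) ^ m" using C(1) s by simp
        from mult_left_mono[OF gap this]
        have le: "C * (2 ^ Suc k / s) ^ m * norm2 (w k) \<le> C * (2 ^ Suc k / s) ^ m * exp (- (a * sqrt 2 ^ k / s)) * norm2 g"
          by (simp only: mult.assoc)
        from * show ?thesis by eventually_elim (rule order_trans[OF _ le])
      qed
      have sum: "AE x in M. fnorm B x (R 0 x) \<le> K * exp (- (a / 2) / s) * norm2 g + fnorm B x (R n x)" for n
      proof -
        have "AE x in M. \<forall>k\<in>{..<n}. fnorm B x (heat \<Phi> (\<tau> k) (w k) x) \<le> C * (2 ^ Suc k / s) ^ m * exp (- (a * sqrt 2 ^ k / s)) * norm2 g"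
          by (intro AE_finite_allI trm) simp
        with tele[of n] show ?thesis
        proof eventually_elim
          case (elim x)
          have f: "heat \<Phi> (\<tau> k) (w k) x \<in> fibre B x" for k
            by (intro L2_fibre heat_L2 wH less_imp_le[OF \<tau>(1)])
          have "fnorm B x (R 0 x) \<le> fnorm B x (\<Sum>k<n. heat \<Phi> (\<tau> k) (w k) x) + fnorm B x (R n x)"
            unfolding elim(1) by (intro fnorm_triangle L2_fibre[OF RH] subspace_sum[OF subspace_fibre] f)
          also have "fnorm B x (\<Sum>k<n. heat \<Phi> (\<tau> k) (w k) x) \<le> (\<Sum>k<n. fnorm B x (heat \<Phi> (\<tau> k) (w k) x))"
            by (intro fnorm_sum_le f)
          also have "\<dots> \<le> (\<Sum>k<n. C * (2 ^ Suc k / s) ^ m * exp (- (a * sqrt 2 ^ k / s)) * norm2 g)"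
            using elim(2) by (intro sum_mono) auto
          also have "\<dots> = (\<Sum>k<n. C * (2 ^ Suc k / s) ^ m * exp (- (a * sqrt 2 ^ k / s))) * norm2 g"
            by (simp only: sum_distrib_right)
          also have "\<dots> \<le> (K * exp (- (a / 2) / s)) * norm2 g"
            unfolding K_def by (intro mult_right_mono off_diagonal_sum a C s norm_nonneg g)
          finally show ?case by simp
        qed
      qed
      \<comment> \<open>The untreated part \<open>R n\<close> has time \<open>s / 2 ^ n\<close> left
        to cross the gap \<open>\<epsilon> * q ^ n\<close>, which is again unlikely at the rate
        \<open>sqrt 2 ^ n\<close>.\<close>
      have rem: "(\<lambda>n. norm2 (cutoff (ball x0 \<epsilon>) (R n))) \<longlonglongrightarrow> 0"
      proof (rule tendsto_sandwich[OF _ _ tendsto_const])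
        show "\<forall>\<^sub>F n in sequentially. 0 \<le> norm2 (cutoff (ball x0 \<epsilon>) (R n))"
          by (intro always_eventually allI norm_nonneg L2_cutoff RH ballm)
        show "\<forall>\<^sub>F n in sequentially. norm2 (cutoff (ball x0 \<epsilon>) (R n)) \<le> exp (- (\<epsilon>\<^sup>2 / (4 * s) * sqrt 2 ^ n)) * norm2 g"
        proof (intro always_eventually allI)
          fix n
          let ?\<delta> = "\<epsilon> * q ^ n"
          have "norm2 (cutoff (ball x0 \<epsilon>) (R n)) = norm2 (cutoff (ball x0 \<epsilon>) (heat \<Phi> (s / 2 ^ n) (cutoff (F n) (h n))))"
            by (simp add: R_def hF)
          also have "\<dots> \<le> exp (- ?\<delta>\<^sup>2 / (4 * (s / 2 ^ n))) * norm2 (h n)"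
          proof (rule davies_gaffney_dist[OF dg Fm ballm _ hH])
            show "0 \<le> ?\<delta>" using \<epsilon> q by simp
            show "0 < s / 2 ^ n" using s by simp
            fix x y assume "x \<in> F n" "y \<in> ball x0 \<epsilon>"
            then have "\<rho> n \<le> dist x0 x" "dist x0 y < \<epsilon>" by (auto simp: F_def)
            moreover have "dist x0 x \<le> dist x0 y + dist x y" by (metis dist_commute dist_triangle)
            moreover have "\<rho> n - \<epsilon> = ?\<delta>" by (simp add: \<rho>_def algebra_simps)
            ultimately show "?\<delta> \<le> dist x y" by linarith
          qed
          also have "\<dots> = exp (- (\<epsilon>\<^sup>2 / (4 * s) * sqrt 2 ^ n)) * norm2 (h n)"
          proof -
            have "?\<delta>\<^sup>2 = \<epsilon>\<^sup>2 * (q ^ n)\<^sup>2" by (simp only: power_mult_distrib)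
            then have "?\<delta>\<^sup>2 / (4 * (s / 2 ^ n)) = \<epsilon>\<^sup>2 / (4 * s) * sqrt 2 ^ n"
              unfolding q2[symmetric] using s by simp
            then show ?thesis by simp
          qed
          also have "\<dots> \<le> exp (- (\<epsilon>\<^sup>2 / (4 * s) * sqrt 2 ^ n)) * norm2 g"
            using hn by (intro mult_left_mono) auto
          finally show "norm2 (cutoff (ball x0 \<epsilon>) (R n)) \<le> exp (- (\<epsilon>\<^sup>2 / (4 * s) * sqrt 2 ^ n)) * norm2 g" .
        qed
        have pos: "0 < \<epsilon>\<^sup>2 / (4 * s)" using \<epsilon> s by simp
        have "(\<lambda>n. exp (- (\<epsilon>\<^sup>2 / (4 * s) * sqrt 2 ^ n))) \<longlonglongrightarrow> 0"
        proof (rule Lim_null_comparison)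
          show "\<forall>\<^sub>F n in sequentially. norm (exp (- (\<epsilon>\<^sup>2 / (4 * s) * sqrt 2 ^ n))) \<le> 1 / (\<epsilon>\<^sup>2 / (4 * s)) * (1 / sqrt 2) ^ n"
          proof (intro always_eventually allI)
            fix n
            have "0 < \<epsilon>\<^sup>2 / (4 * s) * sqrt 2 ^ n" by (intro mult_pos_pos pos) simp
            from exp_minus_le_inverse_power[OF this, of 1]
            show "norm (exp (- (\<epsilon>\<^sup>2 / (4 * s) * sqrt 2 ^ n))) \<le> 1 / (\<epsilon>\<^sup>2 / (4 * s)) * (1 / sqrt 2) ^ n"
              by (simp add: power_one_over)
          qed
          show "(\<lambda>n. 1 / (\<epsilon>\<^sup>2 / (4 * s)) * (1 / sqrt 2) ^ n) \<longlonglongrightarrow> 0"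
            by (intro tendsto_mult_right_zero LIMSEQ_power_zero) simp
        qed
        then show "(\<lambda>n. exp (- (\<epsilon>\<^sup>2 / (4 * s) * sqrt 2 ^ n)) * norm2 g) \<longlonglongrightarrow> 0" by (rule tendsto_mult_left_zero)
      qed
      have "AE x in M. x \<in> ball x0 \<epsilon> \<longrightarrow> fnorm B x (R 0 x) \<le> K * exp (- (a / 2) / s) * norm2 g"
      proof (rule AE_fnorm_le_limit[OF RH RH ballm _ _ rem])
        show "0 \<le> K * exp (- (a / 2) / s) * norm2 g" using K g by simp
        show "AE x in M. x \<in> ball x0 \<epsilon> \<longrightarrow> fnorm B x (R 0 x) \<le> K * exp (- (a / 2) / s) * norm2 g + fnorm B x (R n x)" for n
          using sum[of n] by eventually_elim simp
      qed
      moreover have "R 0 = heat \<Phi> s (cutoff (- ball x0 (2 * \<epsilon>)) g)"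
        by (simp add: R_def h0 F_def \<rho>_def mult.commute)
      ultimately show "AE x in M. x \<in> ball x0 \<epsilon> \<longrightarrow> fnorm B x (heat \<Phi> s (cutoff (- ball x0 (2 * \<epsilon>)) g) x) \<le> K * exp (- (a / 2) / s) * norm2 g"
        by simp
    qed
  qed
qed

end

section \<open>The heat kernel at a point as a section\<close>

lemma delta_AE_diagonal:
  assumes "delta_AE M P"
  shows "AE x in M. P x x"
proof -
  obtain N where N: "N \<in> null_sets M" "\<And>x y. x \<notin> N \<and> y \<notin> N \<longrightarrow> P x y" using assms unfolding delta_AE_def by auto
  from AE_not_in[OF N(1)] show ?thesis by eventually_elim (use N(2) in simp)
qed

lemma delta_AE_iterated:
  assumes "delta_AE M P"
  shows "AE y in M. AE x in M. P x y" "AE x in M. AE y in M. P x y"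
proof -
  obtain N where N: "N \<in> null_sets M" "\<And>x y. x \<notin> N \<and> y \<notin> N \<longrightarrow> P x y" using assms unfolding delta_AE_def by auto
  have n: "AE x in M. x \<notin> N" by (rule AE_not_in[OF N(1)])
  show "AE y in M. AE x in M. P x y" using n
  proof eventually_elim
    case (elim y) from n show ?case by eventually_elim (use N(2) elim in simp)
  qed
  show "AE x in M. AE y in M. P x y" using n
  proof eventually_elim
    case (elim x) from n show ?case by eventually_elim (use N(2) elim in simp)
  qed
qed

locale l2_heat_kernel = l2_calculus M B D A \<Phi>
  for M :: "'x::{metric_space, second_countable_topology} measure"
    and B :: "('x, 'v::real_vector, 'e::euclidean_space) vbundle"
    and D :: "('x \<Rightarrow> 'v) set"
    and A :: "('x \<Rightarrow> 'v) \<Rightarrow> ('x \<Rightarrow> 'v)"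
    and \<Phi> :: "(real \<Rightarrow> real) \<Rightarrow> ('x \<Rightarrow> 'v) \<Rightarrow> ('x \<Rightarrow> 'v)" +
  fixes p :: "real \<Rightarrow> 'x \<Rightarrow> 'x \<Rightarrow> 'v \<Rightarrow> 'v"
  assumes heat_kernel: "heat_kernel B M \<Phi> p"
begin

lemmas heat_kernel_1 = heat_kernel[unfolded heat_kernel_def, THEN conjunct1, THEN spec, THEN mp]

lemma kernel_p: "0 < t \<Longrightarrow> kernel B M (p t)"
  by (rule heat_kernel_1[THEN conjunct1])

lemma heat_eq_kernel:
  "0 < t \<Longrightarrow> f \<in> H \<Longrightarrow> AE x in M. \<forall>u\<in>fibre B x.
     integrable M (\<lambda>y. ip B x (p t x y (f y)) u) \<and> ip B x (heat \<Phi> t f x) u = (LINT y|M. ip B x (p t x y (f y)) u)"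
  by (rule heat_kernel_1[THEN conjunct2, THEN conjunct2, THEN conjunct1, THEN bspec])

lemma kernel_symmetric:
  "0 < t \<Longrightarrow> delta_AE M (\<lambda>x y. \<forall>v\<in>fibre B y. \<forall>u\<in>fibre B x. ip B x (p t x y v) u = ip B y v (p t y x u))"
  by (rule heat_kernel_1[THEN conjunct2, THEN conjunct2, THEN conjunct2])

lemma kernel_semigroup:
  "0 < t \<Longrightarrow> 0 < s \<Longrightarrow> delta_AE M (\<lambda>x y. \<forall>v\<in>fibre B y. \<forall>u\<in>fibre B x.
      integrable M (\<lambda>z. ip B x (p t x z (p s z y v)) u) \<and>
      ip B x (p (t + s) x y v) u = (LINT z|M. ip B x (p t x z (p s z y v)) u))"
  by (rule heat_kernel[unfolded heat_kernel_def, THEN conjunct2, THEN spec, THEN mp, THEN spec, THEN mp])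

lemma kernel_fibre: "0 < t \<Longrightarrow> v \<in> fibre B y \<Longrightarrow> p t x y v \<in> fibre B x"
  using kernel_p[of t, unfolded kernel_def, THEN conjunct1] by blast

lemma kernel_linear:
  "0 < t \<Longrightarrow> u \<in> fibre B y \<Longrightarrow> v \<in> fibre B y \<Longrightarrow> p t x y (a *\<^sub>R u + v) = a *\<^sub>R p t x y u + p t x y v"
  using kernel_p[of t, unfolded kernel_def, THEN conjunct1] by blast

lemma ex_chart: "\<exists>U \<phi>. (U, \<phi>) \<in> charts B \<and> x \<in> U"
  using UNIV_I[of x, folded euclidean[unfolded euclidean_bundle_def, THEN conjunct2, THEN conjunct1]] by auto

text \<open>Kernels are jointly measurable in pairs of charts with constant coordinates in the
  second one. So \<open>v\<close> is written in a chart around \<open>y\<close>, and the kernel is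
  restricted to the slice over \<open>y\<close>.\<close>

lemma Pop_section:
  assumes t: "0 < t" and v: "v \<in> fibre B y"
  shows "measurable_section B M (Pop p t y v)"
  unfolding measurable_section_def Pop_def
proof (intro conjI allI, goal_cases)
  case (1 x) show ?case by (rule kernel_fibre[OF t v])
next
  case 2
  obtain W \<psi> where W: "(W, \<psi>) \<in> charts B" "y \<in> W" using ex_chart by blast
  define a where "a = inv (\<psi> y) v"
  have a: "\<psi> y a = v" unfolding a_def by (rule chart_inv_right[OF W v])
  show ?case
  proof safe
    fix U \<phi> assume c: "(U, \<phi>) \<in> charts B"
    have m: "(\<lambda>(x, y). inv (\<phi> x) (p t x y (\<psi> y a))) \<in> borel_measurable (restrict_space (M \<Otimes>\<^sub>M M) (U \<times> W))"
      using kernel_p[OF t, unfolded kernel_def, THEN conjunct2] c W(1) by fast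
    have "(\<lambda>x. (x, y)) \<in> measurable (restrict_space M U) (restrict_space (M \<Otimes>\<^sub>M M) (U \<times> W))"
      by (rule measurable_restrict_space3) (use W(2) in auto)
    from measurable_compose[OF this m] show "(\<lambda>x. inv (\<phi> x) (p t x y v)) \<in> borel_measurable (restrict_space M U)"
      by (simp add: a)
  qed
qed

text \<open>On the diagonal the integrand of the semigroup identity at \<open>t + t\<close> is, by
  symmetry of the kernel, the squared norm of \<open>p t z y v\<close>; its integrability is part of
  \<open>heat_kernel\<close>.\<close>

lemma Pop_L2:
  assumes t: "0 < t"
  shows "AE y in M. \<forall>v\<in>fibre B y. Pop p t y v \<in> H"
  using delta_AE_diagonal[OF kernel_semigroup[OF t t]] delta_AE_iterated(2)[OF kernel_symmetric[OF t]]
proof eventually_elim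
  case (elim y)
  show ?case
  proof
    fix v assume v: "v \<in> fibre B y"
    let ?k = "\<lambda>z. ip B y (p t y z (p t z y v)) v"
    have s: "measurable_section B M (Pop p t y v)" by (rule Pop_section[OF t v])
    have "integrable M ?k" using elim(1) v by blast
    moreover have "AE z in M. ?k z = ip B z (Pop p t y v z) (Pop p t y v z)"
      using elim(2) by eventually_elim (use v t in \<open>auto simp: Pop_def kernel_fibre\<close>)
    ultimately have "integrable M (\<lambda>z. ip B z (Pop p t y v z) (Pop p t y v z))"
      by (subst integrable_cong_AE[of _ _ ?k]) (auto intro: ip_measurable s elim: eventually_mono)
    then show "Pop p t y v \<in> H" using s by (simp add: L2_def)
  qed
qed

text \<open>So \<open>Pop p t x u\<close> represents the functional that evaluates the heat flow at
  \<open>x\<close> against \<open>u\<close>. The exceptional null set still depends on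
  \<open>f\<close>.\<close>

lemma Pop_inner:
  assumes t: "0 < t" and f: "f \<in> H"
  shows "AE x in M. \<forall>u\<in>fibre B x. ip B x (heat \<Phi> t f x) u = f \<odot> Pop p t x u"
  using heat_eq_kernel[OF t f] delta_AE_iterated(2)[OF kernel_symmetric[OF t]]
proof eventually_elim
  case (elim x)
  show ?case
  proof
    fix u assume u: "u \<in> fibre B x"
    have "ip B x (heat \<Phi> t f x) u = (LINT y|M. ip B x (p t x y (f y)) u)" using elim(1) u by blast
    also have "\<dots> = f \<odot> Pop p t x u"
      unfolding l2inner_def
    proof (rule integral_cong_AE)
      show "(\<lambda>y. ip B x (p t x y (f y)) u) \<in> borel_measurable M" using elim(1) u by auto
      show "(\<lambda>y. ip B y (f y) (Pop p t x u y)) \<in> borel_measurable M"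
        by (intro ip_measurable L2_section f Pop_section t u)
      show "AE y in M. ip B x (p t x y (f y)) u = ip B y (f y) (Pop p t x u y)"
        using elim(2) by eventually_elim (use u L2_fibre[OF f] in \<open>auto simp: Pop_def\<close>)
    qed
    finally show "ip B x (heat \<Phi> t f x) u = f \<odot> Pop p t x u" .
  qed
qed

lemma Pop_semigroup:
  assumes t: "0 < t" and s: "0 < s"
  shows "AE y in M. \<forall>v\<in>fibre B y. AE x in M. Pop p (t + s) y v x = heat \<Phi> t (Pop p s y v) x"
  using delta_AE_iterated(1)[OF kernel_semigroup[OF t s]] Pop_L2[OF s]
proof eventually_elim
  case (elim y)
  show ?case
  proof
    fix v assume v: "v \<in> fibre B y"
    then have P: "Pop p s y v \<in> H" using elim(2) by blast
    show "AE x in M. Pop p (t + s) y v x = heat \<Phi> t (Pop p s y v) x"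
      using elim(1) heat_eq_kernel[OF t P]
    proof eventually_elim
      case (elim x)
      let ?a = "Pop p (t + s) y v x" and ?b = "heat \<Phi> t (Pop p s y v) x"
      have a: "?a \<in> fibre B x" unfolding Pop_def by (rule kernel_fibre[OF _ v]) (use t s in simp)
      have b: "?b \<in> fibre B x" by (rule L2_fibre[OF heat_L2[OF less_imp_le[OF t] P]])
      note ab = a b
      have d: "?a - ?b \<in> fibre B x" by (rule fibre_diff[OF a b])
      have "ip B x ?a (?a - ?b) = ip B x ?b (?a - ?b)"
        using elim(1)[rule_format, OF v d] elim(2)[rule_format, OF d] by (simp add: Pop_def)
      then have "ip B x (?a - ?b) (?a - ?b) = 0" using ab d by (simp add: ip_diff_left)
      then show ?case using ip_eq_0[OF d] by simp
    qed
  qed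
qed

lemma Pop_lincomb:
  assumes "0 < t" "u \<in> fibre B x" "v \<in> fibre B x"
  shows "Pop p t x (a *\<^sub>R u + v) = (\<lambda>y. a *\<^sub>R Pop p t x u y + Pop p t x v y)"
  using assms by (simp add: Pop_def kernel_linear)

text \<open>An \<open>L\<^sup>2 \<rightarrow> L\<^sup>\<infinity>\<close> bound only holds off a null set that depends on the function. Separability of \<open>L\<^sup>2\<close>
  makes the null set uniform, which transfers the bound to the heat kernel itself.\<close>

lemma Pop_cutoff_norm_le:
  assumes t: "0 < t" and F: "F \<in> sets M" and N: "0 \<le> N"
    and bound: "\<And>g. g \<in> H \<Longrightarrow> AE x in M. x \<in> S \<longrightarrow> fnorm B x (heat \<Phi> t (cutoff F g) x) \<le> N * norm2 g"
  shows "AE x in M. x \<in> S \<longrightarrow> (\<forall>v\<in>fibre B x. norm2 (cutoff F (Pop p t x v)) \<le> N * fnorm B x v)"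
proof -
  obtain C where C: "countable C" "C \<subseteq> H" "approximable C = H" by (rule separable_L2)
  have "AE x in M. \<forall>g\<in>C. x \<in> S \<longrightarrow> fnorm B x (heat \<Phi> t (cutoff F g) x) \<le> N * norm2 g"
    unfolding AE_ball_countable[OF C(1)] using bound C(2) by blast
  moreover have "AE x in M. \<forall>g\<in>C. \<forall>u\<in>fibre B x. ip B x (heat \<Phi> t (cutoff F g) x) u = cutoff F g \<odot> Pop p t x u"
    unfolding AE_ball_countable[OF C(1)] using C(2) F by (intro ballI Pop_inner t L2_cutoff) auto
  ultimately show ?thesis using Pop_L2[OF t]
  proof eventually_elim
    case (elim x)
    show ?case
    proof (intro impI ballI)
      fix v assume x: "x \<in> S" and v: "v \<in> fibre B x"
      define w where "w = cutoff F (Pop p t x v)"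
      have P: "Pop p t x v \<in> H" using elim(3) v by blast
      then have w: "w \<in> H" unfolding w_def by (rule L2_cutoff[OF _ F])
      have ww: "w \<odot> w \<le> N * fnorm B x v * norm2 w"
      proof (rule field_le_epsilon)
        fix e :: real assume e: "0 < e"
        \<comment> \<open>At the fixed \<open>x\<close> the bound is available only for
          \<open>g\<close> in the countable set. Replacing \<open>w\<close> by such a
          \<open>g\<close> changes the pairing and the norm bound by at most \<open>\<delta>\<close>
          times the sum in this denominator.\<close>
        define \<delta> where "\<delta> = e / (1 + norm2 w + N * fnorm B x v)"
        have pos: "0 < 1 + norm2 w + N * fnorm B x v"
          using norm_nonneg[OF w] N fnorm_nonneg[OF v] by (intro add_pos_nonneg) auto
        have \<delta>: "0 < \<delta>" using e pos by (simp add: \<delta>_def)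
        have "w \<in> approximable C" using w C(3) by simp
        then obtain g where g: "g \<in> C" "norm2 (\<lambda>x. w x - g x) < \<delta>" using \<delta> unfolding approximable_def by blast
        have gH: "g \<in> H" using g C(2) by blast
        have "g \<odot> w = cutoff F g \<odot> Pop p t x v" unfolding w_def by (rule inner_cutoff[OF gH P, symmetric])
        also have "\<dots> = ip B x (heat \<Phi> t (cutoff F g) x) v" using elim(2) g(1) v by simp
        also have "\<dots> \<le> fnorm B x (heat \<Phi> t (cutoff F g) x) * fnorm B x v"
          using ip_Cauchy_Schwarz[OF L2_fibre[OF heat_L2[OF less_imp_le[OF t] L2_cutoff[OF gH F]]] v] by (rule abs_le_D1)
        also have "\<dots> \<le> (N * norm2 g) * fnorm B x v"
          using elim(1) g(1) x by (intro mult_right_mono fnorm_nonneg[OF v]) blast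
        also have "\<dots> \<le> (N * (norm2 w + \<delta>)) * fnorm B x v"
        proof (intro mult_right_mono mult_left_mono N fnorm_nonneg[OF v])
          show "norm2 g \<le> norm2 w + \<delta>"
            using norm_le_diff[OF gH w] norm_diff_commute[OF gH w] g(2) by linarith
        qed
        finally have 1: "g \<odot> w \<le> N * (norm2 w + \<delta>) * fnorm B x v" .
        have "(\<lambda>x. w x - g x) \<odot> w \<le> norm2 (\<lambda>x. w x - g x) * norm2 w"
          using Cauchy_Schwarz[OF L2_diff[OF w gH] w] by (rule abs_le_D1)
        also have "\<dots> \<le> \<delta> * norm2 w" using g(2) by (intro mult_right_mono norm_nonneg[OF w]) simp
        finally have 2: "(\<lambda>x. w x - g x) \<odot> w \<le> \<delta> * norm2 w" .
        have "w \<odot> w = (\<lambda>x. w x - g x) \<odot> w + g \<odot> w" by (simp add: inner_diff_left w gH)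
        also have "\<dots> \<le> N * fnorm B x v * norm2 w + \<delta> * (norm2 w + N * fnorm B x v)"
          using 1 2 by (simp add: algebra_simps)
        also have "\<delta> * (norm2 w + N * fnorm B x v) \<le> \<delta> * (1 + norm2 w + N * fnorm B x v)"
          using \<delta> by (intro mult_left_mono) auto
        also have "\<dots> = e" using pos by (simp add: \<delta>_def)
        finally show "w \<odot> w \<le> N * fnorm B x v * norm2 w + e" by simp
      qed
      show "norm2 w \<le> N * fnorm B x v"
      proof (cases "norm2 w = 0")
        case True then show ?thesis using N v by simp
      next
        case False
        then have p: "0 < norm2 w" using norm_nonneg[OF w] by simp
        have "norm2 w * norm2 w \<le> N * fnorm B x v * norm2 w"
          using ww norm_power2[OF w] by (simp add: power2_eq_square)
        then show ?thesis by (rule mult_right_le_imp_le) (rule p)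
      qed
    qed
  qed
qed

section \<open>Local counting function\<close>

text \<open>A chart carries the inner product of the fibre to the Gram operator \<open>S\<close> on
  the model space. Positivity makes it injective, hence surjective in finite dimension, and a
  preimage of the coefficients of the functional gives the representing vector.\<close>

lemma fibre_riesz:
  assumes "\<And>a u v. u \<in> fibre B x \<Longrightarrow> v \<in> fibre B x \<Longrightarrow> f (a *\<^sub>R u + v) = a * f u + f v"
  shows "\<exists>w\<in>fibre B x. \<forall>u\<in>fibre B x. ip B x w u = f u"
proof -
  obtain U \<phi> where c: "(U, \<phi>) \<in> charts B" "x \<in> U" using ex_chart by blast
  note lin = chart_linear[OF c]
  define S :: "'e \<Rightarrow> 'e" where "S a = (\<Sum>i\<in>Basis. ip B x (\<phi> x a) (\<phi> x i) *\<^sub>R i)" for a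
  have fib: "\<phi> x a \<in> fibre B x" for a by (rule chart_fibre[OF c])
  have Si: "S a \<bullet> i = ip B x (\<phi> x a) (\<phi> x i)" if "i \<in> Basis" for a i
    using that by (simp add: S_def inner_sum_left_Basis)
  have Sb: "S a \<bullet> b = ip B x (\<phi> x a) (\<phi> x b)" for a b
  proof -
    have "\<phi> x b = (\<Sum>i\<in>Basis. (b \<bullet> i) *\<^sub>R \<phi> x i)"
      using lin by (subst euclidean_representation[of b, symmetric]) (simp add: linear_sum linear_scale del: euclidean_representation)
    then have "ip B x (\<phi> x a) (\<phi> x b) = (\<Sum>i\<in>Basis. (b \<bullet> i) * ip B x (\<phi> x a) (\<phi> x i))"
      by (simp add: ip_sum_right fib)
    also have "\<dots> = (\<Sum>i\<in>Basis. (S a \<bullet> i) * (b \<bullet> i))" by (intro sum.cong) (auto simp: Si)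
    also have "\<dots> = S a \<bullet> b" by (rule euclidean_inner[symmetric])
    finally show ?thesis by simp
  qed
  have linS: "linear S"
    by (rule linearI) (simp_all add: S_def linear_add[OF lin] linear_scale[OF lin] ip_add_left ip_scale_left fib
        scaleR_add_left sum.distrib scaleR_sum_right)
  have "inj S"
    unfolding linear_injective_0[OF linS]
  proof (intro allI impI)
    fix a assume "S a = 0"
    then have "ip B x (\<phi> x a) (\<phi> x a) = 0" using Sb[of a a] by simp
    then have "\<phi> x a = 0" using ip_eq_0[OF fib] by simp
    then show "a = 0" using chart_inv_left[OF c, of a] chart_inv_left[OF c, of 0] linear_0[OF lin] by simp
  qed
  with linS have "surj S" by (rule linear_inj_imp_surj)
  define g where "g a = f (\<phi> x a)" for a
  have f0: "f 0 = 0" using assms[of 0 0 1] by simp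
  have ling: "linear g"
  proof (rule linearI)
    show "g (a + b) = g a + g b" for a b using assms[OF fib fib, of 1 a b] by (simp add: g_def linear_add[OF lin])
    show "g (r *\<^sub>R a) = r *\<^sub>R g a" for r a using assms[OF fib fibre_0, of r a] f0 by (simp add: g_def linear_scale[OF lin])
  qed
  obtain a where a: "S a = (\<Sum>i\<in>Basis. g i *\<^sub>R i)" using \<open>surj S\<close> by (metis surjD)
  have "ip B x (\<phi> x a) u = f u" if u: "u \<in> fibre B x" for u
  proof -
    define b where "b = inv (\<phi> x) u"
    have b: "\<phi> x b = u" unfolding b_def by (rule chart_inv_right[OF c u])
    have "ip B x (\<phi> x a) u = S a \<bullet> b" by (simp add: Sb b)
    also have "\<dots> = (\<Sum>i\<in>Basis. (S a \<bullet> i) * (b \<bullet> i))" by (rule euclidean_inner)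
    also have "\<dots> = (\<Sum>i\<in>Basis. (b \<bullet> i) * g i)"
      by (intro sum.cong refl) (simp add: a inner_sum_left_Basis)
    also have "\<dots> = g b"
      using ling by (subst (2) euclidean_representation[of b, symmetric]) (simp add: linear_sum linear_scale del: euclidean_representation)
    finally show ?thesis by (simp add: g_def b)
  qed
  then show ?thesis using fib by blast
qed

lemma counting_multiplier_bounded: "(\<lambda>l. indicat_real {0..a} l * exp (t * l)) \<in> bounded_borel"
proof (rule bounded_borelI[where C="exp (\<bar>t * a\<bar>)"])
  fix l :: real assume "0 \<le> l"
  show "\<bar>indicat_real {0..a} l * exp (t * l)\<bar> \<le> exp \<bar>t * a\<bar>"
  proof (cases "l \<in> {0..a}")
    case True
    then have "t * l \<le> \<bar>t\<bar> * \<bar>a\<bar>"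
      by (metis abs_ge_self abs_mult abs_of_nonneg atLeastAtMost_iff mult_left_mono abs_ge_zero order_trans)
    then show ?thesis using True by (simp add: abs_mult)
  qed simp
qed measurable

text \<open>The vectors \<open>e v\<close> represent the coordinate functionals of a basis
  \<open>b\<close>, so the trace becomes a sum of pairings. Since \<open>b\<close> and
  \<open>e\<close> do not depend on \<open>a\<close>, increments of the counting function can be
  estimated term by term.\<close>

lemma local_counting_eq:
  assumes t: "0 < t" and P: "\<forall>v\<in>fibre B x. Pop p (t / 2) x v \<in> H"
  obtains b e where "b \<subseteq> fibre B x" "e ` b \<subseteq> fibre B x"
    "\<forall>a. local_counting B M \<Phi> p t x a =
      (\<Sum>v\<in>b. \<Phi> (\<lambda>l. indicat_real {0..a} l * exp (t * l)) (Pop p (t / 2) x v) \<odot> Pop p (t / 2) x (e v))"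
proof -
  have t2: "0 < t / 2" using t by simp
  \<comment> \<open>The very basis selected by \<open>trace_on\<close>, so that no invariance of the
    trace is called for.\<close>
  define b where "b = (SOME b. independent b \<and> span b = fibre B x)"
  have "\<exists>b. independent b \<and> span b = fibre B x"
    by (metis basis_exists span_subspace subspace_fibre)
  then have b: "independent b" "span b = fibre B x" unfolding b_def by (rule someI2_ex; blast)+
  have bf: "b \<subseteq> fibre B x" using b(2) span_superset by blast
  have "\<exists>w\<in>fibre B x. \<forall>u\<in>fibre B x. ip B x w u = representation b u v" for v
  proof (rule fibre_riesz)
    fix a u u' assume "u \<in> fibre B x" "u' \<in> fibre B x"
    then show "representation b (a *\<^sub>R u + u') v = a * representation b u v + representation b u' v"
      using b by (simp add: representation_add representation_scale fibre_scale)
  qed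
  then obtain e where e: "\<And>v. e v \<in> fibre B x" "\<And>v u. u \<in> fibre B x \<Longrightarrow> ip B x (e v) u = representation b u v"
    by metis
  show thesis
  proof (rule that[OF bf])
    show "e ` b \<subseteq> fibre B x" using e(1) by blast
    show "\<forall>a. local_counting B M \<Phi> p t x a =
      (\<Sum>v\<in>b. \<Phi> (\<lambda>l. indicat_real {0..a} l * exp (t * l)) (Pop p (t / 2) x v) \<odot> Pop p (t / 2) x (e v))"
    proof
      fix a
      let ?\<phi> = "\<lambda>l. indicat_real {0..a} l * exp (t * l)"
      let ?K = "calc_kernel B M \<Phi> p t (indicat_real {0..a}) x x"
      have K: "?K v \<in> fibre B x \<and> (\<forall>u\<in>fibre B x. ip B x (?K v) u = \<Phi> ?\<phi> (Pop p (t / 2) x v) \<odot> Pop p (t / 2) x u)"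
        if v: "v \<in> fibre B x" for v
      proof -
        let ?g = "\<Phi> ?\<phi> (Pop p (t / 2) x v)"
        have g: "?g \<in> H" using P v by (intro calc_L2 counting_multiplier_bounded) blast
        have "\<exists>w\<in>fibre B x. \<forall>u\<in>fibre B x. ip B x w u = ?g \<odot> Pop p (t / 2) x u"
          by (rule fibre_riesz) (use P g in \<open>simp add: Pop_lincomb[OF t2] inner_lincomb_right\<close>)
        then obtain w where w: "w \<in> fibre B x" "\<forall>u\<in>fibre B x. ip B x w u = ?g \<odot> Pop p (t / 2) x u" by blast
        have "Pop_adj B M p (t / 2) x ?g = w"
          unfolding Pop_adj_def
        proof (rule the_equality)
          show "w \<in> fibre B x \<and> (\<forall>u\<in>fibre B x. ip B x w u = ?g \<odot> Pop p (t / 2) x u)" using w by blast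
          fix w' assume w': "w' \<in> fibre B x \<and> (\<forall>u\<in>fibre B x. ip B x w' u = ?g \<odot> Pop p (t / 2) x u)"
          then have "ip B x (w' - w) (w' - w) = 0" using w by (simp add: ip_diff_left fibre_diff)
          then have "w' - w = 0" using w w' ip_eq_0[of "w' - w" x] by (simp add: fibre_diff)
          then show "w' = w" by simp
        qed
        then show ?thesis using w by (simp add: calc_kernel_def)
      qed
      have "local_counting B M \<Phi> p t x a = (\<Sum>v\<in>b. representation b (?K v) v)"
        unfolding local_counting_def trace_on_def Let_def b_def ..
      also have "\<dots> = (\<Sum>v\<in>b. \<Phi> ?\<phi> (Pop p (t / 2) x v) \<odot> Pop p (t / 2) x (e v))"
      proof (rule sum.cong[OF refl])
        fix v assume "v \<in> b"
        then have v: "v \<in> fibre B x" using bf by blast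
        have "representation b (?K v) v = ip B x (?K v) (e v)"
          using e(2)[of "?K v" v] ip_commute[OF _ e(1), of "?K v" v] K[OF v] by simp
        then show "representation b (?K v) v = \<Phi> ?\<phi> (Pop p (t / 2) x v) \<odot> Pop p (t / 2) x (e v)"
          using K[OF v] e(1) by simp
      qed
      finally show "local_counting B M \<Phi> p t x a = (\<Sum>v\<in>b. \<Phi> ?\<phi> (Pop p (t / 2) x v) \<odot> Pop p (t / 2) x (e v))" .
    qed
  qed
qed

end

section \<open>The Weyl law in spectral windows\<close>

context l2_heat_kernel
begin

text \<open>Spectral mass in the windows \<open>(a\<^sup>n, a\<^sup>n\<^sup>+\<^sup>1]\<close>: the Weyl law makes \<open>E\<^sub>x(a\<^sup>n)\<close> grow by the factor
  \<open>a\<^sup>\<alpha>\<close>, so the increments stay away from zero. No regularity of the slowly varying function is needed.\<close>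

lemma counting_increment:
  fixes E :: "real \<Rightarrow> real"
  assumes eq: "asymp_equiv E at_top (\<lambda>l. c * l powr \<alpha> * \<kappa> l)" and c: "0 < c" and \<alpha>: "0 < \<alpha>"
    and \<kappa>: "slowly_varying \<kappa>" and a: "1 < a"
  obtains \<delta> n0 where "0 < \<delta>" "\<forall>n\<ge>n0. \<delta> \<le> E (a ^ Suc n) - E (a ^ n)"
proof -
  define w where "w l = c * l powr \<alpha> * \<kappa> l" for l
  have \<kappa>pos: "0 < \<kappa> l" if "0 \<le> l" for l using \<kappa> that by (simp add: slowly_varying_def)
  have wpos: "0 < w l" if "0 < l" for l using \<kappa>pos[of l] c that by (simp add: w_def)
  have an: "filterlim (\<lambda>n. a ^ n) at_top sequentially" using a by real_asymp
  \<comment> \<open>\<open>asymp_equiv\<close> assigns the value 1 to the quotient where both sides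
    vanish. For positive \<open>l\<close> the comparison function is positive, so eventually the
    plain quotient is meant.\<close>
  have Ew: "((\<lambda>l. E l / w l) \<longlongrightarrow> 1) at_top"
  proof -
    have "((\<lambda>x. if E x = 0 \<and> w x = 0 then 1 else E x / w x) \<longlongrightarrow> 1) at_top"
      using eq unfolding asymp_equiv_def w_def .
    moreover have "eventually (\<lambda>x. (if E x = 0 \<and> w x = 0 then 1 else E x / w x) = E x / w x) at_top"
      using eventually_gt_at_top[of 0] by eventually_elim (use wpos in force)
    ultimately show ?thesis by (rule Lim_transform_eventually)
  qed
  have r: "(\<lambda>n. E (a ^ n) / w (a ^ n)) \<longlonglongrightarrow> 1" by (rule filterlim_compose[OF Ew an])
  have "((\<lambda>l. \<kappa> (a * l) / \<kappa> l) \<longlongrightarrow> 1) at_top" using \<kappa> a by (simp add: slowly_varying_def)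
  from filterlim_compose[OF this an] have k: "(\<lambda>n. \<kappa> (a ^ Suc n) / \<kappa> (a ^ n)) \<longlonglongrightarrow> 1" by simp
  have "(\<lambda>n. E (a ^ Suc n) / E (a ^ n)) \<longlonglongrightarrow> 1 * (a powr \<alpha> * 1) / 1"
  proof (rule Lim_transform_eventually)
    show "(\<lambda>n. (E (a ^ Suc n) / w (a ^ Suc n)) * (a powr \<alpha> * (\<kappa> (a ^ Suc n) / \<kappa> (a ^ n))) / (E (a ^ n) / w (a ^ n))) \<longlonglongrightarrow> 1 * (a powr \<alpha> * 1) / 1"
      by (intro tendsto_intros r k LIMSEQ_Suc[OF r]) simp
    show "\<forall>\<^sub>F n in sequentially. (E (a ^ Suc n) / w (a ^ Suc n)) * (a powr \<alpha> * (\<kappa> (a ^ Suc n) / \<kappa> (a ^ n))) / (E (a ^ n) / w (a ^ n)) = E (a ^ Suc n) / E (a ^ n)"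
    proof (intro always_eventually allI)
      fix n
      have pos: "0 < a ^ n" "0 < a ^ Suc n" using a by simp_all
      have "w (a ^ Suc n) = a powr \<alpha> * (\<kappa> (a ^ Suc n) / \<kappa> (a ^ n)) * w (a ^ n)"
        using \<kappa>pos[of "a ^ n"] a by (simp add: w_def powr_mult)
      then show "(E (a ^ Suc n) / w (a ^ Suc n)) * (a powr \<alpha> * (\<kappa> (a ^ Suc n) / \<kappa> (a ^ n))) / (E (a ^ n) / w (a ^ n)) = E (a ^ Suc n) / E (a ^ n)"
        using wpos[OF pos(1)] wpos[OF pos(2)] by (cases "a powr \<alpha> * (\<kappa> (a ^ Suc n) / \<kappa> (a ^ n)) = 0") (simp_all only: mult_zero_left less_irrefl, simp)
    qed
  qed
  then have lim: "(\<lambda>n. E (a ^ Suc n) / E (a ^ n)) \<longlonglongrightarrow> a powr \<alpha>" by simp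
  \<comment> \<open>Any number strictly between 1 and the limiting growth factor
    \<open>a powr \<alpha>\<close> would do. From some index on, each step multiplies
    \<open>E\<close> by more than \<open>b\<close>, so the increments are at least
    \<open>b - 1\<close> times the value at that index.\<close>
  define b where "b = (1 + a powr \<alpha>) / 2"
  have "1 < a powr \<alpha>" using a \<alpha> by (simp add: gr_one_powr)
  then have b: "1 < b" "b < a powr \<alpha>" by (auto simp: b_def)
  have "eventually (\<lambda>n. 0 < E (a ^ n) / w (a ^ n) \<and> b < E (a ^ Suc n) / E (a ^ n)) sequentially"
    using order_tendstoD(1)[OF r, of 0] order_tendstoD(1)[OF lim b(2)] by (auto elim: eventually_elim2)
  then obtain n0 where n0: "\<And>n. n0 \<le> n \<Longrightarrow> 0 < E (a ^ n) / w (a ^ n) \<and> b < E (a ^ Suc n) / E (a ^ n)"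
    unfolding eventually_sequentially by blast
  have Epos: "0 < E (a ^ n)" if "n0 \<le> n" for n
    using n0[OF that] wpos[of "a ^ n"] a by (simp add: zero_less_divide_iff)
  have grow: "b * E (a ^ n) < E (a ^ Suc n)" if "n0 \<le> n" for n
    using n0[OF that] Epos[OF that] by (simp add: pos_less_divide_eq)
  have ge: "E (a ^ n0) \<le> E (a ^ n)" if "n0 \<le> n" for n
    using that
  proof (induction n rule: dec_induct)
    case (step n)
    have "1 * E (a ^ n) \<le> b * E (a ^ n)" using b Epos[OF step(1)] by (intro mult_right_mono) auto
    then show ?case using grow[OF step(1)] step by simp
  qed simp
  show thesis
  proof (rule that)
    show "0 < (b - 1) * E (a ^ n0)" using b Epos[of n0] by simp
    show "\<forall>n\<ge>n0. (b - 1) * E (a ^ n0) \<le> E (a ^ Suc n) - E (a ^ n)"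
    proof (intro allI impI)
      fix n assume n: "n0 \<le> n"
      have "(b - 1) * E (a ^ n0) \<le> (b - 1) * E (a ^ n)" using b ge[OF n] by (intro mult_left_mono) auto
      also have "\<dots> \<le> E (a ^ Suc n) - E (a ^ n)" using grow[OF n] by (simp add: left_diff_distrib)
      finally show "(b - 1) * E (a ^ n0) \<le> E (a ^ Suc n) - E (a ^ n)" .
    qed
  qed
qed

lemma calc_norm_power2:
  assumes "\<phi> \<in> bounded_borel" "f \<in> H"
  shows "(norm2 (\<Phi> \<phi> f))\<^sup>2 = (LINT l|spec f. (\<phi> l)\<^sup>2)"
  using assms calc_inner_mult[of \<phi> \<phi> f f] integral_spec(2)[of f "\<lambda>l. \<phi> l * \<phi> l"]
  by (simp add: norm_power2 calc_L2 bounded_borel_mult power2_eq_square[of "\<phi> _"])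

lemma heat_norm_power2:
  assumes "0 \<le> t" "f \<in> H"
  shows "(norm2 (heat \<Phi> t f))\<^sup>2 = (LINT l|spec f. exp (- 2 * t * l))"
proof -
  have "(exp (- t * l))\<^sup>2 = exp (- 2 * t * l)" for l by (simp add: power2_eq_square flip: exp_add)
  then show ?thesis using calc_norm_power2[OF bounded_borel_exp[OF assms(1)] assms(2)] by (simp add: heat_def)
qed

text \<open>Written as the Laplace transform of a finite measure, the squared heat norm is visibly
  measurable in time, which \<open>observability_window\<close> needs for the weighted
  integral.\<close>

lemma heat_norm_power2_measurable:
  assumes "f \<in> H"
  shows "(\<lambda>t. LINT l|spec f. exp (- 2 * t * l)) \<in> borel_measurable borel"
proof -
  interpret finite_measure "spec f" by (rule finite_measure_spec[OF assms])
  show ?thesis by measurable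
qed

lemma heat_norm_power2_ge:
  assumes t: "0 \<le> t" and f: "f \<in> H" and b: "0 \<le> b"
  shows "exp (- 2 * t * b) * (norm2 (\<Phi> (indicat_real {a<..b}) f))\<^sup>2 \<le> (norm2 (heat \<Phi> t f))\<^sup>2"
proof -
  have i: "indicat_real {a<..b} \<in> bounded_borel" by (rule bounded_borel_indicator) simp
  have sq: "(indicat_real {a<..b} l)\<^sup>2 = indicat_real {a<..b} l" for l by (simp add: indicator_def)
  have "exp (- 2 * t * b) * (norm2 (\<Phi> (indicat_real {a<..b}) f))\<^sup>2 = (LINT l|spec f. exp (- 2 * t * b) * indicat_real {a<..b} l)"
    using calc_norm_power2[OF i f] by (simp add: sq)
  also have "\<dots> \<le> (LINT l|spec f. exp (- 2 * t * l))"
  proof (rule integral_mono_AE)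
    show "integrable (spec f) (\<lambda>l. exp (- 2 * t * b) * indicat_real {a<..b} l)"
      by (intro integrable_mult_right integral_spec f i)
    have "(\<lambda>l. exp (- (2 * t) * l)) \<in> bounded_borel" using t by (intro bounded_borel_exp) simp
    from integral_spec(1)[OF f this] show "integrable (spec f) (\<lambda>l. exp (- 2 * t * l))" by simp
    show "AE l in spec f. exp (- 2 * t * b) * indicat_real {a<..b} l \<le> exp (- 2 * t * l)"
    proof (rule AE_I2)
      fix l
      show "exp (- 2 * t * b) * indicat_real {a<..b} l \<le> exp (- 2 * t * l)"
        using mult_left_mono[of l b t] t by (cases "l \<in> {a<..b}") auto
    qed
  qed
  finally show ?thesis using heat_norm_power2[OF t f] by simp
qed

text \<open>The semigroup moves the reference time from \<open>1 / 2\<close> to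
  \<open>\<sigma>\<close> on both sides of the pairing. On the window the total multiplier is
  \<open>exp l * exp (- (1 - 2 * \<sigma>) * l) = exp (2 * \<sigma> * l)\<close>, a constant for
  \<open>\<sigma>\<close> of order \<open>1 / b\<close>. The window projection is kept only on the
  side of \<open>v\<close>, where the observability inequality will bound it.\<close>

lemma weyl_increment_le:
  assumes x: "\<forall>v\<in>fibre B x. Pop p (1 / 2) x v \<in> H" "\<forall>v\<in>fibre B x. Pop p \<sigma> x v \<in> H"
    and semi: "\<forall>v\<in>fibre B x. AE y in M. Pop p (1 / 2) x v y = heat \<Phi> (1 / 2 - \<sigma>) (Pop p \<sigma> x v) y"
    and \<sigma>: "0 < \<sigma>" "\<sigma> < 1 / 2" and ab: "0 \<le> a" "a \<le> b" and v: "v \<in> fibre B x" and w: "w \<in> fibre B x"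
  shows "\<Phi> (\<lambda>l. indicat_real {0..b} l * exp (1 * l)) (Pop p (1 / 2) x v) \<odot> Pop p (1 / 2) x w
       - \<Phi> (\<lambda>l. indicat_real {0..a} l * exp (1 * l)) (Pop p (1 / 2) x v) \<odot> Pop p (1 / 2) x w
     \<le> exp (2 * \<sigma> * b) * norm2 (\<Phi> (indicat_real {a<..b}) (Pop p \<sigma> x v)) * norm2 (Pop p \<sigma> x w)"
proof -
  let ?\<phi> = "\<lambda>c l. indicat_real {0..c} l * exp (1 * l)"
  let ?e = "\<lambda>l. exp (- (1 / 2 - \<sigma>) * l)"
  let ?P = "Pop p (1 / 2) x" and ?Q = "Pop p \<sigma> x"
  have P: "?P v \<in> H" "?P w \<in> H" and Q: "?Q v \<in> H" "?Q w \<in> H" using x v w by auto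
  note bb = counting_multiplier_bounded[of _ 1]
  have e: "?e \<in> bounded_borel" using \<sigma> by (intro bounded_borel_exp) simp
  have i: "indicat_real {a<..b} \<in> bounded_borel" by (rule bounded_borel_indicator) simp
  define \<psi> where "\<psi> = (\<lambda>l. - 1 * ?\<phi> a l + ?\<phi> b l)"
  have \<psi>: "\<psi> \<in> bounded_borel" unfolding \<psi>_def by (intro bounded_borel_lincomb bb)
  have "\<Phi> (?\<phi> b) (?P v) \<odot> ?P w - \<Phi> (?\<phi> a) (?P v) \<odot> ?P w = \<Phi> \<psi> (?P v) \<odot> ?P w"
    unfolding \<psi>_def using calc_inner_fun_lincomb[OF bb bb P, of "-1" a b] by simp
  also have "\<dots> = \<Phi> \<psi> (\<Phi> ?e (?Q v)) \<odot> ?P w"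
    using semi v by (intro inner_cong_left calc_AE_cong calc_L2 \<psi> e P Q) (auto simp: heat_def)
  also have "\<dots> = ?P w \<odot> \<Phi> \<psi> (\<Phi> ?e (?Q v))"
    by (intro inner_commute calc_L2 \<psi> e P Q)
  also have "\<dots> = \<Phi> ?e (?Q w) \<odot> \<Phi> \<psi> (\<Phi> ?e (?Q v))"
    using semi w by (intro inner_cong_left calc_L2 \<psi> e P Q) (auto simp: heat_def)
  also have "\<dots> = \<Phi> (\<lambda>l. \<psi> l * ?e l) (?Q w) \<odot> \<Phi> ?e (?Q v)"
    using calc_inner_mult[OF \<psi> e Q(2) calc_L2[OF e Q(1)]] by simp
  also have "\<dots> = \<Phi> (\<lambda>l. ?e l * (\<psi> l * ?e l)) (?Q w) \<odot> ?Q v"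
    using calc_inner_mult[OF e bounded_borel_mult[OF \<psi> e] Q(2,1)] by simp
  also have "\<dots> = \<Phi> (\<lambda>l. indicat_real {a<..b} l * (?e l * (\<psi> l * ?e l))) (?Q w) \<odot> ?Q v"
  proof (rule calc_inner_fun_cong)
    show "?e l * (\<psi> l * ?e l) = indicat_real {a<..b} l * (?e l * (\<psi> l * ?e l))" if "0 \<le> l" for l
      using that ab by (auto simp: \<psi>_def indicator_def)
  qed (intro bounded_borel_mult i e \<psi> Q)+
  also have "\<dots> = \<Phi> (\<lambda>l. ?e l * (\<psi> l * ?e l)) (?Q w) \<odot> \<Phi> (indicat_real {a<..b}) (?Q v)"
    by (intro calc_inner_mult bounded_borel_mult i e \<psi> Q)
  also have "\<dots> \<le> norm2 (\<Phi> (\<lambda>l. ?e l * (\<psi> l * ?e l)) (?Q w)) * norm2 (\<Phi> (indicat_real {a<..b}) (?Q v))"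
    by (intro Cauchy_Schwarz[THEN abs_le_D1] calc_L2 bounded_borel_mult i e \<psi> Q)
  also have "\<dots> \<le> (exp (2 * \<sigma> * b) * norm2 (?Q w)) * norm2 (\<Phi> (indicat_real {a<..b}) (?Q v))"
  proof (intro mult_right_mono calc_norm_le norm_nonneg calc_L2 bounded_borel_mult i e \<psi> Q)
    fix l :: real assume l: "0 \<le> l"
    have "\<psi> l = indicat_real {a<..b} l * exp l" using l ab by (auto simp: \<psi>_def indicator_def)
    then have "?e l * (\<psi> l * ?e l) = indicat_real {a<..b} l * (exp l * (?e l * ?e l))" by (simp add: mult_ac)
    also have "exp l * (?e l * ?e l) = exp (2 * \<sigma> * l)" by (simp add: algebra_simps flip: exp_add)
    finally show "\<bar>?e l * (\<psi> l * ?e l)\<bar> \<le> exp (2 * \<sigma> * b)"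
      using \<sigma> by (auto simp: indicator_def abs_mult)
  qed
  finally show ?thesis by (simp add: mult_ac)
qed

end

section \<open>Decay of the weight transform\<close>

text \<open>Monotonicity interpolates between the points \<open>a ^ n\<close> at the price of a
  factor \<open>a\<close> in front of \<open>sqrt l\<close>. Letting \<open>a\<close> be close to 1
  keeps the rate above \<open>R\<close>, and the surplus absorbs the polynomial factor.\<close>

lemma geometric_decay:
  fixes F :: "real \<Rightarrow> real"
  assumes anti: "\<And>k l. 0 \<le> k \<Longrightarrow> k \<le> l \<Longrightarrow> F l \<le> F k" and F0: "\<And>l. 0 \<le> F l"
    and R: "0 \<le> R" "R < R1"
    and bound: "\<And>a. 1 < a \<Longrightarrow> \<exists>G\<ge>0. \<exists>n0. \<forall>n\<ge>n0. F (a ^ Suc n) \<le> G * (a ^ Suc n) ^ m * exp (- R1 * sqrt (a ^ n))"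
  shows "\<exists>C>0. \<forall>l\<ge>0. F l \<le> C * exp (- R * sqrt l)"
proof -
  \<comment> \<open>Then \<open>R1 / a\<close> is the midpoint of \<open>R\<close> and
    \<open>R1\<close>, so the surplus \<open>d\<close> below is \<open>(R1 - R) / 2\<close>.\<close>
  define a where "a = 2 * R1 / (R1 + R)"
  have a: "1 < a" using R by (simp add: a_def less_divide_eq)
  define d where "d = R1 / a - R"
  have d: "0 < d" using R by (simp add: d_def a_def)
  obtain G n0 where G: "0 \<le> G" "\<And>n. n0 \<le> n \<Longrightarrow> F (a ^ Suc n) \<le> G * (a ^ Suc n) ^ m * exp (- R1 * sqrt (a ^ n))"
    using bound[OF a] by blast
  define C where "C = F 0 * exp (R * sqrt (a ^ Suc n0)) + G * (fact (2 * m) / d ^ (2 * m)) + 1"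
  have C1: "0 \<le> F 0 * exp (R * sqrt (a ^ Suc n0))" "0 \<le> G * (fact (2 * m) / d ^ (2 * m))"
    using F0 G(1) d by auto
  have "F l \<le> C * exp (- R * sqrt l)" if l: "0 \<le> l" for l
  proof (cases "l \<le> a ^ Suc n0")
    case True
    have "F l \<le> F 0" using anti[of 0 l] l by simp
    also have "F 0 \<le> F 0 * (exp (R * sqrt (a ^ Suc n0)) * exp (- R * sqrt l))"
    proof -
      have "R * sqrt l \<le> R * sqrt (a ^ Suc n0)" using True R by (intro mult_left_mono) (auto simp del: power_Suc)
      then have "1 \<le> exp (R * sqrt (a ^ Suc n0)) * exp (- R * sqrt l)" by (simp flip: exp_add)
      then show ?thesis using mult_left_mono[OF _ F0[of 0], of 1] by simp
    qed
    also have "\<dots> \<le> C * exp (- R * sqrt l)"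
    proof -
      have "F 0 * exp (R * sqrt (a ^ Suc n0)) \<le> C" using C1(2) by (simp add: C_def)
      then show ?thesis using mult_right_mono[of _ C "exp (- R * sqrt l)"] by (simp add: mult.assoc)
    qed
    finally show ?thesis .
  next
    case False
    obtain N where N: "l < a ^ N" using real_arch_pow[OF a] by blast
    define k where "k = (LEAST k. l < a ^ k)"
    have k: "l < a ^ k" unfolding k_def using N by (rule LeastI)
    have kmin: "a ^ j \<le> l" if "j < k" for j using that not_less_Least unfolding k_def by force
    have "Suc n0 < k"
    proof (rule ccontr)
      assume "\<not> Suc n0 < k"
      then have "a ^ k \<le> a ^ Suc n0" using a by (intro power_increasing) auto
      then show False using k False by linarith
    qed
    then obtain n where n: "k = Suc (Suc n)" "n0 \<le> n"
      by (metis Suc_leI Suc_le_D Suc_le_mono less_Suc_eq_le)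
    have ln: "a ^ Suc n \<le> l" "l < a ^ Suc (Suc n)" using k kmin[of "Suc n"] n by auto
    have ge1: "1 \<le> a ^ Suc n" using a by (intro one_le_power) simp
    \<comment> \<open>The gap is two powers of \<open>a\<close>, not one: \<open>l\<close> lies
      below \<open>a ^ Suc (Suc n)\<close>, while the bound at \<open>a ^ Suc n\<close> decays in
      terms of the lower end \<open>a ^ n\<close> of its window.\<close>
    have "sqrt l \<le> sqrt (a\<^sup>2 * a ^ n)" using ln by (simp add: power2_eq_square mult.assoc)
    also have "\<dots> = a * sqrt (a ^ n)" using a by (simp add: real_sqrt_mult)
    finally have "R1 / a * sqrt l \<le> R1 / a * (a * sqrt (a ^ n))" using R a by (intro mult_left_mono) auto
    then have sq: "R1 / a * sqrt l \<le> R1 * sqrt (a ^ n)" using a by simp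
    have lpos: "0 < l" using ln(1) ge1 by linarith
    have "F l \<le> F (a ^ Suc n)" using anti[of "a ^ Suc n" l] ln ge1 by linarith
    also have "\<dots> \<le> G * (a ^ Suc n) ^ m * exp (- R1 * sqrt (a ^ n))" by (rule G(2)[OF n(2)])
    also have "\<dots> \<le> G * l ^ m * exp (- (R1 / a * sqrt l))"
      using G(1) ln(1) ge1 sq lpos by (intro mult_mono mult_left_mono power_mono) auto
    also have "exp (- (R1 / a * sqrt l)) = exp (- (d * sqrt l)) * exp (- R * sqrt l)"
      by (simp add: d_def algebra_simps flip: exp_add)
    also have "G * l ^ m * (exp (- (d * sqrt l)) * exp (- R * sqrt l)) \<le> G * l ^ m * (fact (2 * m) / (d * sqrt l) ^ (2 * m) * exp (- R * sqrt l))"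
      using G(1) lpos d by (intro mult_left_mono mult_right_mono exp_minus_le_inverse_power) auto
    also have "\<dots> = G * (fact (2 * m) / d ^ (2 * m)) * exp (- R * sqrt l)"
    proof -
      have "(d * sqrt l) ^ (2 * m) = d ^ (2 * m) * l ^ m"
        using lpos by (simp add: power_mult_distrib power_mult)
      then show ?thesis using lpos by simp
    qed
    also have "\<dots> \<le> C * exp (- R * sqrt l)"
      using C1(1) by (intro mult_right_mono) (auto simp: C_def)
    finally show ?thesis .
  qed
  moreover have "0 < C" using C1 by (simp add: C_def)
  ultimately show ?thesis by blast
qed

lemma integrable_indicator_Ico: "integrable lborel (indicat_real {a..<b::real})"
  by (cases "a \<le> b") (simp_all add: integrable_indicator_iff)

lemma weight_set_integrable:
  assumes h: "admissible_weight T h" and g: "g \<in> borel_measurable borel" "\<And>t. 0 \<le> t \<Longrightarrow> \<bar>g t\<bar> \<le> C"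
  shows "set_integrable lborel {0..<T} (\<lambda>t. h t * g t)"
proof -
  have c: "continuous_on {0..<T} h" and "bounded (h ` {0..<T})" using h unfolding admissible_weight_def by auto
  then obtain K where K: "\<forall>x\<in>h ` {0..<T}. norm x \<le> K" unfolding bounded_iff by blast
  have hm [measurable]: "(\<lambda>t. indicat_real {0..<T} t *\<^sub>R h t) \<in> borel_measurable borel"
    by (rule borel_measurable_continuous_on_indicator) (use c in auto)
  note [measurable] = g(1)
  have C0: "0 \<le> C" using g(2)[of 0] by simp
  show ?thesis
    unfolding set_integrable_def
  proof (rule Bochner_Integration.integrable_bound)
    show "integrable lborel (\<lambda>t. (K * C) * indicat_real {0..<T} t)"
      by (intro integrable_mult_right integrable_indicator_Ico)
    have "(\<lambda>t. (indicat_real {0..<T} t *\<^sub>R h t) * g t) \<in> borel_measurable lborel" by measurable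
    then show "(\<lambda>t. indicat_real {0..<T} t *\<^sub>R (h t * g t)) \<in> borel_measurable lborel" by (simp add: mult.assoc)
    show "AE t in lborel. norm (indicat_real {0..<T} t *\<^sub>R (h t * g t)) \<le> norm ((K * C) * indicat_real {0..<T} t)"
    proof (rule AE_I2)
      fix t
      show "norm (indicat_real {0..<T} t *\<^sub>R (h t * g t)) \<le> norm ((K * C) * indicat_real {0..<T} t)"
      proof (cases "t \<in> {0..<T}")
        case True
        then have "\<bar>h t\<bar> * \<bar>g t\<bar> \<le> K * C" using K g(2)[of t] C0 by (intro mult_mono) auto
        then show ?thesis using True abs_ge_self[of "K * C"] by (simp add: abs_mult)
      qed simp
    qed
  qed
qed

lemma weight_exp_set_integrable:
  assumes "admissible_weight T h" "0 \<le> l"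
  shows "set_integrable lborel {0..<T} (\<lambda>t. h t * exp (- 2 * t * l))"
  by (rule weight_set_integrable[OF assms(1), where C=1]) (use assms(2) in auto)

lemma weight_nonneg: "admissible_weight T h \<Longrightarrow> t \<in> {0..<T} \<Longrightarrow> 0 \<le> h t"
  by (simp add: admissible_weight_def)

lemma weight_integral_nonneg:
  assumes "admissible_weight T h"
  shows "0 \<le> (LBINT t:{0..<T}. h t * exp (- 2 * t * l))"
  unfolding set_lebesgue_integral_def
proof (rule Bochner_Integration.integral_nonneg)
  fix t show "0 \<le> indicat_real {0..<T} t *\<^sub>R (h t * exp (- 2 * t * l))"
    using weight_nonneg[OF assms, of t] by (cases "t \<in> {0..<T}") auto
qed

lemma weight_transform_nonneg: "admissible_weight T h \<Longrightarrow> 0 \<le> weight_transform T h l"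
  unfolding weight_transform_def by (intro real_sqrt_ge_zero weight_integral_nonneg)

lemma weight_transform_antimono:
  assumes h: "admissible_weight T h" and kl: "0 \<le> k" "k \<le> l"
  shows "weight_transform T h l \<le> weight_transform T h k"
  unfolding weight_transform_def
proof (intro real_sqrt_le_mono set_integral_mono weight_exp_set_integrable h)
  fix t assume t: "t \<in> {0..<T}"
  then have "t * k \<le> t * l" using kl by (intro mult_left_mono) auto
  then show "h t * exp (- 2 * t * l) \<le> h t * exp (- 2 * t * k)"
    using weight_nonneg[OF h t] by (intro mult_left_mono) auto
qed (use kl in auto)

section \<open>The observability inequality on spectral windows\<close>

context l2_heat_kernel
begin

text \<open>On the window the heat flow loses at most \<open>exp (- 2 * t * b)\<close>, so the
  weighted left-hand side contains the squared weight transform at \<open>b\<close> times the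
  squared window mass. The observed side is at most \<open>T * Z\<^sup>2\<close>.\<close>

lemma observability_window:
  assumes h: "admissible_weight T h" and T: "0 < T" and \<omega>: "\<omega> \<in> sets M" and f: "f \<in> H"
    and obs: "(LBINT t:{0..<T}. h t * (norm2 (heat \<Phi> t f))\<^sup>2) \<le> (LBINT t:{0..<T}. (norm2 (cutoff \<omega> (heat \<Phi> t f)))\<^sup>2)"
    and Z: "\<And>t. 0 \<le> t \<Longrightarrow> norm2 (cutoff \<omega> (heat \<Phi> t f)) \<le> Z" and b: "0 \<le> b"
  shows "weight_transform T h b * norm2 (\<Phi> (indicat_real {a<..b}) f) \<le> sqrt T * Z"
proof -
  let ?Y = "norm2 (\<Phi> (indicat_real {a<..b}) f)"
  have i: "indicat_real {a<..b} \<in> bounded_borel" by (rule bounded_borel_indicator) simp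
  have Y: "0 \<le> ?Y" by (intro norm_nonneg calc_L2 i f)
  have Z0: "0 \<le> Z" using Z[of 0] norm_nonneg[OF L2_cutoff[OF heat_L2[OF order.refl f] \<omega>]] by linarith
  have "(LBINT t:{0..<T}. h t * exp (- 2 * t * b)) * ?Y\<^sup>2 = (LBINT t:{0..<T}. (h t * exp (- 2 * t * b)) * ?Y\<^sup>2)"
    by (rule set_integral_mult_left[symmetric])
  also have "\<dots> \<le> (LBINT t:{0..<T}. h t * (norm2 (heat \<Phi> t f))\<^sup>2)"
  proof (rule set_integral_mono)
    show "set_integrable lborel {0..<T} (\<lambda>t. (h t * exp (- 2 * t * b)) * ?Y\<^sup>2)"
      by (intro set_integrable_mult_left weight_exp_set_integrable h b)
    have "set_integrable lborel {0..<T} (\<lambda>t. h t * (LINT l|spec f. exp (- 2 * t * l)))"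
    proof (rule weight_set_integrable[OF h heat_norm_power2_measurable[OF f]])
      fix t :: real assume t: "0 \<le> t"
      have "norm2 (heat \<Phi> t f) \<le> norm2 f" by (rule heat_norm_le[OF t f])
      then show "\<bar>LINT l|spec f. exp (- 2 * t * l)\<bar> \<le> (norm2 f)\<^sup>2"
        using power_mono[OF _ norm_nonneg[OF heat_L2[OF t f]], of "norm2 f" 2]
        by (simp only: heat_norm_power2[OF t f, symmetric] abs_of_nonneg zero_le_power2)
    qed
    moreover have "(LINT l|spec f. exp (- 2 * t * l)) = (norm2 (heat \<Phi> t f))\<^sup>2" if "t \<in> {0..<T}" for t
      using that by (simp add: heat_norm_power2[OF _ f])
    ultimately show "set_integrable lborel {0..<T} (\<lambda>t. h t * (norm2 (heat \<Phi> t f))\<^sup>2)"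
      by (subst set_integrable_cong[OF refl refl, of _ _ "\<lambda>t. h t * (LINT l|spec f. exp (- 2 * t * l))"]) auto
    show "h t * exp (- 2 * t * b) * ?Y\<^sup>2 \<le> h t * (norm2 (heat \<Phi> t f))\<^sup>2" if "t \<in> {0..<T}" for t
      using mult_left_mono[OF heat_norm_power2_ge[OF _ f b, of t a] weight_nonneg[OF h that]] that by (simp add: mult.assoc)
  qed
  also have "\<dots> \<le> (LBINT t:{0..<T}. (norm2 (cutoff \<omega> (heat \<Phi> t f)))\<^sup>2)" by (rule obs)
  also have "\<dots> \<le> T * Z\<^sup>2"
  \<comment> \<open>If the observed integrand is not integrable, its integral is 0 by convention,
    and the bound holds in that case too.\<close>
  proof (cases "set_integrable lborel {0..<T} (\<lambda>t. (norm2 (cutoff \<omega> (heat \<Phi> t f)))\<^sup>2)")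
    case True
    have "(LBINT t:{0..<T}. (norm2 (cutoff \<omega> (heat \<Phi> t f)))\<^sup>2) \<le> (LBINT t:{0..<T}. Z\<^sup>2)"
    proof (rule set_integral_mono[OF True])
      show "set_integrable lborel {0..<T} (\<lambda>t. Z\<^sup>2)" by (simp add: set_integrable_def integrable_indicator_Ico)
      fix t assume "t \<in> {0..<T}"
      then show "(norm2 (cutoff \<omega> (heat \<Phi> t f)))\<^sup>2 \<le> Z\<^sup>2"
        by (intro power_mono Z norm_nonneg L2_cutoff heat_L2 f \<omega>) auto
    qed
    also have "\<dots> = T * Z\<^sup>2" using T by (simp add: set_lebesgue_integral_def)
    finally show ?thesis .
  next
    case False
    then have "(LBINT t:{0..<T}. (norm2 (cutoff \<omega> (heat \<Phi> t f)))\<^sup>2) = 0"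
      unfolding set_integrable_def set_lebesgue_integral_def by (rule not_integrable_integral_eq)
    then show ?thesis using T by simp
  qed
  finally have "sqrt ((LBINT t:{0..<T}. h t * exp (- 2 * t * b)) * ?Y\<^sup>2) \<le> sqrt (T * Z\<^sup>2)" by (rule real_sqrt_le_mono)
  then show ?thesis using Y Z0 by (simp add: real_sqrt_mult weight_transform_def)
qed

text \<open>On the window the amplification is at least its value at the left end and the damping
  factor is at least its value at the right end; the 2 comes from \<open>cosh\<close>. In terms of
  \<open>spec f\<close> this is an inequality between integrands.\<close>

lemma cosh_window_norm:
  assumes f: "f \<in> H" and ab: "0 \<le> a" and s: "0 < s" and R: "0 \<le> R"
  shows "exp (R * sqrt a) * exp (- s * b) / 2 * norm2 (\<Phi> (indicat_real {a<..b}) f)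
     \<le> norm2 (\<Phi> (indicat_real {a<..b}) (\<Phi> (cosh_heat R s) f))"
proof (rule power2_le_imp_le)
  let ?i = "indicat_real {a<..b}"
  let ?m = "exp (R * sqrt a) * exp (- s * b) / 2"
  have i: "?i \<in> bounded_borel" by (rule bounded_borel_indicator) simp
  note c = bounded_borel_cosh_heat[OF s R]
  have ic: "(\<lambda>l. ?i l * cosh_heat R s l) \<in> bounded_borel" by (rule bounded_borel_mult[OF i c])
  have sq: "(\<lambda>l. (\<phi> l)\<^sup>2) \<in> bounded_borel" if "\<phi> \<in> bounded_borel" for \<phi>
    using bounded_borel_mult[OF that that] by (simp add: power2_eq_square)
  have "(?m * norm2 (\<Phi> ?i f))\<^sup>2 = (LINT l|spec f. ?m\<^sup>2 * (?i l)\<^sup>2)"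
    unfolding power_mult_distrib calc_norm_power2[OF i f] by simp
  also have "\<dots> \<le> (LINT l|spec f. (?i l * cosh_heat R s l)\<^sup>2)"
  proof (rule integral_mono)
    show "integrable (spec f) (\<lambda>l. ?m\<^sup>2 * (?i l)\<^sup>2)" by (intro integrable_mult_right integral_spec f sq i)
    show "integrable (spec f) (\<lambda>l. (?i l * cosh_heat R s l)\<^sup>2)" by (intro integral_spec f sq ic)
    fix l
    show "?m\<^sup>2 * (?i l)\<^sup>2 \<le> (?i l * cosh_heat R s l)\<^sup>2"
    proof (cases "l \<in> {a<..b}")
      case True
      have "exp (R * sqrt a) / 2 \<le> cosh (R * sqrt l)"
      proof -
        have "R * sqrt a \<le> R * sqrt l" using True R by (intro mult_left_mono) auto
        then have "exp (R * sqrt a) \<le> exp (R * sqrt l)" by simp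
        also have "\<dots> \<le> exp (R * sqrt l) + exp (- (R * sqrt l))" by simp
        finally show ?thesis by (simp add: cosh_def)
      qed
      moreover have "exp (- s * b) \<le> exp (- s * l)" using True s by simp
      ultimately have "exp (R * sqrt a) / 2 * exp (- s * b) \<le> cosh_heat R s l"
        unfolding cosh_heat_def by (intro mult_mono) auto
      then have "?m \<le> cosh_heat R s l" by simp
      then have "?m\<^sup>2 \<le> (cosh_heat R s l)\<^sup>2" by (intro power_mono) auto
      then show ?thesis using True by simp
    qed simp
  qed
  also have "\<dots> = (norm2 (\<Phi> (\<lambda>l. ?i l * cosh_heat R s l) f))\<^sup>2" by (rule calc_norm_power2[OF ic f, symmetric])
  also have "norm2 (\<Phi> (\<lambda>l. ?i l * cosh_heat R s l) f) = norm2 (\<Phi> ?i (\<Phi> (cosh_heat R s) f))"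
    by (intro norm_cong calc_mult calc_L2 i c ic f)
  finally show "(?m * norm2 (\<Phi> ?i f))\<^sup>2 \<le> (norm2 (\<Phi> ?i (\<Phi> (cosh_heat R s) f)))\<^sup>2" .
  show "0 \<le> norm2 (\<Phi> ?i (\<Phi> (cosh_heat R s) f))" by (intro norm_nonneg calc_L2 i c f)
qed

text \<open>The heat flow only raises the parameter of \<open>cosh_heat\<close> from
  \<open>s\<close> to \<open>t + s\<close>, so the bounds are uniform in \<open>t\<close>. The part
  of \<open>f\<close> inside \<open>E\<close> is governed by finite propagation. The part outside
  meets the crude multiplier bound, which is affordable only if it is exponentially small. Passing
  from \<open>\<omega>\<close> to \<open>F\<close> discards a null set so that a positive distance
  to \<open>E\<close> makes sense.\<close>

lemma heat_cosh_cutoff_le: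
  assumes dg: "davies_gaffney B M \<Phi>" and E: "E \<in> sets M" and \<omega>: "\<omega> \<in> sets M" and F: "F \<in> sets M"
    and \<omega>F: "emeasure M (\<omega> - F) = 0" "F \<subseteq> \<omega>"
    and r: "r \<le> setdist E F" and R: "0 \<le> R" "R < r" and s: "0 < s" and t: "0 \<le> t" and f: "f \<in> H"
  shows "norm2 (cutoff \<omega> (heat \<Phi> t (\<Phi> (cosh_heat R s) f)))
     \<le> norm2 f / sqrt (1 - (R / r)\<^sup>2) + exp (R\<^sup>2 / (4 * s)) * norm2 (cutoff (- E) f)"
proof -
  have st: "0 < t + s" using s t by simp
  note c = bounded_borel_cosh_heat[OF s R(1)] and c' = bounded_borel_cosh_heat[OF st R(1)]
  have E': "- E \<in> sets M" using E sets.compl_sets[of E M] by (simp add: Compl_eq_Diff_UNIV)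
  let ?g = "\<Phi> (cosh_heat R (t + s)) f"
  let ?g1 = "\<Phi> (cosh_heat R (t + s)) (cutoff E f)" and ?g2 = "\<Phi> (cosh_heat R (t + s)) (cutoff (- E) f)"
  have H: "?g \<in> H" "?g1 \<in> H" "?g2 \<in> H" by (intro calc_L2 c' f L2_cutoff E E')+
  have eq: "(\<lambda>l. exp (- t * l) * cosh_heat R s l) = cosh_heat R (t + s)"
    by (simp add: cosh_heat_def fun_eq_iff algebra_simps flip: exp_add)
  have "AE x in M. heat \<Phi> t (\<Phi> (cosh_heat R s) f) x = ?g x"
    using calc_mult[OF bounded_borel_exp[OF t] c f] unfolding eq heat_def by eventually_elim simp
  moreover have "AE x in M. ?g x = ?g1 x + ?g2 x"
  proof -
    have "f = (\<lambda>x. 1 *\<^sub>R cutoff E f x + cutoff (- E) f x)" using cutoff_Compl[of f _ E] by auto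
    then have "\<Phi> (cosh_heat R (t + s)) f = \<Phi> (cosh_heat R (t + s)) (\<lambda>x. 1 *\<^sub>R cutoff E f x + cutoff (- E) f x)" by (rule arg_cong)
    then show ?thesis using calc_lincomb[OF c' L2_cutoff[OF f E] L2_cutoff[OF f E'], of 1] by simp
  qed
  moreover have "AE x in M. x \<notin> \<omega> - F"
    by (rule AE_not_in) (use \<omega>F \<omega> F in \<open>auto simp: null_sets_def\<close>)
  ultimately have "AE x in M. cutoff \<omega> (heat \<Phi> t (\<Phi> (cosh_heat R s) f)) x = cutoff F ?g1 x + cutoff F ?g2 x"
    by eventually_elim (use \<omega>F(2) in \<open>auto simp: cutoff_def indicator_def\<close>)
  then have "norm2 (cutoff \<omega> (heat \<Phi> t (\<Phi> (cosh_heat R s) f))) = norm2 (\<lambda>x. cutoff F ?g1 x + cutoff F ?g2 x)"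
    by (rule norm_cong) (intro L2_cutoff heat_L2 calc_L2 L2_add c c' E E' F \<omega> f t)+
  also have "\<dots> \<le> norm2 (cutoff F ?g1) + norm2 (cutoff F ?g2)" by (intro norm_triangle L2_cutoff H F)
  also have "\<dots> \<le> norm2 f / sqrt (1 - (R / r)\<^sup>2) + exp (R\<^sup>2 / (4 * s)) * norm2 (cutoff (- E) f)"
  proof (rule add_mono)
    show "norm2 (cutoff F ?g1) \<le> norm2 f / sqrt (1 - (R / r)\<^sup>2)"
      by (rule cosh_heat_cutoff[OF dg E F r R st f])
    have "norm2 (cutoff F ?g2) \<le> norm2 ?g2" by (rule norm_cutoff_le[OF H(3) F])
    also have "\<dots> \<le> exp (R\<^sup>2 / (4 * s)) * norm2 (cutoff (- E) f)"
    proof (rule calc_norm_le[OF c' _ L2_cutoff[OF f E']])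
      fix l :: real assume l: "0 \<le> l"
      have "R\<^sup>2 / (4 * (t + s)) \<le> R\<^sup>2 / (4 * s)" using s t by (intro divide_left_mono) auto
      then have "exp (R\<^sup>2 / (4 * (t + s))) \<le> exp (R\<^sup>2 / (4 * s))" by simp
      then show "\<bar>cosh_heat R (t + s) l\<bar> \<le> exp (R\<^sup>2 / (4 * s))" using cosh_heat_le[OF st l R(1)] by linarith
    qed
    finally show "norm2 (cutoff F ?g2) \<le> exp (R\<^sup>2 / (4 * s)) * norm2 (cutoff (- E) f)" .
  qed
  finally show ?thesis .
qed

end

context l2_heat_kernel
begin

text \<open>Both estimates are operator bounds transferred by \<open>Pop_cutoff_norm_le\<close>:
  off-diagonal smoothing for the complement of the larger ball, ultracontractivity for the whole
  space.\<close>

lemma heat_kernel_localization: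
  assumes dg: "davies_gaffney B M \<Phi>" and uc: "ultracontractive B M \<Phi>" and \<epsilon>: "0 < \<epsilon>"
  obtains K c C m where "0 < K" "0 < c" "0 < C"
    "\<forall>s. 0 < s \<and> s \<le> 1 \<longrightarrow> (AE x in M. x \<in> ball x0 \<epsilon> \<longrightarrow> (\<forall>v\<in>fibre B x.
       norm2 (cutoff (- ball x0 (2 * \<epsilon>)) (Pop p s x v)) \<le> K * exp (- c / s) * fnorm B x v \<and>
       norm2 (Pop p s x v) \<le> C * (1 / s) ^ m * fnorm B x v))"
proof -
  obtain K c where K: "0 < K" "0 < c"
    "\<forall>s g. 0 < s \<and> s \<le> 1 \<and> g \<in> H \<longrightarrow> (AE x in M. x \<in> ball x0 \<epsilon> \<longrightarrow>
       fnorm B x (heat \<Phi> s (cutoff (- ball x0 (2 * \<epsilon>)) g) x) \<le> K * exp (- c / s) * norm2 g)"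
    by (rule heat_off_diagonal[OF dg uc \<epsilon>])
  obtain C m where C: "0 < C" "\<forall>t. 0 < t \<and> t \<le> 1 \<longrightarrow> bounded_2_inf B M (heat \<Phi> t) (C * (1 / t) ^ m)"
    by (rule ultracontractive_power[OF uc])
  show thesis
  proof (rule that[OF K(1,2) C(1)], intro allI impI)
    fix s :: real assume "0 < s \<and> s \<le> 1"
    then have s: "0 < s" "s \<le> 1" by auto
    have "AE x in M. x \<in> ball x0 \<epsilon> \<longrightarrow> (\<forall>v\<in>fibre B x.
       norm2 (cutoff (- ball x0 (2 * \<epsilon>)) (Pop p s x v)) \<le> K * exp (- c / s) * fnorm B x v)"
      by (rule Pop_cutoff_norm_le[OF s(1)]) (use K s in \<open>auto simp: sets_M\<close>)
    moreover have "AE x in M. x \<in> UNIV \<longrightarrow> (\<forall>v\<in>fibre B x.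
       norm2 (cutoff UNIV (Pop p s x v)) \<le> C * (1 / s) ^ m * fnorm B x v)"
    proof (rule Pop_cutoff_norm_le[OF s(1)])
      fix g assume g: "g \<in> H"
      have "AE x in M. fnorm B x (heat \<Phi> s g x) \<le> C * (1 / s) ^ m * norm2 g"
        using C(2) s g unfolding bounded_2_inf_def by blast
      then show "AE x in M. x \<in> UNIV \<longrightarrow> fnorm B x (heat \<Phi> s (cutoff UNIV g) x) \<le> C * (1 / s) ^ m * norm2 g"
        by (simp add: cutoff_def)
    qed (use C s in \<open>auto simp: sets_M\<close>)
    ultimately show "AE x in M. x \<in> ball x0 \<epsilon> \<longrightarrow> (\<forall>v\<in>fibre B x.
       norm2 (cutoff (- ball x0 (2 * \<epsilon>)) (Pop p s x v)) \<le> K * exp (- c / s) * fnorm B x v \<and>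
       norm2 (Pop p s x v) \<le> C * (1 / s) ^ m * fnorm B x v)"
      by eventually_elim (simp add: cutoff_def)
  qed
qed

text \<open>The observability inequality bounds the weight transform times the window mass of each
  kernel section, and the Weyl increment is dominated by a sum of such masses over a basis of one
  fibre. Working with the whole sum avoids selecting a vector whose mass is large, which could vary
  with the window.\<close>

lemma weight_transform_bound:
  assumes dg: "davies_gaffney B M \<Phi>" and uc: "ultracontractive B M \<Phi>" and weyl: "local_weyl_law B M \<Phi> p"
    and ball_pos: "\<And>x r. 0 < r \<Longrightarrow> 0 < emeasure M (ball x r)"
    and \<omega>: "\<omega> \<in> sets M" "0 < emeasure M \<omega>" and T: "0 < T" and h: "admissible_weight T h"
    and obs: "\<And>f. f \<in> H \<Longrightarrow> (LBINT t:{0..<T}. h t * (norm2 (heat \<Phi> t f))\<^sup>2)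
           \<le> (LBINT t:{0..<T}. (norm2 (cutoff \<omega> (heat \<Phi> t f)))\<^sup>2)"
    and r: "emeasure M (ball x0 r \<inter> \<omega>) = 0" and R: "0 \<le> R" "R < r"
  shows "\<exists>A>0. \<forall>l\<ge>0. weight_transform T h l \<le> A * exp (- R * sqrt l)"
proof -
  \<comment> \<open>The argument runs with a radius strictly above \<open>R\<close>, whose surplus
    \<open>geometric_decay\<close> consumes.\<close>
  define R1 where "R1 = (R + r) / 2"
  have R1: "R < R1" "R1 < r" "0 < R1" using R by (auto simp: R1_def)
  \<comment> \<open>With \<open>r - R1 = 4 * \<epsilon>\<close>, the ball \<open>E\<close> of radius
    \<open>2 * \<epsilon>\<close> still has distance at least
    \<open>r' = R1 + 2 * \<epsilon>\<close> from the observed set, which exceeds the radius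
    \<open>R1\<close> of the multiplier.\<close>
  define \<epsilon> where "\<epsilon> = (r - R1) / 4"
  have \<epsilon>: "0 < \<epsilon>" using R1 by (simp add: \<epsilon>_def)
  define r' where "r' = r - 2 * \<epsilon>"
  have r': "R1 < r'" using R1 by (simp add: r'_def \<epsilon>_def field_simps)
  define E where "E = ball x0 (2 * \<epsilon>)"
  define F where "F = \<omega> - ball x0 r"
  have EF: "E \<in> sets M" "F \<in> sets M" using \<omega> by (auto simp: E_def F_def sets_M)
  have null: "emeasure M (\<omega> - F) = 0"
  proof -
    have "\<omega> - F = ball x0 r \<inter> \<omega>" by (auto simp: F_def)
    then show ?thesis using r by simp
  qed
  have dist: "r' \<le> setdist E F"
  proof (rule le_setdistI)
    show "E \<noteq> {}" using \<epsilon> by (auto simp: E_def)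
    show "F \<noteq> {}"
    proof
      assume "F = {}"
      then show False using null \<omega>(2) by simp
    qed
    fix x y assume "x \<in> E" "y \<in> F"
    then have "dist x0 x < 2 * \<epsilon>" "r \<le> dist x0 y" by (auto simp: E_def F_def)
    moreover have "dist x0 y \<le> dist x0 x + dist x y" by (rule dist_triangle)
    ultimately show "r' \<le> dist x y" unfolding r'_def by linarith
  qed
  obtain K c C m where K: "0 < K" "0 < c" "0 < C" and
    loc: "\<forall>s. 0 < s \<and> s \<le> 1 \<longrightarrow> (AE x in M. x \<in> ball x0 \<epsilon> \<longrightarrow> (\<forall>v\<in>fibre B x.
       norm2 (cutoff (- ball x0 (2 * \<epsilon>)) (Pop p s x v)) \<le> K * exp (- c / s) * fnorm B x v \<and>
       norm2 (Pop p s x v) \<le> C * (1 / s) ^ m * fnorm B x v))"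
    by (rule heat_kernel_localization[OF dg uc \<epsilon>])
  obtain \<alpha> \<kappa> w where \<alpha>: "0 < \<alpha>" "slowly_varying \<kappa>" "\<forall>x. 0 < w x"
    "\<forall>t>0. AE x in M. asymp_equiv (local_counting B M \<Phi> p t x) at_top (\<lambda>l. w x * l powr \<alpha> * \<kappa> l)"
    using weyl unfolding local_weyl_law_def by blast
  \<comment> \<open>For \<open>s = k * \<sigma>\<close> the multiplier bound
    \<open>exp (R1\<^sup>2 / (4 * s))\<close> is then at most \<open>exp (c / \<sigma>)\<close>,
    which the localization factor \<open>exp (- c / \<sigma>)\<close> cancels.\<close>
  define k where "k = R1\<^sup>2 / (4 * c) + 1"
  have k: "0 < k" using K by (simp add: k_def add_nonneg_pos)
  define C1 where "C1 = 1 / sqrt (1 - (R1 / r')\<^sup>2)"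
  have C1: "0 \<le> C1"
  proof -
    have "(R1 / r')\<^sup>2 \<le> 1" using R1 r' by (intro power_le_one) auto
    then show ?thesis by (simp add: C1_def)
  qed
  show ?thesis
  proof (rule geometric_decay[OF weight_transform_antimono[OF h] weight_transform_nonneg[OF h] R(1) R1(1), where m="2 * m"])
    fix a :: real assume a: "1 < a"
    \<comment> \<open>The inverse of the upper end of the window. There are only countably many such
      times, so their exceptional sets combine into one null set.\<close>
    define \<sigma> where "\<sigma> n = 1 / a ^ Suc n" for n
    have \<sigma>: "0 < \<sigma> n" "\<sigma> n \<le> 1" "\<sigma> n * a ^ Suc n = 1" for n
      using a one_le_power[of a "Suc n"] by (auto simp: \<sigma>_def simp del: power_Suc)
    have AE1: "AE x in M. \<forall>n. x \<in> ball x0 \<epsilon> \<longrightarrow> (\<forall>v\<in>fibre B x.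
       norm2 (cutoff (- E) (Pop p (\<sigma> n) x v)) \<le> K * exp (- c / \<sigma> n) * fnorm B x v \<and>
       norm2 (Pop p (\<sigma> n) x v) \<le> C * (1 / \<sigma> n) ^ m * fnorm B x v)"
      unfolding AE_all_countable E_def using loc \<sigma> by blast
    have AE2: "AE x in M. \<forall>n. \<forall>v\<in>fibre B x. Pop p (\<sigma> n) x v \<in> H"
      unfolding AE_all_countable using Pop_L2 \<sigma> by blast
    have AE3: "AE x in M. \<forall>v\<in>fibre B x. Pop p (1 / 2) x v \<in> H" by (rule Pop_L2) simp
    have AE4: "AE x in M. \<forall>n. \<sigma> n < 1 / 2 \<longrightarrow> (\<forall>v\<in>fibre B x. AE y in M. Pop p (1 / 2) x v y = heat \<Phi> (1 / 2 - \<sigma> n) (Pop p (\<sigma> n) x v) y)"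
      unfolding AE_all_countable
    proof
      fix n
      show "AE x in M. \<sigma> n < 1 / 2 \<longrightarrow> (\<forall>v\<in>fibre B x. AE y in M. Pop p (1 / 2) x v y = heat \<Phi> (1 / 2 - \<sigma> n) (Pop p (\<sigma> n) x v) y)"
      proof (cases "\<sigma> n < 1 / 2")
        case True
        then show ?thesis using Pop_semigroup[of "1 / 2 - \<sigma> n" "\<sigma> n"] \<sigma>(1)[of n] by simp
      qed simp
    qed
    have AE5: "AE x in M. asymp_equiv (local_counting B M \<Phi> p 1 x) at_top (\<lambda>l. w x * l powr \<alpha> * \<kappa> l)"
      using \<alpha>(4) by simp
    let ?good = "\<lambda>x. (\<forall>n. x \<in> ball x0 \<epsilon> \<longrightarrow> (\<forall>v\<in>fibre B x.
       norm2 (cutoff (- E) (Pop p (\<sigma> n) x v)) \<le> K * exp (- c / \<sigma> n) * fnorm B x v \<and>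
       norm2 (Pop p (\<sigma> n) x v) \<le> C * (1 / \<sigma> n) ^ m * fnorm B x v)) \<and>
       (\<forall>n. \<forall>v\<in>fibre B x. Pop p (\<sigma> n) x v \<in> H) \<and> (\<forall>v\<in>fibre B x. Pop p (1 / 2) x v \<in> H) \<and>
       (\<forall>n. \<sigma> n < 1 / 2 \<longrightarrow> (\<forall>v\<in>fibre B x. AE y in M. Pop p (1 / 2) x v y = heat \<Phi> (1 / 2 - \<sigma> n) (Pop p (\<sigma> n) x v) y)) \<and>
       asymp_equiv (local_counting B M \<Phi> p 1 x) at_top (\<lambda>l. w x * l powr \<alpha> * \<kappa> l)"
    have "AE x in M. ?good x" using AE1 AE2 AE3 AE4 AE5 by (intro AE_conjI)
    \<comment> \<open>The ball has positive measure, so it contains a point at which everything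
      holds. The point may depend on \<open>a\<close>, but it serves all \<open>n\<close>.\<close>
    have "\<exists>x\<in>ball x0 \<epsilon>. ?good x"
    proof (rule ccontr)
      assume no: "\<not> (\<exists>x\<in>ball x0 \<epsilon>. ?good x)"
      have "AE x in M. x \<notin> ball x0 \<epsilon>" using \<open>AE x in M. ?good x\<close>
        by (rule eventually_mono) (use no in blast)
      then have "emeasure M (ball x0 \<epsilon>) = 0"
        by (subst (asm) AE_iff_measurable[of "ball x0 \<epsilon>"]) (auto simp: sets_M)
      then show False using ball_pos[OF \<epsilon>, of x0] by simp
    qed
    then obtain x where x: "x \<in> ball x0 \<epsilon>" and good: "?good x" by blast
    have g1: "norm2 (cutoff (- E) (Pop p (\<sigma> n) x v)) \<le> K * exp (- c / \<sigma> n) * fnorm B x v"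
      "norm2 (Pop p (\<sigma> n) x v) \<le> C * (1 / \<sigma> n) ^ m * fnorm B x v" "Pop p (\<sigma> n) x v \<in> H"
      if "v \<in> fibre B x" for n v using good x that by blast+
    have g2: "\<forall>v\<in>fibre B x. Pop p (1 / 2) x v \<in> H" using good by blast
    have g3: "\<forall>v\<in>fibre B x. AE y in M. Pop p (1 / 2) x v y = heat \<Phi> (1 / 2 - \<sigma> n) (Pop p (\<sigma> n) x v) y"
      if "\<sigma> n < 1 / 2" for n using good that by blast
    have g4: "asymp_equiv (local_counting B M \<Phi> p 1 x) at_top (\<lambda>l. w x * l powr \<alpha> * \<kappa> l)" using good by blast
    obtain b e where b: "b \<subseteq> fibre B x" "e ` b \<subseteq> fibre B x" and count:
      "\<forall>l. local_counting B M \<Phi> p 1 x l =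
        (\<Sum>v\<in>b. \<Phi> (\<lambda>u. indicat_real {0..l} u * exp (1 * u)) (Pop p (1 / 2) x v) \<odot> Pop p (1 / 2) x (e v))"
      by (rule local_counting_eq[OF zero_less_one g2])
    obtain \<delta> n1 where \<delta>: "0 < \<delta>" "\<forall>n\<ge>n1. \<delta> \<le> local_counting B M \<Phi> p 1 x (a ^ Suc n) - local_counting B M \<Phi> p 1 x (a ^ n)"
      by (rule counting_increment[OF g4 \<alpha>(3)[rule_format] \<alpha>(1,2) a])
    obtain n2 where n2: "2 < a ^ n2" using real_arch_pow[OF a] by blast
    have \<sigma>2: "\<sigma> n < 1 / 2" if "n2 \<le> n" for n
    proof -
      have "a ^ n2 \<le> a ^ Suc n" using that a by (intro power_increasing) auto
      then show ?thesis using n2 by (simp add: \<sigma>_def field_simps del: power_Suc)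
    qed
    \<comment> \<open>The first summand comes from the section inside \<open>E\<close>, the second
      from its small remainder outside.\<close>
    define Z where "Z = C1 * C + K"
    have Z: "0 \<le> Z" using C1 K by (simp add: Z_def)
    have window: "weight_transform T h (a ^ Suc n) * (exp (R1 * sqrt (a ^ n)) * exp (- k) / 2 * norm2 (\<Phi> (indicat_real {a ^ n<..a ^ Suc n}) (Pop p (\<sigma> n) x v)))
        \<le> sqrt T * (Z * (a ^ Suc n) ^ m * fnorm B x v)" if v: "v \<in> fibre B x" for n v
    proof -
      define s where "s = k * \<sigma> n"
      have s: "0 < s" using k \<sigma>(1)[of n] by (simp add: s_def)
      define P where "P = Pop p (\<sigma> n) x v"
      have P: "P \<in> H" using g1(3)[OF v] by (simp add: P_def)
      define f where "f = \<Phi> (cosh_heat R1 s) P"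
      have f: "f \<in> H" unfolding f_def by (intro calc_L2 bounded_borel_cosh_heat P s) (use R1 in simp)
      have an: "0 \<le> a ^ n" "1 \<le> a ^ Suc n" using a one_le_power[of a "Suc n"] by auto
      have \<sigma>inv: "1 / \<sigma> n = a ^ Suc n" by (simp add: \<sigma>_def)
      have ub: "norm2 (cutoff \<omega> (heat \<Phi> t f)) \<le> Z * (a ^ Suc n) ^ m * fnorm B x v" if t: "0 \<le> t" for t
      proof -
        have "norm2 (cutoff \<omega> (heat \<Phi> t f)) \<le> norm2 P / sqrt (1 - (R1 / r')\<^sup>2) + exp (R1\<^sup>2 / (4 * s)) * norm2 (cutoff (- E) P)"
          unfolding f_def
          by (rule heat_cosh_cutoff_le[OF dg EF(1) \<omega>(1) EF(2) null _ dist _ r' s t P]) (use R1 in \<open>auto simp: F_def\<close>)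
        also have "norm2 P / sqrt (1 - (R1 / r')\<^sup>2) = C1 * norm2 P" by (simp add: C1_def)
        also have "\<dots> \<le> C1 * (C * (a ^ Suc n) ^ m * fnorm B x v)"
          using g1(2)[OF v, of n] C1 unfolding \<sigma>inv P_def[symmetric] by (intro mult_left_mono)
        also have "exp (R1\<^sup>2 / (4 * s)) * norm2 (cutoff (- E) P) \<le> exp (R1\<^sup>2 / (4 * s)) * (K * exp (- c / \<sigma> n) * fnorm B x v)"
          using g1(1)[OF v, of n] unfolding P_def[symmetric] by (intro mult_left_mono) auto
        also have "\<dots> \<le> K * (a ^ Suc n) ^ m * fnorm B x v"
        proof -
          have "R1\<^sup>2 / (4 * c) \<le> k" by (simp add: k_def)
          then have "R1\<^sup>2 \<le> 4 * (c * k)" using K(2) by (simp add: pos_divide_le_eq mult_ac)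
          then have "R1\<^sup>2 / (4 * s) \<le> c / \<sigma> n"
            using \<sigma>(1)[of n] k by (simp add: s_def divide_simps)
          then have "exp (R1\<^sup>2 / (4 * s)) * exp (- c / \<sigma> n) \<le> 1" by (simp flip: exp_add)
          moreover have "1 \<le> (a ^ Suc n) ^ m" by (rule one_le_power[OF an(2)])
          ultimately have "exp (R1\<^sup>2 / (4 * s)) * exp (- c / \<sigma> n) \<le> (a ^ Suc n) ^ m" by (rule order_trans)
          from mult_right_mono[OF mult_left_mono[OF this, of K], of "fnorm B x v"] show ?thesis
            using K(1) v by (simp add: mult_ac del: power_Suc)
        qed
        finally show ?thesis by (simp add: Z_def distrib_right mult.assoc del: power_Suc)
      qed
      have wt: "0 \<le> weight_transform T h (a ^ Suc n)" by (rule weight_transform_nonneg[OF h])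
      \<comment> \<open>At the upper end of the window the damping therefore costs only
        \<open>exp (- k)\<close>.\<close>
      have "s * a ^ Suc n = k" using \<sigma>(3)[of n] by (simp add: s_def mult.assoc del: power_Suc)
      then have "exp (R1 * sqrt (a ^ n)) * exp (- k) / 2 * norm2 (\<Phi> (indicat_real {a ^ n<..a ^ Suc n}) P)
          \<le> norm2 (\<Phi> (indicat_real {a ^ n<..a ^ Suc n}) f)"
        using cosh_window_norm[OF P an(1) s less_imp_le[OF R1(3)], of "a ^ Suc n"] unfolding f_def[symmetric]
        by (simp only: mult_minus_left)
      from mult_left_mono[OF this wt]
      have "weight_transform T h (a ^ Suc n) * (exp (R1 * sqrt (a ^ n)) * exp (- k) / 2 * norm2 (\<Phi> (indicat_real {a ^ n<..a ^ Suc n}) P))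
          \<le> weight_transform T h (a ^ Suc n) * norm2 (\<Phi> (indicat_real {a ^ n<..a ^ Suc n}) f)" .
      also have "\<dots> \<le> sqrt T * (Z * (a ^ Suc n) ^ m * fnorm B x v)"
        by (rule observability_window[OF h T \<omega>(1) f obs[OF f] ub]) (use an in auto)
      finally show ?thesis unfolding P_def .
    qed
    define S where "S = (\<Sum>v\<in>b. fnorm B x v * fnorm B x (e v))"
    have S: "0 \<le> S" unfolding S_def using b by (intro sum_nonneg mult_nonneg_nonneg fnorm_nonneg) auto
    define G where "G = exp 2 * sqrt T * Z * C * S * (2 * exp k) / \<delta>"
    have G: "0 \<le> G" using T Z K S \<delta>(1) by (simp add: G_def)
    have "weight_transform T h (a ^ Suc n) \<le> G * (a ^ Suc n) ^ (2 * m) * exp (- R1 * sqrt (a ^ n))"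
      if n: "max n1 n2 \<le> n" for n
    proof -
      let ?l = "a ^ Suc n" and ?W = "weight_transform T h (a ^ Suc n)"
      let ?\<mu> = "exp (R1 * sqrt (a ^ n)) * exp (- k) / 2"
      let ?X = "\<lambda>v. norm2 (\<Phi> (indicat_real {a ^ n<..a ^ Suc n}) (Pop p (\<sigma> n) x v))"
      have W: "0 \<le> ?W" by (rule weight_transform_nonneg[OF h])
      have an: "0 \<le> a ^ n" "a ^ n \<le> ?l" using a by auto
      have inc: "\<delta> \<le> (\<Sum>v\<in>b. exp 2 * ?X v * norm2 (Pop p (\<sigma> n) x (e v)))"
      proof -
        have "\<delta> \<le> local_counting B M \<Phi> p 1 x ?l - local_counting B M \<Phi> p 1 x (a ^ n)"
          using \<delta>(2) n by auto
        also have "\<dots> = (\<Sum>v\<in>b. \<Phi> (\<lambda>u. indicat_real {0..?l} u * exp (1 * u)) (Pop p (1 / 2) x v) \<odot> Pop p (1 / 2) x (e v)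
            - \<Phi> (\<lambda>u. indicat_real {0..a ^ n} u * exp (1 * u)) (Pop p (1 / 2) x v) \<odot> Pop p (1 / 2) x (e v))"
          by (simp only: count[rule_format] sum_subtractf)
        also have "\<dots> \<le> (\<Sum>v\<in>b. exp 2 * ?X v * norm2 (Pop p (\<sigma> n) x (e v)))"
        proof (rule sum_mono)
          fix v assume v: "v \<in> b"
          have *: "2 * \<sigma> n * ?l = 2" using \<sigma>(3)[of n] by (simp only: mult.assoc mult_1_right)
          have "\<sigma> n < 1 / 2" using \<sigma>2 n by simp
          from weyl_increment_le[OF g2 _ g3[OF this] \<sigma>(1) this an, of v "e v"] g1(3) b v
          show "\<Phi> (\<lambda>u. indicat_real {0..?l} u * exp (1 * u)) (Pop p (1 / 2) x v) \<odot> Pop p (1 / 2) x (e v)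
            - \<Phi> (\<lambda>u. indicat_real {0..a ^ n} u * exp (1 * u)) (Pop p (1 / 2) x v) \<odot> Pop p (1 / 2) x (e v)
            \<le> exp 2 * ?X v * norm2 (Pop p (\<sigma> n) x (e v))"
            unfolding * by blast
        qed
        finally show ?thesis .
      qed
      \<comment> \<open>Multiplying the lower bound \<open>\<delta>\<close> by the weight and the
        amplification lets \<open>window\<close> be applied to every basis vector inside the sum.
        Each summand is left with two factors \<open>?l ^ m\<close>, one from \<open>window\<close>
        and one from the norm of the second kernel section.\<close>
      have "(?W * ?\<mu>) * \<delta> \<le> (?W * ?\<mu>) * (\<Sum>v\<in>b. exp 2 * ?X v * norm2 (Pop p (\<sigma> n) x (e v)))"
        using W by (intro mult_left_mono inc) auto
      also have "\<dots> = (\<Sum>v\<in>b. exp 2 * ((?W * (?\<mu> * ?X v)) * norm2 (Pop p (\<sigma> n) x (e v))))"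
        unfolding sum_distrib_left by (intro sum.cong refl) (simp only: mult_ac)
      also have "\<dots> \<le> (\<Sum>v\<in>b. exp 2 * ((sqrt T * (Z * ?l ^ m * fnorm B x v)) * (C * ?l ^ m * fnorm B x (e v))))"
      proof (rule sum_mono, rule mult_left_mono, rule mult_mono)
        fix v assume v: "v \<in> b"
        then have vf: "v \<in> fibre B x" "e v \<in> fibre B x" using b by auto
        show "?W * (?\<mu> * ?X v) \<le> sqrt T * (Z * ?l ^ m * fnorm B x v)" by (rule window[OF vf(1)])
        show "norm2 (Pop p (\<sigma> n) x (e v)) \<le> C * ?l ^ m * fnorm B x (e v)"
          using g1(2)[OF vf(2), of n] by (simp add: \<sigma>_def del: power_Suc)
        show "0 \<le> norm2 (Pop p (\<sigma> n) x (e v))" by (rule norm_nonneg[OF g1(3)[OF vf(2)]])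
        show "0 \<le> sqrt T * (Z * ?l ^ m * fnorm B x v)" using T Z a vf by simp
      qed auto
      also have "\<dots> = exp 2 * sqrt T * Z * C * S * ?l ^ (2 * m)"
        unfolding S_def sum_distrib_left sum_distrib_right mult_2 power_add by (intro sum.cong refl) (simp only: mult_ac)
      finally have "?W * (?\<mu> * \<delta>) \<le> exp 2 * sqrt T * Z * C * S * ?l ^ (2 * m)" by (simp only: mult.assoc)
      then have "?W \<le> exp 2 * sqrt T * Z * C * S * ?l ^ (2 * m) / (?\<mu> * \<delta>)"
        using \<delta>(1) by (subst pos_le_divide_eq) auto
      also have "\<dots> = G * ?l ^ (2 * m) * exp (- R1 * sqrt (a ^ n))"
        by (simp add: G_def exp_minus field_simps del: power_Suc)
      finally show ?thesis .
    qed
    then show "\<exists>G\<ge>0. \<exists>n0. \<forall>n\<ge>n0. weight_transform T h (a ^ Suc n) \<le> G * (a ^ Suc n) ^ (2 * m) * exp (- R1 * sqrt (a ^ n))"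
      using G by blast
  qed
qed

end

section \<open>From a single ball to the essential distance\<close>

lemma ess_dist_witness:
  assumes "ennreal \<rho> < max_ess_dist M \<omega>" "0 \<le> \<rho>"
  obtains x r where "\<rho> < r" "emeasure M (ball x r \<inter> \<omega>) = 0"
proof -
  obtain x where "ennreal \<rho> < ess_dist M \<omega> x"
    using assms(1) unfolding max_ess_dist_def less_SUP_iff by blast
  then obtain r where r: "0 < r" "emeasure M (ball x r \<inter> \<omega>) = 0" "ennreal \<rho> < ennreal r"
    unfolding ess_dist_def less_SUP_iff by blast
  have "\<rho> < r" using r(3) assms(2) by (simp add: ennreal_less_iff)
  then show thesis using r(2) by (rule that)
qed

theorem corollary3:
  fixes M :: "'x::{metric_space, second_countable_topology} measure"
    and B :: "('x, 'v::real_vector, 'e::euclidean_space) vbundle"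
    and D :: "('x \<Rightarrow> 'v) set"
    and A :: "('x \<Rightarrow> 'v) \<Rightarrow> ('x \<Rightarrow> 'v)"
    and \<Phi> :: "(real \<Rightarrow> real) \<Rightarrow> ('x \<Rightarrow> 'v) \<Rightarrow> ('x \<Rightarrow> 'v)"
    and p :: "real \<Rightarrow> 'x \<Rightarrow> 'x \<Rightarrow> 'v \<Rightarrow> 'v"
    and \<omega> :: "'x set"
    and T :: real
    and h :: "real \<Rightarrow> real"
  assumes "locally compact (UNIV :: 'x set)"
    and "radon_measure M"
    and "msupport M = UNIV"
    and "\<And>x r. 0 < r \<Longrightarrow> 0 < emeasure M (ball x r) \<and> emeasure M (ball x r) < \<infinity>"
    and "doubling M"
    and "euclidean_bundle B"
    and "selfadjoint_op B M D A"
    and "nonneg_op B M D A"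
    and "functional_calculus B M D A \<Phi>"
    and "ultracontractive B M \<Phi>"
    and "davies_gaffney B M \<Phi>"
    and "heat_kernel B M \<Phi> p"
    and "local_weyl_law B M \<Phi> p"
    and "\<omega> \<in> sets M"
    and "0 < emeasure M \<omega>"
    and "0 < T"
    and "admissible_weight T h"
    and "\<And>f. f \<in> L2 B M \<Longrightarrow>
           (LBINT t:{0..<T}. h t * (l2norm B M (heat \<Phi> t f))\<^sup>2)
           \<le> (LBINT t:{0..<T}. (l2norm B M (cutoff \<omega> (heat \<Phi> t f)))\<^sup>2)"
  shows "(max_ess_dist M \<omega> < \<infinity> \<longrightarrow>
            (\<forall>\<beta>. 0 < \<beta> \<and> \<beta> < 1 \<longrightarrow>
              (\<exists>A'>0. \<forall>l\<ge>0. weight_transform T h l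
                 \<le> A' * exp (- \<beta> * enn2real (max_ess_dist M \<omega>) * sqrt l)))) \<and>
         (max_ess_dist M \<omega> = \<infinity> \<longrightarrow>
            (\<forall>R>0. \<forall>\<beta>. 0 < \<beta> \<and> \<beta> < 1 \<longrightarrow>
              (\<exists>A'>0. \<forall>l\<ge>0. weight_transform T h l
                 \<le> A' * exp (- \<beta> * R * sqrt l))))"
proof -
  interpret l2_heat_kernel M B D A \<Phi> p
  proof
    show "sets M = sets borel" using assms(2) by (simp add: radon_measure_def)
    show "emeasure M (ball x r) < \<infinity>" for x r
      using assms(4)[of r x] by (cases "0 < r") (auto simp: not_less ball_empty)
  qed fact+
  \<comment> \<open>Strict inequality below the supremum produces an actual ball of radius more than
    \<open>\<beta> * R\<close> that misses the observed set up to a null set. Both cases of the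
    theorem are instances.\<close>
  have main: "\<exists>A'>0. \<forall>l\<ge>0. weight_transform T h l \<le> A' * exp (- \<beta> * R * sqrt l)"
    if lt: "ennreal (\<beta> * R) < max_ess_dist M \<omega>" and nn: "0 \<le> \<beta> * R" for \<beta> R :: real
  proof -
    obtain x r where r: "\<beta> * R < r" "emeasure M (ball x r \<inter> \<omega>) = 0"
      by (rule ess_dist_witness[OF lt nn])
    from weight_transform_bound[OF assms(11,10,13) _ assms(14-17) _ r(2) nn r(1)] assms(4,18)
    show ?thesis by (simp only: mult_minus_left)
  qed
  show ?thesis
  proof (intro conjI impI allI)
    fix \<beta> :: real assume fin: "max_ess_dist M \<omega> < \<infinity>" and \<beta>: "0 < \<beta> \<and> \<beta> < 1"
    define L where "L = enn2real (max_ess_dist M \<omega>)"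
    have eL: "max_ess_dist M \<omega> = ennreal L" and L: "0 \<le> L" using fin by (auto simp: L_def)
    show "\<exists>A'>0. \<forall>l\<ge>0. weight_transform T h l \<le> A' * exp (- \<beta> * enn2real (max_ess_dist M \<omega>) * sqrt l)"
      unfolding L_def[symmetric]
    \<comment> \<open>For \<open>L = 0\<close> the inequality \<open>\<beta> * L < L\<close> fails
      and no ball is at hand. The claim is then mere boundedness, which follows from monotonicity;
      adding 1 makes the constant positive.\<close>
    proof (cases "L = 0")
      case True
      have "weight_transform T h l \<le> weight_transform T h 0 + 1" if "0 \<le> l" for l
        using weight_transform_antimono[OF assms(17) order.refl that] by simp
      moreover have "0 < weight_transform T h 0 + 1"
        using weight_transform_nonneg[OF assms(17), of 0] by linarith
      ultimately show "\<exists>A'>0. \<forall>l\<ge>0. weight_transform T h l \<le> A' * exp (- \<beta> * L * sqrt l)"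
        using True by (intro exI[of _ "weight_transform T h 0 + 1"]) simp
    next
      case False
      then have "\<beta> * L < L" using \<beta> L by simp
      then show "\<exists>A'>0. \<forall>l\<ge>0. weight_transform T h l \<le> A' * exp (- \<beta> * L * sqrt l)"
        using \<beta> L by (intro main) (auto simp: eL ennreal_less_iff)
    qed
  next
    fix R \<beta> :: real assume "max_ess_dist M \<omega> = \<infinity>" "0 < R" "0 < \<beta> \<and> \<beta> < 1"
    then show "\<exists>A'>0. \<forall>l\<ge>0. weight_transform T h l \<le> A' * exp (- \<beta> * R * sqrt l)"
      by (intro main) auto
  qed
qed

end
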